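(* For any $\epsilon > 0$, with probability at least $1 - e^{-\Omega(n)}$, as long as $\mathrm{OPT} = \Omega(n)$, the two suggested matchings algorithm achieves approximation ratio $$\frac{\mathrm{ALG}}{\mathrm{OPT}} - \epsilon \; \geq \; \alpha := \frac{ 1 - \tfrac{2}{e^2} }{ \tfrac 4 3 - \tfrac{2}{3e} } \; \approx \; 0.67029 \; > \; 1 - \tfrac 1 e.$$ Moreover, this ratio is tight; specifically, there is a family of instances for which the two suggested matchings algorithm has expected approximation factor at most $\alpha + \epsilon$.
   Context: Online stochastic matching in the i.i.d. model: given a bipartite graph $G=(A,I,E)$ between advertisers $A$ and impression types $I$, integers $e_i$ for $i\in I$, $n=\sum_i e_i$, and the distribution $D$ on $I$ with $\Pr[i]=e_i/n$; $n$ i.i.d. draws from $D$ arrive online, each must be immediately assigned to an adjacent advertiser or left unassigned, each advertiser is assigned at most once, and $\mathrm{OPT}$ is the maximum matching in the realization graph of the drawn impressions. Probabilities are over the random draws. The two suggested matchings (TSM) algorithm (for $e_i=1$; general integer $e_i$ is handled by making $e_i$ copies of type $i$ and naming each arriving impression of type $i$ uniformly at random as one of its copies): build a flow graph with source $s$, edges $(s,a)$ of capacity 2 for all $a\in A$, edges $(a,i)\in E$ directed from $A$ to $I$ with capacity 1, and edges $(i,t)$ to the sink of capacity 2. Compute an integral max flow; the set of edges $(a,i)$ carrying (unit) flow forms a collection of paths and cycles. Color these edges: cycle edges alternately blue and red; odd-length paths alternately blue and red with more blue than red; even-length paths starting and ending at ads alternately blue and red; even-length paths starting and ending at impressions: first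 two edges blue, then alternating red, blue, ..., ending in blue. Online, when impression type $i$ arrives for the first time, try the ad along $i$'s blue edge (if any); the second time, try the ad along $i$'s red edge (if any); assign $i$ to that ad if it is still unassigned, and otherwise (or on the third or later arrival of $i$) make no assignment.
   Formalization: The bound is stated as ALG/OPT ≥ α − ε, i.e. ALG/OPT + ε ≥ α; with the printed sign, ALG/OPT − ε ≥ α for every ε > 0, it is false, for example for ε = 2, since ALG ≤ OPT. *)

theory Defs
  imports "HOL-Probability.Probability"
begin

record ('a, 'i) osm =
  ads :: "'a set"
  imps :: "'i set"
  edges :: "('a \<times> 'i) set"
  freq :: "'i \<Rightarrow> nat"  \<comment> \<open>the integers \<open>e\<^sub>i\<close>\<close>

definition num :: "('a, 'i) osm \<Rightarrow> nat" where
  "num G = (\<Sum>i\<in>imps G. freq G i)"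

definition osm_instance :: "('a, 'i) osm \<Rightarrow> bool" where
  "osm_instance G \<longleftrightarrow>
     finite (ads G) \<and> finite (imps G) \<and> edges G \<subseteq> ads G \<times> imps G \<and> num G > 0"

definition type_pmf :: "('a, 'i) osm \<Rightarrow> 'i pmf" where
  "type_pmf G = embed_pmf (\<lambda>i. if i \<in> imps G then real (freq G i) / real (num G) else 0)"

lemma pmf_type_pmf:
  assumes "osm_instance G"
  shows "pmf (type_pmf G) i = (if i \<in> imps G then real (freq G i) / real (num G) else 0)"
proof -
  let ?p = "\<lambda>i. if i \<in> imps G then real (freq G i) / real (num G) else 0"
  have fin: "finite (imps G)" and pos: "num G > 0"
    using assms by (auto simp: osm_instance_def)
  have "(\<integral>\<^sup>+ x. ennreal (?p x) \<partial>count_space UNIV) = (\<Sum>x\<in>imps G. ennreal (?p x))"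
    by (rule nn_integral_count_space'[OF fin]) auto
  also have "\<dots> = ennreal (\<Sum>x\<in>imps G. ?p x)"
    by (rule sum_ennreal) auto
  also have "(\<Sum>x\<in>imps G. ?p x) = (\<Sum>x\<in>imps G. real (freq G x)) / real (num G)"
    by (simp add: sum_divide_distrib)
  also have "\<dots> = 1"
    using pos by (simp add: num_def flip: of_nat_sum)
  finally show ?thesis
    unfolding type_pmf_def by (intro pmf_embed_pmf) auto
qed

text \<open>
  An arrival is a pair \<open>(i, j)\<close>: a type \<open>i\<close> drawn from \<^const>\<open>type_pmf\<close> together with the
  uniformly random name \<open>j < e\<^sub>i\<close> of one of its copies.  Only the type is relevant for the
  offline optimum; the name is used by the algorithm.
\<close>

definition arrival_pmf :: "('a, 'i) osm \<Rightarrow> ('i \<times> nat) pmf" where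
  "arrival_pmf G = do {
     i \<leftarrow> type_pmf G;
     j \<leftarrow> pmf_of_set {..<freq G i};
     return_pmf (i, j)
   }"

definition arrivals :: "('a, 'i) osm \<Rightarrow> ('i \<times> nat) list pmf" where
  "arrivals G = replicate_pmf (num G) (arrival_pmf G)"

definition copies :: "('a, 'i) osm \<Rightarrow> ('i \<times> nat) set" where
  "copies G = (SIGMA i:imps G. {..<freq G i})"

definition copy_edges :: "('a, 'i) osm \<Rightarrow> ('a \<times> ('i \<times> nat)) set" where
  "copy_edges G = {(a, (i, j)). (a, i) \<in> edges G \<and> j < freq G i}"

definition matching :: "('a \<times> 'b) set \<Rightarrow> bool" where
  "matching M \<longleftrightarrow> inj_on fst M \<and> inj_on snd M"

text \<open>The impression side of the realization graph consists of the positions in the list of draws.\<close>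

definition realization :: "('a, 'i) osm \<Rightarrow> ('i \<times> nat) list \<Rightarrow> ('a \<times> nat) set" where
  "realization G xs = {(a, k). k < length xs \<and> (a, fst (xs ! k)) \<in> edges G}"

definition OPT :: "('a, 'i) osm \<Rightarrow> ('i \<times> nat) list \<Rightarrow> nat" where
  "OPT G xs = Max (card ` {M. M \<subseteq> realization G xs \<and> matching M})"

definition is_flow :: "'v set \<Rightarrow> ('v \<Rightarrow> 'v \<Rightarrow> real) \<Rightarrow> 'v \<Rightarrow> 'v \<Rightarrow> ('v \<Rightarrow> 'v \<Rightarrow> real) \<Rightarrow> bool" where
  "is_flow V c s t f \<longleftrightarrow>
     (\<forall>u v. 0 \<le> f u v \<and> f u v \<le> c u v) \<and>
     (\<forall>v\<in>V - {s, t}. (\<Sum>u\<in>V. f u v) = (\<Sum>w\<in>V. f v w))"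

definition flow_value :: "'v set \<Rightarrow> 'v \<Rightarrow> ('v \<Rightarrow> 'v \<Rightarrow> real) \<Rightarrow> real" where
  "flow_value V s f = (\<Sum>v\<in>V. f s v) - (\<Sum>v\<in>V. f v s)"

definition is_max_flow :: "'v set \<Rightarrow> ('v \<Rightarrow> 'v \<Rightarrow> real) \<Rightarrow> 'v \<Rightarrow> 'v \<Rightarrow> ('v \<Rightarrow> 'v \<Rightarrow> real) \<Rightarrow> bool" where
  "is_max_flow V c s t f \<longleftrightarrow>
     is_flow V c s t f \<and> (\<forall>g. is_flow V c s t g \<longrightarrow> flow_value V s g \<le> flow_value V s f)"

datatype ('a, 'j) node = Source | Ad 'a | Imp 'j | Sink

definition tsm_nodes :: "'a set \<Rightarrow> 'j set \<Rightarrow> ('a, 'j) node set" where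
  "tsm_nodes A J = {Source, Sink} \<union> Ad ` A \<union> Imp ` J"

fun tsm_cap :: "'a set \<Rightarrow> 'j set \<Rightarrow> ('a \<times> 'j) set \<Rightarrow> ('a, 'j) node \<Rightarrow> ('a, 'j) node \<Rightarrow> real" where
  "tsm_cap A J F Source (Ad a) = (if a \<in> A then 2 else 0)"
| "tsm_cap A J F (Ad a) (Imp j) = (if (a, j) \<in> F then 1 else 0)"
| "tsm_cap A J F (Imp j) Sink = (if j \<in> J then 2 else 0)"
| "tsm_cap A J F _ _ = 0"

definition integral_max_flow ::
    "'a set \<Rightarrow> 'j set \<Rightarrow> ('a \<times> 'j) set \<Rightarrow> (('a, 'j) node \<Rightarrow> ('a, 'j) node \<Rightarrow> real) \<Rightarrow> bool" where
  "integral_max_flow A J F f \<longleftrightarrow>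
     is_max_flow (tsm_nodes A J) (tsm_cap A J F) Source Sink f \<and> (\<forall>u v. f u v \<in> \<int>)"

definition flow_edges :: "(('a, 'j) node \<Rightarrow> ('a, 'j) node \<Rightarrow> real) \<Rightarrow> ('a \<times> 'j) set" where
  "flow_edges f = {(a, j). f (Ad a) (Imp j) > 0}"

text \<open>
  Paths and cycles are given by their lists of vertices, \<open>Inl\<close> marking advertisers and \<open>Inr\<close>
  impressions.  Their edge lists follow the same order; for a cycle the closing edge is last.
\<close>

fun edge_between :: "'a + 'j \<Rightarrow> 'a + 'j \<Rightarrow> 'a \<times> 'j" where
  "edge_between (Inl a) (Inr j) = (a, j)"
| "edge_between (Inr j) (Inl a) = (a, j)"
| "edge_between _ _ = undefined"

fun adjacent :: "('a \<times> 'j) set \<Rightarrow> 'a + 'j \<Rightarrow> 'a + 'j \<Rightarrow> bool" where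
  "adjacent H (Inl a) (Inr j) \<longleftrightarrow> (a, j) \<in> H"
| "adjacent H (Inr j) (Inl a) \<longleftrightarrow> (a, j) \<in> H"
| "adjacent H _ _ \<longleftrightarrow> False"

definition path_edges :: "('a + 'j) list \<Rightarrow> ('a \<times> 'j) list" where
  "path_edges vs = map2 edge_between (butlast vs) (tl vs)"

definition cycle_edges :: "('a + 'j) list \<Rightarrow> ('a \<times> 'j) list" where
  "cycle_edges vs = map2 edge_between vs (rotate1 vs)"

definition incident_edges :: "('a \<times> 'j) set \<Rightarrow> ('a + 'j) set \<Rightarrow> ('a \<times> 'j) set" where
  "incident_edges H W = {(a, j) \<in> H. Inl a \<in> W \<or> Inr j \<in> W}"

text \<open>
  A connected component of \<open>H\<close> is a path (cycle) if some path (cycle) contains all edges of \<open>H\<close>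
  incident with its vertices.
\<close>

definition path_component :: "('a \<times> 'j) set \<Rightarrow> ('a + 'j) list \<Rightarrow> bool" where
  "path_component H vs \<longleftrightarrow>
     length vs \<ge> 2 \<and> distinct vs \<and> successively (adjacent H) vs \<and>
     incident_edges H (set vs) = set (path_edges vs)"

definition cycle_component :: "('a \<times> 'j) set \<Rightarrow> ('a + 'j) list \<Rightarrow> bool" where
  "cycle_component H vs \<longleftrightarrow>
     length vs \<ge> 3 \<and> distinct vs \<and> successively (adjacent H) vs \<and> adjacent H (last vs) (hd vs) \<and>
     incident_edges H (set vs) = set (cycle_edges vs)"

text \<open>In the following, \<open>B\<close> is the set of blue edges; all other edges are red.\<close>

definition alternating :: "'e set \<Rightarrow> 'e list \<Rightarrow> bool" where
  "alternating B es \<longleftrightarrow> successively (\<lambda>x y. x \<in> B \<longleftrightarrow> y \<notin> B) es"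

definition alternating_cyclically :: "'e set \<Rightarrow> 'e list \<Rightarrow> bool" where
  "alternating_cyclically B es \<longleftrightarrow> alternating B es \<and> (last es \<in> B \<longleftrightarrow> hd es \<notin> B)"

text \<open>Colours along an even path between impressions: blue, blue, red, blue, red, \<dots>, blue.\<close>

definition impression_pattern :: "'e set \<Rightarrow> 'e list \<Rightarrow> bool" where
  "impression_pattern B es \<longleftrightarrow> (\<forall>k<length es. es ! k \<in> B \<longleftrightarrow> k = 0 \<or> odd k)"

definition tsm_colouring :: "('a \<times> 'j) set \<Rightarrow> ('a \<times> 'j) set \<Rightarrow> ('a \<times> 'j) set \<Rightarrow> bool" where
  "tsm_colouring H B R \<longleftrightarrow>
     B \<union> R = H \<and> B \<inter> R = {} \<and>
     (\<forall>vs. cycle_component H vs \<longrightarrow> alternating_cyclically B (cycle_edges vs)) \<and>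
     (\<forall>vs. path_component H vs \<and> odd (length (path_edges vs)) \<longrightarrow>
        alternating B (path_edges vs) \<and>
        card (set (path_edges vs) \<inter> B) > card (set (path_edges vs) \<inter> R)) \<and>
     (\<forall>vs. path_component H vs \<and> even (length (path_edges vs)) \<and> isl (hd vs) \<and> isl (last vs) \<longrightarrow>
        alternating B (path_edges vs)) \<and>
     (\<forall>vs. path_component H vs \<and> even (length (path_edges vs)) \<and> \<not> isl (hd vs) \<and> \<not> isl (last vs) \<longrightarrow>
        impression_pattern B (path_edges vs) \<or> impression_pattern B (rev (path_edges vs)))"

text \<open>
  The possible outcomes of the offline phase.  Neither the maximum flow nor the colouring is
  uniquely determined.
\<close>

definition tsm_offline ::
    "('a, 'i) osm \<Rightarrow> ('a \<times> ('i \<times> nat)) set \<Rightarrow> ('a \<times> ('i \<times> nat)) set \<Rightarrow> bool" where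
  "tsm_offline G B R \<longleftrightarrow>
     (\<exists>f. integral_max_flow (ads G) (copies G) (copy_edges G) f \<and> tsm_colouring (flow_edges f) B R)"

definition ad_along :: "('a \<times> 'j) set \<Rightarrow> 'j \<Rightarrow> 'a option" where
  "ad_along M j = (if \<exists>a. (a, j) \<in> M then Some (THE a. (a, j) \<in> M) else None)"

text \<open>
  \<open>k\<close> is the number of earlier arrivals of the impression \<open>j\<close>, whether or not they were
  assigned; \<open>T\<close> is the set of ads assigned so far.
\<close>

definition tsm_decide ::
    "('a \<times> 'j) set \<Rightarrow> ('a \<times> 'j) set \<Rightarrow> nat \<Rightarrow> 'a set \<Rightarrow> 'j \<Rightarrow> 'a option" where
  "tsm_decide B R k T j =
     (case (if k = 0 then ad_along B j else if k = 1 then ad_along R j else None) of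
        None \<Rightarrow> None
      | Some a \<Rightarrow> if a \<in> T then None else Some a)"

fun tsm_online ::
    "('a \<times> 'j) set \<Rightarrow> ('a \<times> 'j) set \<Rightarrow> 'j list \<Rightarrow> 'a set \<Rightarrow> 'j list \<Rightarrow> 'a option list" where
  "tsm_online B R past T [] = []"
| "tsm_online B R past T (j # js) =
     (let d = tsm_decide B R (count_list past j) T j
      in d # tsm_online B R (j # past) (T \<union> set_option d) js)"

definition ALG :: "('a \<times> 'j) set \<Rightarrow> ('a \<times> 'j) set \<Rightarrow> 'j list \<Rightarrow> nat" where
  "ALG B R xs = length (filter (\<lambda>d. d \<noteq> None) (tsm_online B R [] {} xs))"

definition tsm_ratio :: real where
  "tsm_ratio = (1 - 2 / exp 1 ^ 2) / (4 / 3 - 2 / (3 * exp 1))"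

end

theory Submission
  imports Defs "HOL-Real_Asymp.Real_Asymp"
begin

text \<open>
  The algorithm matches exactly the ads whose blue impression is drawn or whose red impression is
  drawn twice, so in the limit an ad with \<open>d\<close> coloured edges, \<open>r\<close> of them red, is matched with
  probability \<open>1 - (1 + r) * exp (- d)\<close>.  On the other side, a minimum cut of the flow graph can be
  chosen such that the edges \<open>\<delta>\<close> which cross it from ads \<open>a \<notin> X\<close> to impressions \<open>j \<notin> Y\<close> form a
  matching.  Every edge of the realization graph uses an ad in \<open>X\<close>, an arrival in \<open>Y\<close> or a drawn edge
  of \<open>\<delta>\<close>, so \<open>OPT\<close> is at most about \<open>|X| + |Y| + (1 - 1/e) |\<delta>|\<close>.  The flow saturates the cut, whence it
  has \<open>2 |X| + 2 |Y| + |\<delta>|\<close> edges, and \<open>\<delta>\<close> is an induced matching among them, so up to the ends of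
  paths at most every third edge of a path or cycle belongs to \<open>\<delta>\<close>.  Comparing both counts gives the
  ratio.  All these quantities change by a bounded amount if a single arrival changes, so deviations
  of linear order from their expectations are exponentially unlikely.
\<close>

section \<open>Concentration of functions with bounded differences\<close>

text \<open>The ratio is the value of a small linear program over the degree classes of the ads. Its
  extremal case is a hexagon of flow edges: three ads with one blue and one red edge each give the
  algorithm 3 (1 - 2/e^2), while one ad in \<open>X\<close>, one impression in \<open>Y\<close> and
  two edges in \<delta> allow the optimum 2 + 2 (1 - 1/e). The quotient is \<open>tsm_ratio\<close>,
  and the tight instances are made of such hexagons. The dangerous class is an ad whose only edge is
  red, matched with limiting probability 1 - 2/e alone. The colour rules for paths pair it with an
  ad whose only edge is blue, and they make the only edge of an impression blue. The constants
  \<kappa> and \<open>N\<close> must not depend on the graph. Only a few pairs (d, r) of degrees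
  occur, so convergence to the limits is uniform; the errors are charged to edges, of which there
  are at most 2 n, since the number of ads is not bounded in terms of n. Additive errors of order n
  become relative ones through the assumption that \<open>OPT\<close> is at least c n.\<close>

definition bounded_diff :: "real \<Rightarrow> ('x list \<Rightarrow> real) \<Rightarrow> bool" where
  "bounded_diff c f \<longleftrightarrow> (\<forall>us x y vs. f (us @ x # vs) \<le> f (us @ y # vs) + c)"

lemma bounded_diffD: "bounded_diff c f \<Longrightarrow> f (us @ x # vs) \<le> f (us @ y # vs) + c"
  by (auto simp: bounded_diff_def)

lemma bounded_diff_Cons: "bounded_diff c f \<Longrightarrow> bounded_diff c (\<lambda>xs. f (x # xs))"
  unfolding bounded_diff_def by (metis append_Cons)

lemma bounded_diff_add:
  "bounded_diff c f \<Longrightarrow> bounded_diff d g \<Longrightarrow> bounded_diff (c + d) (\<lambda>xs. f xs + g xs)"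
  unfolding bounded_diff_def by (smt (verit))

lemma bounded_diff_const: "bounded_diff 0 (\<lambda>_. k)"
  by (auto simp: bounded_diff_def)

lemma bounded_diff_mult:
  assumes "bounded_diff c f"
  shows "bounded_diff (\<bar>t\<bar> * c) (\<lambda>xs. t * f xs)"
  unfolding bounded_diff_def
proof (intro allI)
  fix us x y vs
  have "\<bar>f (us @ x # vs) - f (us @ y # vs)\<bar> \<le> c"
    using bounded_diffD[OF assms, of us x vs y] bounded_diffD[OF assms, of us y vs x] by linarith
  then have "\<bar>t\<bar> * \<bar>f (us @ x # vs) - f (us @ y # vs)\<bar> \<le> \<bar>t\<bar> * c"
    by (intro mult_left_mono) auto
  then have "\<bar>t * f (us @ x # vs) - t * f (us @ y # vs)\<bar> \<le> \<bar>t\<bar> * c"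
    by (simp flip: abs_mult right_diff_distrib)
  then show "t * f (us @ x # vs) \<le> t * f (us @ y # vs) + \<bar>t\<bar> * c" by linarith
qed

lemma finite_set_replicate_pmf:
  assumes "finite (set_pmf p)" shows "finite (set_pmf (replicate_pmf n p))"
  using finite_lists_length_eq[OF assms, of n]
  by (rule rev_finite_subset) (auto simp: set_replicate_pmf)

lemma integrable_replicate_pmf:
  fixes f :: "'x list \<Rightarrow> real"
  assumes "finite (set_pmf p)" shows "integrable (replicate_pmf n p) f"
  by (intro integrable_measure_pmf_finite finite_set_replicate_pmf assms)

lemma expectation_replicate_pmf_Suc:
  fixes f :: "'x list \<Rightarrow> real"
  assumes fin: "finite (set_pmf p)"
  shows "measure_pmf.expectation (replicate_pmf (Suc n) p) f =
    measure_pmf.expectation p (\<lambda>x. measure_pmf.expectation (replicate_pmf n p) (\<lambda>xs. f (x # xs)))"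
proof -
  have "replicate_pmf (Suc n) p = p \<bind> (\<lambda>x. map_pmf (\<lambda>xs. x # xs) (replicate_pmf n p))"
    by (simp add: map_pmf_def)
  then show ?thesis
    by (simp only: pmf_expectation_bind[OF fin, of "\<lambda>x. map_pmf (\<lambda>xs. x # xs) (replicate_pmf n p)"]
         integral_map_pmf set_map_pmf finite_imageI finite_set_replicate_pmf[OF fin] order_refl)
       (subst integral_measure_pmf[OF fin], auto)
qed

text \<open>McDiarmid's argument by induction on the number of draws: Hoeffding's lemma is applied
  to the conditional expectation \<open>g\<close> given the first draw, and the induction hypothesis
  to the other draws with the first one fixed.\<close>

lemma mgf_bounded_diff:
  fixes f :: "'x list \<Rightarrow> real"
  assumes fin: "finite (set_pmf p)" and l: "l > 0" and bd: "bounded_diff c f"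
  shows "measure_pmf.expectation (replicate_pmf n p)
      (\<lambda>xs. exp (l * (f xs - measure_pmf.expectation (replicate_pmf n p) f)))
    \<le> exp (l\<^sup>2 * c\<^sup>2 / 2) ^ n"
  using bd
proof (induction n arbitrary: f)
  case 0
  then show ?case by simp
next
  case (Suc n)
  let ?E = "measure_pmf.expectation (replicate_pmf n p)"
  define g where "g x = ?E (\<lambda>xs. f (x # xs))" for x
  define \<mu> where "\<mu> = measure_pmf.expectation p g"
  have \<mu>: "measure_pmf.expectation (replicate_pmf (Suc n) p) f = \<mu>"
    unfolding \<mu>_def g_def by (rule expectation_replicate_pmf_Suc[OF fin])
  have int: "integrable (replicate_pmf n p) h" for h :: "'x list \<Rightarrow> real"
    by (rule integrable_replicate_pmf[OF fin])
  have g_le: "g x \<le> g y + c" for x y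
  proof -
    have "g x \<le> ?E (\<lambda>xs. f (y # xs) + c)"
      unfolding g_def
      by (intro integral_mono int) (use bounded_diffD[OF Suc.prems, of "[]"] in simp)
    also have "\<dots> = g y + c"
      unfolding g_def by (subst Bochner_Integration.integral_add[OF int int]) simp
    finally show ?thesis .
  qed
  \<comment> \<open>Any reference point will do, since bounded differences are required of all
    values and not only of the support. All values of \<open>g\<close> lie within \<open>c\<close>
    of \<open>g x0\<close>; the interval has width \<open>2 * c\<close>, hence the exponent with
    \<open>(2 * c)^2 / 8 = c^2 / 2\<close>. The sharp width \<open>c\<close> would only improve the
    constant.\<close>
  define x0 :: 'x where "x0 = undefined"
  interpret ib: interval_bounded_random_variable "measure_pmf p" g "g x0 - c" "g x0 + c"
  proof
    show "AE x in measure_pmf p. g x \<in> {g x0 - c..g x0 + c}"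
      using g_le[of _ x0] g_le[of x0] by (intro AE_pmfI) (auto simp: algebra_simps)
  qed auto
  have "ennreal (measure_pmf.expectation p (\<lambda>x. exp (l * (g x - \<mu>))))
      = nn_integral p (\<lambda>x. ennreal (exp (l * (g x - \<mu>))))"
    by (subst nn_integral_eq_integral) (auto intro: integrable_measure_pmf_finite fin)
  also have "\<dots> \<le> ennreal (exp (l\<^sup>2 * (g x0 + c - (g x0 - c))\<^sup>2 / 8))"
    unfolding \<mu>_def by (rule ib.Hoeffdings_lemma_nn_integral[OF l])
  also have "l\<^sup>2 * (g x0 + c - (g x0 - c))\<^sup>2 / 8 = l\<^sup>2 * c\<^sup>2 / 2"
    by (simp add: power2_eq_square)
  finally have hoeff: "measure_pmf.expectation p (\<lambda>x. exp (l * (g x - \<mu>))) \<le> exp (l\<^sup>2 * c\<^sup>2 / 2)"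
    by simp
  have inner: "?E (\<lambda>xs. exp (l * (f (x # xs) - \<mu>)))
      \<le> exp (l * (g x - \<mu>)) * exp (l\<^sup>2 * c\<^sup>2 / 2) ^ n" for x
  proof -
    have "?E (\<lambda>xs. exp (l * (f (x # xs) - \<mu>)))
        = ?E (\<lambda>xs. exp (l * (g x - \<mu>)) * exp (l * (f (x # xs) - g x)))"
      by (simp flip: exp_add add: algebra_simps)
    also have "\<dots> = exp (l * (g x - \<mu>)) * ?E (\<lambda>xs. exp (l * (f (x # xs) - g x)))"
      by simp
    also have "\<dots> \<le> exp (l * (g x - \<mu>)) * exp (l\<^sup>2 * c\<^sup>2 / 2) ^ n"
      using Suc.IH[OF bounded_diff_Cons[OF Suc.prems], of x]
      by (intro mult_left_mono) (auto simp: g_def)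
    finally show ?thesis .
  qed
  have "measure_pmf.expectation (replicate_pmf (Suc n) p) (\<lambda>xs. exp (l * (f xs - \<mu>)))
      = measure_pmf.expectation p (\<lambda>x. ?E (\<lambda>xs. exp (l * (f (x # xs) - \<mu>))))"
    by (rule expectation_replicate_pmf_Suc[OF fin])
  also have "\<dots> \<le> measure_pmf.expectation p (\<lambda>x. exp (l * (g x - \<mu>)) * exp (l\<^sup>2 * c\<^sup>2 / 2) ^ n)"
    by (intro integral_mono integrable_measure_pmf_finite fin inner)
  also have "\<dots> = measure_pmf.expectation p (\<lambda>x. exp (l * (g x - \<mu>))) * exp (l\<^sup>2 * c\<^sup>2 / 2) ^ n"
    by simp
  also have "\<dots> \<le> exp (l\<^sup>2 * c\<^sup>2 / 2) * exp (l\<^sup>2 * c\<^sup>2 / 2) ^ n"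
    by (intro mult_right_mono hoeff) auto
  finally show ?case by (simp only: \<mu> power_Suc)
qed

lemma bounded_diff_tail:
  fixes f :: "'x list \<Rightarrow> real"
  assumes fin: "finite (set_pmf p)" and bd: "bounded_diff c f" and c: "c > 0" and t: "t > 0"
  shows "measure_pmf.prob (replicate_pmf n p)
      {xs. f xs \<ge> measure_pmf.expectation (replicate_pmf n p) f + t * real n}
    \<le> exp (- (t\<^sup>2 / (2 * c\<^sup>2)) * real n)"
proof -
  let ?M = "replicate_pmf n p"
  define \<mu> where "\<mu> = measure_pmf.expectation ?M f"
  \<comment> \<open>The minimiser of the Chernoff exponent
    \<open>l^2 * c^2 / 2 - l * t\<close>.\<close>
  define l where "l = t / c\<^sup>2"
  have l: "l > 0" using c t by (simp add: l_def)
  let ?h = "\<lambda>xs. exp (l * (f xs - \<mu>))"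
  have "measure_pmf.prob ?M {xs. f xs \<ge> \<mu> + t * n} \<le> measure_pmf.prob ?M {xs \<in> space ?M. ?h xs \<ge> exp (l * t * n)}"
    using l by (intro measure_pmf.finite_measure_mono) (auto simp: mult.assoc intro!: mult_left_mono)
  also have "\<dots> \<le> (\<integral>xs. ?h xs \<partial>?M) / exp (l * t * n)"
    by (intro integral_Markov_inequality_measure[where A = "{}"] integrable_replicate_pmf fin) auto
  also have "\<dots> \<le> exp (l\<^sup>2 * c\<^sup>2 / 2) ^ n / exp (l * t * n)"
    unfolding \<mu>_def by (intro divide_right_mono mgf_bounded_diff fin l bd) auto
  also have "\<dots> = exp (n * (l\<^sup>2 * c\<^sup>2 / 2) - l * t * n)"
    by (simp only: exp_diff exp_of_nat_mult)
  also have "n * (l\<^sup>2 * c\<^sup>2 / 2) - l * t * n = - (t\<^sup>2 / (2 * c\<^sup>2)) * real n"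
    using c by (simp add: l_def field_simps power2_eq_square)
  finally show ?thesis by (simp add: \<mu>_def)
qed

section \<open>Independent uniform arrivals\<close>

lemma finite_copies: "osm_instance G \<Longrightarrow> finite (copies G)"
  by (auto simp: osm_instance_def copies_def)

lemma card_copies: "osm_instance G \<Longrightarrow> card (copies G) = num G"
  by (simp add: osm_instance_def copies_def num_def)

lemma copies_nonempty: "osm_instance G \<Longrightarrow> copies G \<noteq> {}"
  using card_copies[of G] by (auto simp: osm_instance_def)

text \<open>A type has weight e_i / n and each of its names weight 1 / e_i, so the frequencies
  cancel. This reduces general frequencies to n uniform draws from n copies. Types of frequency 0,
  where \<open>pmf_of_set\<close> is applied to the empty set, have weight 0.\<close>

lemma arrival_pmf_eq:
  assumes G: "osm_instance G"
  shows "arrival_pmf G = pmf_of_set (copies G)"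
proof (rule pmf_eqI)
  fix x :: "'b \<times> nat"
  obtain i j where x: "x = (i, j)" by (cases x)
  have fin: "finite (imps G)" and pos: "num G > 0" using G by (auto simp: osm_instance_def)
  have sub: "set_pmf (type_pmf G) \<subseteq> imps G"
    by (auto simp: set_pmf_eq pmf_type_pmf[OF G] split: if_splits)
  let ?q = "\<lambda>i. pmf_of_set {..<freq G i} \<bind> (\<lambda>j. return_pmf (i, j))"
  have q: "?q i' = map_pmf (Pair i') (pmf_of_set {..<freq G i'})" for i'
    by (simp add: map_pmf_def)
  have "pmf (arrival_pmf G) x = (\<integral>i'. pmf (?q i') x \<partial>type_pmf G)"
    by (simp add: arrival_pmf_def pmf_bind)
  also have "\<dots> = (\<Sum>i'\<in>imps G. pmf (type_pmf G) i' * pmf (?q i') x)"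
    by (subst integral_measure_pmf[OF fin]) (use sub in auto)
  also have "\<dots> = (\<Sum>i'\<in>imps G. if i' = i then pmf (type_pmf G) i * pmf (?q i) x else 0)"
  proof (intro sum.cong refl)
    fix i' assume "i' \<in> imps G"
    have "pmf (?q i') x = 0" if "i' \<noteq> i"
      unfolding q using that by (intro pmf_map_outside) (auto simp: x)
    then show "pmf (type_pmf G) i' * pmf (?q i') x
        = (if i' = i then pmf (type_pmf G) i * pmf (?q i) x else 0)" by auto
  qed
  also have "\<dots> = (if i \<in> imps G then pmf (type_pmf G) i * pmf (?q i) x else 0)"
    using fin by (simp add: sum.delta)
  also have "\<dots> = indicator (copies G) x / card (copies G)"
  proof (cases "i \<in> imps G \<and> freq G i > 0")
    case True
    have "pmf (?q i) x = pmf (pmf_of_set {..<freq G i}) j"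
      unfolding q x by (intro pmf_map_inj') (auto simp: inj_on_def)
    then show ?thesis using True pos
      by (auto simp: pmf_type_pmf[OF G] x copies_def card_copies[OF G, unfolded copies_def]
            indicator_def lessThan_empty_iff)
  next
    case False
    then show ?thesis by (auto simp: pmf_type_pmf[OF G] x copies_def)
  qed
  also have "\<dots> = pmf (pmf_of_set (copies G)) x"
    by (simp add: finite_copies[OF G] copies_nonempty[OF G])
  finally show "pmf (arrival_pmf G) x = pmf (pmf_of_set (copies G)) x" .
qed

lemma arrivals_eq: "osm_instance G \<Longrightarrow> arrivals G = replicate_pmf (num G) (pmf_of_set (copies G))"
  by (simp add: arrivals_def arrival_pmf_eq)

lemma set_arrivals:
  "osm_instance G \<Longrightarrow> set_pmf (arrivals G) = {xs. set xs \<subseteq> copies G \<and> length xs = num G}"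
  by (auto simp: arrivals_eq set_replicate_pmf finite_copies copies_nonempty)

locale uniform_draws =
  fixes C :: "'j set"
  assumes finite_C: "finite C" and nonempty_C: "C \<noteq> {}"
begin

abbreviation "draws n \<equiv> replicate_pmf n (pmf_of_set C)"
abbreviation E :: "nat \<Rightarrow> ('j list \<Rightarrow> real) \<Rightarrow> real" where
  "E n \<equiv> measure_pmf.expectation (draws n)"

lemma fin_pmf: "finite (set_pmf (pmf_of_set C))"
  by (simp add: finite_C nonempty_C)

lemma card_C_pos: "real (card C) > 0"
  using finite_C nonempty_C by (simp add: card_gt_0_iff)

lemma int: "integrable (draws n) (f :: _ \<Rightarrow> real)"
  by (rule integrable_replicate_pmf[OF fin_pmf])

lemma E_Suc: "E (Suc n) f = (\<Sum>x\<in>C. E n (\<lambda>xs. f (x # xs))) / card C" for f :: "_ \<Rightarrow> real"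
  by (simp add: expectation_replicate_pmf_Suc[OF fin_pmf] integral_pmf_of_set finite_C nonempty_C
      del: replicate_pmf.simps)

lemma E_avoid:
  assumes "S \<subseteq> C"
  shows "E n (\<lambda>xs. of_bool (set xs \<inter> S = {})) = (1 - card S / card C) ^ n"
proof (induction n)
  case (Suc n)
  have "E n (\<lambda>xs. of_bool (set (x # xs) \<inter> S = {}))
      = of_bool (x \<notin> S) * (1 - card S / card C) ^ n" for x
    by (cases "x \<in> S") (simp_all add: Suc.IH)
  then have "E (Suc n) (\<lambda>xs. of_bool (set xs \<inter> S = {}))
      = (\<Sum>x\<in>C. of_bool (x \<notin> S)) * (1 - card S / card C) ^ n / card C"
    by (simp only: E_Suc sum_distrib_right)
  also have "(\<Sum>x\<in>C. of_bool (x \<notin> S)) = real (card (C - S))"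
    using finite_C by (simp add: of_bool_def sum.If_cases) (auto intro!: arg_cong[where f = card])
  also have "real (card (C - S)) = real (card C) - real (card S)"
    using assms finite_C
    by (simp add: card_Diff_subset finite_subset card_mono of_nat_diff)
  finally show ?case using card_C_pos by (simp add: field_simps)
qed simp

text \<open>A single draw avoids both \<open>S\<close> and \<open>j\<close> with probability
  \<open>r\<close>. Either all draws do so, or exactly one of the \<open>n\<close> positions holds
  \<open>j\<close> and the others avoid both.\<close>

lemma E_avoid_once:
  assumes "S \<subseteq> C" "j \<in> C - S"
  defines "r \<equiv> 1 - real (card S + 1) / card C"
  shows "E n (\<lambda>xs. of_bool (set xs \<inter> S = {} \<and> count_list xs j \<le> 1))
    = r ^ n + n / card C * r ^ (n - 1)"
proof (induction n)
  case (Suc n)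
  have fS: "finite S" using assms finite_C by (auto intro: finite_subset)
  have av: "E n (\<lambda>xs. of_bool (set xs \<inter> insert j S = {})) = r ^ n"
    using E_avoid[of "insert j S" n] assms fS by simp
  define q where "q = E n (\<lambda>xs. of_bool (set xs \<inter> S = {} \<and> count_list xs j \<le> 1))"
  have q: "q = r ^ n + n / card C * r ^ (n - 1)" unfolding q_def by (rule Suc.IH)
  have *: "E n (\<lambda>xs. of_bool (set (x # xs) \<inter> S = {} \<and> count_list (x # xs) j \<le> 1))
      = of_bool (x \<notin> insert j S) * q + of_bool (x = j) * r ^ n" for x
  proof (cases "x = j")
    case True
    have "set (j # xs) \<inter> S = {} \<and> count_list (j # xs) j \<le> 1 \<longleftrightarrow> set xs \<inter> insert j S = {}" for xs
      using assms by (auto simp: count_list_0_iff)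
    then show ?thesis by (simp only: True av) simp
  next
    case False
    then show ?thesis by (cases "x \<in> S") (simp_all add: q_def)
  qed
  have "E (Suc n) (\<lambda>xs. of_bool (set xs \<inter> S = {} \<and> count_list xs j \<le> 1))
      = ((\<Sum>x\<in>C. of_bool (x \<notin> insert j S)) * q + (\<Sum>x\<in>C. of_bool (x = j)) * r ^ n) / card C"
    by (simp only: E_Suc * sum.distrib sum_distrib_right)
  also have "(\<Sum>x\<in>C. of_bool (x \<notin> insert j S)) = real (card (C - insert j S))"
    using finite_C by (simp add: of_bool_def sum.If_cases) (auto intro!: arg_cong[where f = card])
  also have "real (card (C - insert j S)) = real (card C) - real (card (insert j S))"
  proof -
    have "card (insert j S) \<le> card C" using assms finite_C by (intro card_mono) auto
    then show ?thesis using assms fS by (subst card_Diff_subset) (auto simp: of_nat_diff)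
  qed
  also have "\<dots> = card C * r" using assms fS card_C_pos by (simp add: r_def field_simps)
  also have "(\<Sum>x\<in>C. of_bool (x = j)) = (1 :: real)"
    using finite_C assms by (simp add: of_bool_def sum.delta)
  finally have "E (Suc n) (\<lambda>xs. of_bool (set xs \<inter> S = {} \<and> count_list xs j \<le> 1))
      = (card C * r * q + 1 * r ^ n) / card C" .
  also have "\<dots> = r * (r ^ n + n / card C * r ^ (n - 1)) + r ^ n / card C"
    unfolding q[symmetric] using card_C_pos by (simp add: field_simps)
  also have "\<dots> = r ^ Suc n + Suc n / card C * r ^ n"
    using card_C_pos by (cases n) (simp_all add: field_simps)
  finally show ?case by simp
qed simp

lemma E_count:
  assumes "Y \<subseteq> C"
  shows "E n (\<lambda>xs. real (length (filter (\<lambda>x. x \<in> Y) xs))) = n * card Y / card C"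
proof (induction n)
  case (Suc n)
  let ?L = "\<lambda>xs. real (length (filter (\<lambda>x. x \<in> Y) xs))"
  have "E n (\<lambda>xs. ?L (x # xs)) = of_bool (x \<in> Y) + n * card Y / card C" for x
  proof -
    have "E n (\<lambda>xs. ?L (x # xs)) = E n (\<lambda>xs. of_bool (x \<in> Y) + ?L xs)"
      by (intro arg_cong[where f = "E n"]) auto
    then show ?thesis by (simp add: Bochner_Integration.integral_add[OF int int] Suc.IH)
  qed
  then have "E (Suc n) ?L = ((\<Sum>x\<in>C. of_bool (x \<in> Y)) + card C * (n * card Y / card C)) / card C"
    by (simp only: E_Suc sum.distrib sum_constant)
  also have "(\<Sum>x\<in>C. of_bool (x \<in> Y)) = real (card Y)"
    using finite_C assms by (simp add: of_bool_def sum.If_cases Int_absorb1)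
  finally show ?case using card_C_pos by (simp add: field_simps)
qed simp

end

text \<open>The probability that an ad with \<open>d\<close> coloured edges,
  \<open>r \<le> 1\<close> of them red, stays unmatched after \<open>n\<close> draws from
  \<open>n\<close> copies: no copy along its edges is drawn, or only the red one is, exactly
  once.\<close>

definition miss :: "nat \<Rightarrow> nat \<Rightarrow> nat \<Rightarrow> real" where
  "miss n d r = (1 - d / n) ^ n + r * (1 - d / n) ^ (n - 1)"

lemma tendsto_miss: "(\<lambda>n. miss n d r) \<longlonglongrightarrow> (1 + r) * exp (- real d)"
proof -
  have 1: "(\<lambda>n. (1 - d / n) ^ n) \<longlonglongrightarrow> exp (- real d)"
    using tendsto_exp_limit_sequentially[of "- real d"] by simp
  have 2: "(\<lambda>n. 1 - real d / real n) \<longlonglongrightarrow> 1"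
    by (rule tendsto_eq_intros lim_const_over_n refl)+ simp
  have "(\<lambda>n. (1 - d / n) ^ n / (1 - d / n)) \<longlonglongrightarrow> exp (- real d) / 1"
    by (intro tendsto_divide 1 2) simp
  moreover have "\<forall>\<^sub>F n in sequentially. (1 - d / n) ^ n / (1 - d / n) = (1 - d / n) ^ (n - 1)"
    using eventually_gt_at_top[of d]
  proof eventually_elim
    case (elim n)
    then have "1 - real d / real n \<noteq> 0" by (simp add: field_simps)
    then show ?case using elim by (cases n) auto
  qed
  ultimately have 3: "(\<lambda>n. (1 - d / n) ^ (n - 1)) \<longlonglongrightarrow> exp (- real d)"
    by (auto elim: Lim_transform_eventually)
  show ?thesis
    unfolding miss_def by (rule tendsto_eq_intros 1 3 refl)+ (simp add: algebra_simps)
qed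

text \<open>The ads that the algorithm matches, described without reference to the order of
  arrivals. With \<open>R = {}\<close> the same notion gives the ads reached by a drawn edge of
  \<open>B\<close>, which is how the cut edges are counted in the bound on the optimum.\<close>

definition hit :: "('a \<times> 'j) set \<Rightarrow> ('a \<times> 'j) set \<Rightarrow> 'j list \<Rightarrow> 'a set" where
  "hit B R xs = {a. (\<exists>j. (a, j) \<in> B \<and> j \<in> set xs) \<or> (\<exists>j. (a, j) \<in> R \<and> count_list xs j \<ge> 2)}"

text \<open>With at most one red edge at \<open>a\<close>, missing \<open>a\<close> means avoiding
  the blue copies and drawing at most one particular copy at most once, so \<open>E_avoid\<close>
  and \<open>E_avoid_once\<close> cover all cases.\<close>

lemma (in uniform_draws) E_not_hit:
  assumes sub: "B `` {a} \<subseteq> C" "R `` {a} \<subseteq> C" and disj: "B `` {a} \<inter> R `` {a} = {}"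
    and r: "card (R `` {a}) \<le> 1" and n: "n = card C"
  shows "E n (\<lambda>xs. of_bool (a \<notin> hit B R xs))
    = miss n (card (B `` {a}) + card (R `` {a})) (card (R `` {a}))"
proof -
  have fin: "finite (B `` {a})" "finite (R `` {a})" using sub finite_C by (auto intro: finite_subset)
  consider "R `` {a} = {}" | j where "R `` {a} = {j}"
    using r fin by (metis One_nat_def card_le_Suc0_iff_eq empty_iff insertI1 is_singletonI'
        is_singleton_def)
  then show ?thesis
  proof cases
    case 1
    then have "a \<notin> hit B R xs \<longleftrightarrow> set xs \<inter> B `` {a} = {}" for xs by (auto simp: hit_def)
    then show ?thesis using 1 E_avoid[OF sub(1), of n] n by (simp add: miss_def)
  next
    case 2
    then have "(a, j') \<in> R \<longleftrightarrow> j' = j" for j' by auto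
    then have "a \<notin> hit B R xs \<longleftrightarrow> set xs \<inter> B `` {a} = {} \<and> count_list xs j \<le> 1" for xs
      by (auto simp: hit_def)
    then show ?thesis using 2 E_avoid_once[of "B `` {a}" j n] sub disj n card_C_pos
      by (simp add: miss_def)
  qed
qed

lemma (in uniform_draws) E_card_hit:
  assumes A: "finite A" and H: "B \<union> R \<subseteq> A \<times> C" and disj: "B \<inter> R = {}"
    and r: "\<And>a. a \<in> A \<Longrightarrow> card (R `` {a}) \<le> 1" and n: "n = card C"
  shows "E n (\<lambda>xs. real (card (hit B R xs)))
    = (\<Sum>a\<in>A. 1 - miss n (card (B `` {a}) + card (R `` {a})) (card (R `` {a})))"
proof -
  have "real (card (hit B R xs)) = (\<Sum>a\<in>A. 1 - of_bool (a \<notin> hit B R xs))" for xs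
  proof -
    have "hit B R xs \<subseteq> A"
    proof
      fix a assume "a \<in> hit B R xs"
      then obtain j where "(a, j) \<in> B \<union> R" by (auto simp: hit_def)
      then show "a \<in> A" using H by blast
    qed
    then have "real (card (hit B R xs)) = (\<Sum>a\<in>A. of_bool (a \<in> hit B R xs))"
      using A by (simp add: of_bool_def sum.If_cases Int_absorb1)
    also have "\<dots> = (\<Sum>a\<in>A. 1 - of_bool (a \<notin> hit B R xs))" by (intro sum.cong) auto
    finally show ?thesis .
  qed
  then have "E n (\<lambda>xs. real (card (hit B R xs)))
      = (\<Sum>a\<in>A. E n (\<lambda>xs. 1 - of_bool (a \<notin> hit B R xs)))"
    by (simp add: Bochner_Integration.integral_sum[OF int] del: of_bool_not_iff)
  also have "\<dots> = (\<Sum>a\<in>A. 1 - miss n (card (B `` {a}) + card (R `` {a})) (card (R `` {a})))"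
  proof (intro sum.cong refl)
    fix a assume a: "a \<in> A"
    have "B `` {a} \<subseteq> C" "R `` {a} \<subseteq> C" "B `` {a} \<inter> R `` {a} = {}"
      using H disj by auto
    then show "E n (\<lambda>xs. 1 - of_bool (a \<notin> hit B R xs))
        = 1 - miss n (card (B `` {a}) + card (R `` {a})) (card (R `` {a}))"
      using E_not_hit[OF _ _ _ r[OF a] n]
      by (simp add: Bochner_Integration.integral_diff[OF int int] del: of_bool_not_iff)
  qed
  finally show ?thesis .
qed

section \<open>The algorithm and the optimum\<close>

lemma inj_on_sndD: "inj_on snd M \<Longrightarrow> (a, j) \<in> M \<Longrightarrow> (a', j) \<in> M \<Longrightarrow> a = a'"
  by (auto dest: inj_onD[of _ _ "(a, j)" "(a', j)"])

lemma inj_on_fstD: "inj_on fst M \<Longrightarrow> (a, j) \<in> M \<Longrightarrow> (a, j') \<in> M \<Longrightarrow> j = j'"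
  by (auto dest: inj_onD[of _ _ "(a, j)" "(a, j')"])

lemma ad_along_eq_Some:
  assumes "inj_on snd M"
  shows "ad_along M j = Some a \<longleftrightarrow> (a, j) \<in> M"
proof -
  have "(THE a. (a, j) \<in> M) = a" if "(a, j) \<in> M" for a
    using that by (intro the_equality) (auto dest: inj_on_sndD[OF assms])
  then show ?thesis by (auto simp: ad_along_def)
qed

lemma hit_cong: "set xs = set ys \<Longrightarrow> (\<And>j. count_list xs j = count_list ys j) \<Longrightarrow> hit B R xs = hit B R ys"
  by (simp add: hit_def)

lemma hit_Nil [simp]: "hit B R [] = {}"
  by (simp add: hit_def)

lemma hit_Cons:
  "hit B R (j # js) = hit B R js \<union> {a. (a, j) \<in> B} \<union> {a. (a, j) \<in> R \<and> j \<in> set js}"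
proof -
  have "j \<in> set js \<longleftrightarrow> count_list js j \<ge> 1" for j :: 'b and js
    by (metis One_nat_def Suc_leI count_notin gr0I count_list_0_iff not_one_le_zero)
  then show ?thesis by (auto simp: hit_def split: if_splits)
qed

lemma hit_subset: "hit B R xs \<subseteq> fst ` (B \<union> R)"
  by (force simp: hit_def)

lemma finite_hit: "finite B \<Longrightarrow> finite R \<Longrightarrow> finite (hit B R xs)"
  by (rule finite_subset[OF hit_subset]) auto

text \<open>The set of assigned ads is always \<open>hit B R past\<close>: an attempt fails only at
  an ad that has already been hit, and a successful one adds exactly its ad. Since
  \<open>past\<close> has the newest arrival in front, the final list is
  \<open>rev js @ past\<close>.\<close>

lemma tsm_online_hit:
  assumes B: "inj_on snd B" "finite B" and R: "inj_on snd R" "finite R"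
  shows "card (hit B R past) + length (filter (\<lambda>d. d \<noteq> None) (tsm_online B R past (hit B R past) js))
    = card (hit B R (rev js @ past))"
proof (induction js arbitrary: past)
  case (Cons j js)
  define d where "d = tsm_decide B R (count_list past j) (hit B R past) j"
  have d_iff: "d = Some a \<longleftrightarrow> a \<notin> hit B R past \<and>
      ((j \<notin> set past \<and> (a, j) \<in> B) \<or> (count_list past j = 1 \<and> (a, j) \<in> R))" for a
  proof -
    define t where "t = (if count_list past j = 0 then ad_along B j
        else if count_list past j = 1 then ad_along R j else None)"
    have "d = Some a \<longleftrightarrow> t = Some a \<and> a \<notin> hit B R past"
      unfolding d_def tsm_decide_def t_def[symmetric] by (cases t) auto
    moreover have "t = Some a \<longleftrightarrow>
        (j \<notin> set past \<and> (a, j) \<in> B) \<or> (count_list past j = 1 \<and> (a, j) \<in> R)"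
      using count_list_0_iff[of past j]
      by (auto simp: t_def ad_along_eq_Some[OF B(1)] ad_along_eq_Some[OF R(1)])
    ultimately show ?thesis by auto
  qed
  have upd: "hit B R (j # past) = hit B R past \<union> set_option d"
  proof (rule set_eqI)
    fix a
    \<comment> \<open>A blue edge at a repeated arrival, or a red edge at a third or later one, adds
      nothing: its ad was hit by earlier arrivals.\<close>
    have "a \<in> hit B R past" if "(a, j) \<in> B" "j \<in> set past"
      using that by (auto simp: hit_def)
    moreover have "a \<in> hit B R past" if "(a, j) \<in> R" "count_list past j \<ge> 2"
      using that by (auto simp: hit_def)
    moreover have "j \<in> set past \<longleftrightarrow> count_list past j = 1 \<or> count_list past j \<ge> 2"
      using count_list_0_iff[of past j] by linarith
    moreover have "a \<in> hit B R (j # past)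
        \<longleftrightarrow> a \<in> hit B R past \<or> (a, j) \<in> B \<or> (a, j) \<in> R \<and> j \<in> set past"
      by (simp add: hit_Cons)
    moreover have "a \<in> hit B R past \<union> set_option d \<longleftrightarrow> a \<in> hit B R past \<or> d = Some a"
      by (simp add: elem_set)
    ultimately show "a \<in> hit B R (j # past) \<longleftrightarrow> a \<in> hit B R past \<union> set_option d"
      unfolding d_iff by blast
  qed
  have "card (hit B R (j # past)) = card (hit B R past) + (if d \<noteq> None then 1 else 0)"
  proof (cases d)
    case (Some a)
    then have "a \<notin> hit B R past" using d_iff[of a] by blast
    then show ?thesis using Some finite_hit[OF B(2) R(2), of past] by (simp add: upd)
  qed (simp add: upd)
  then show ?case
    using Cons.IH[of "j # past"] by (cases d) (simp_all add: Let_def d_def[symmetric] upd)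
qed simp

lemma ALG_eq_card_hit:
  assumes "inj_on snd B" "finite B" "inj_on snd R" "finite R"
  shows "ALG B R xs = card (hit B R xs)"
proof -
  have "hit B R (rev xs) = hit B R xs" by (rule hit_cong) auto
  then show ?thesis using tsm_online_hit[OF assms, of "[]" xs] by (simp add: ALG_def)
qed

text \<open>Both lists are compared with \<open>us @ vs\<close>, where the position is deleted:
  deletion only shrinks the set, and inserting \<open>x\<close> adds at most
  \<open>T x\<close>.\<close>

lemma bounded_diff_card:
  assumes fin: "\<And>xs. finite (S xs)"
    and mono: "\<And>us y vs. S (us @ vs) \<subseteq> S (us @ y # vs)"
    and step: "\<And>us x vs. S (us @ x # vs) \<subseteq> S (us @ vs) \<union> T x"
    and T: "\<And>x. finite (T x) \<and> card (T x) \<le> c"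
  shows "bounded_diff (real c) (\<lambda>xs. real (card (S xs)))"
  unfolding bounded_diff_def
proof (intro allI)
  fix us x y vs
  have "card (S (us @ x # vs)) \<le> card (S (us @ y # vs) \<union> T x)"
    using mono[of us vs y] step[of us x vs] T[of x] fin by (intro card_mono) auto
  also have "\<dots> \<le> card (S (us @ y # vs)) + card (T x)" by (rule card_Un_le)
  also have "\<dots> \<le> card (S (us @ y # vs)) + c" using T by simp
  finally show "real (card (S (us @ x # vs))) \<le> real (card (S (us @ y # vs))) + real c" by simp
qed

text \<open>A draw concerns at most two ads, one along the blue and one along the red edge of its
  copy.\<close>

lemma bounded_diff_hit:
  assumes B: "inj_on snd B" "finite B" and R: "inj_on snd R" "finite R"
  shows "bounded_diff 2 (\<lambda>xs. real (card (hit B R xs)))"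
proof -
  have "bounded_diff (real 2) (\<lambda>xs. real (card (hit B R xs)))"
  proof (rule bounded_diff_card[where T = "\<lambda>j. {a. (a, j) \<in> B} \<union> {a. (a, j) \<in> R}"])
    show "finite (hit B R xs)" for xs by (rule finite_hit) fact+
    show "hit B R (us @ vs) \<subseteq> hit B R (us @ y # vs)" for us y vs
      by (fastforce simp: hit_def)
    show "hit B R (us @ x # vs) \<subseteq> hit B R (us @ vs) \<union> ({a. (a, x) \<in> B} \<union> {a. (a, x) \<in> R})" for us x vs
      by (auto simp: hit_def split: if_splits)
    have *: "finite {a. (a, j) \<in> M} \<and> card {a. (a, j) \<in> M} \<le> 1"
      if "inj_on snd M" "finite M" for M :: "('a \<times> 'b) set" and j
    proof
      show fin: "finite {a. (a, j) \<in> M}"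
        by (rule finite_subset[of _ "fst ` M"]) (use that in \<open>force+\<close>)
      show "card {a. (a, j) \<in> M} \<le> 1"
        using fin by (auto simp: card_le_Suc0_iff_eq dest: inj_on_sndD[OF that(1)])
    qed
    show "finite ({a. (a, j) \<in> B} \<union> {a. (a, j) \<in> R}) \<and> card ({a. (a, j) \<in> B} \<union> {a. (a, j) \<in> R}) \<le> 2" for j
      using *[OF B, of j] *[OF R, of j] card_Un_le[of "{a. (a, j) \<in> B}" "{a. (a, j) \<in> R}"] by auto
  qed
  then show ?thesis by simp
qed

lemma bounded_diff_count: "bounded_diff 1 (\<lambda>xs. real (length (filter P xs)))"
  by (auto simp: bounded_diff_def)

lemma finite_realization:
  assumes "osm_instance G" shows "finite (realization G xs)"
  by (rule finite_subset[of _ "ads G \<times> {..<length xs}"])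
     (use assms in \<open>auto simp: realization_def osm_instance_def\<close>)

lemma card_le_OPT:
  assumes "osm_instance G" "M \<subseteq> realization G xs" "matching M"
  shows "card M \<le> OPT G xs"
  unfolding OPT_def using assms finite_realization[of G xs] by (intro Max_ge) auto

lemma OPT_attained:
  assumes "osm_instance G"
  obtains M where "M \<subseteq> realization G xs" "matching M" "card M = OPT G xs"
proof -
  have "OPT G xs \<in> card ` {M. M \<subseteq> realization G xs \<and> matching M}"
    unfolding OPT_def using finite_realization[OF assms, of xs]
    by (intro Max_in) (auto simp: matching_def intro: exI[of _ "{}"])
  then show ?thesis using that by auto
qed

lemma OPT_le_cut:
  fixes X :: "'a set" and Y :: "('i \<times> nat) set"
  assumes G: "osm_instance G" and xs: "set xs \<subseteq> copies G" and X: "finite X"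
  defines "\<delta> \<equiv> {(a, j) \<in> copy_edges G. a \<notin> X \<and> j \<notin> Y}"
  assumes fin: "finite \<delta>"
  shows "OPT G xs \<le> card X + length (filter (\<lambda>j. j \<in> Y) xs) + card (hit \<delta> {} xs)"
proof -
  obtain M where M: "M \<subseteq> realization G xs" "matching M" "card M = OPT G xs"
    by (rule OPT_attained[OF G])
  have finM: "finite M" using M(1) finite_realization[OF G] by (rule finite_subset)
  have inj: "inj_on fst M" "inj_on snd M" using M(2) by (auto simp: matching_def)
  define M1 where "M1 = {e \<in> M. fst e \<in> X}"
  define M2 where "M2 = {e \<in> M. xs ! snd e \<in> Y}"
  define M3 where "M3 = {e \<in> M. fst e \<notin> X \<and> xs ! snd e \<notin> Y}"
  have "card M \<le> card (M1 \<union> M2 \<union> M3)"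
    using finM by (intro card_mono) (auto simp: M1_def M2_def M3_def)
  also have "\<dots> \<le> card M1 + card M2 + card M3"
    by (rule order_trans[OF card_Un_le]) (simp add: card_Un_le)
  also have "card M1 \<le> card X"
    by (rule card_inj_on_le[of fst])
       (use inj X in \<open>auto simp: M1_def intro: inj_on_subset\<close>)
  also have "card M2 \<le> card {k. k < length xs \<and> xs ! k \<in> Y}"
  proof (rule card_inj_on_le[of snd])
    show "inj_on snd M2" using inj(2) by (rule inj_on_subset) (auto simp: M2_def)
    show "snd ` M2 \<subseteq> {k. k < length xs \<and> xs ! k \<in> Y}"
      using M(1) by (auto simp: M2_def realization_def)
  qed auto
  also have "card {k. k < length xs \<and> xs ! k \<in> Y} = length (filter (\<lambda>j. j \<in> Y) xs)"
    by (simp add: length_filter_conv_card)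
  \<comment> \<open>These edges are counted by their ads and not by arrivals, so that repeated draws
    of one copy do not add up. This is the source of the factor 1 - 1/e for cut edges.\<close>
  also have "card M3 \<le> card (hit \<delta> {} xs)"
  proof (rule card_inj_on_le[of fst])
    show "inj_on fst M3" using inj(1) by (rule inj_on_subset) (auto simp: M3_def)
    show "fst ` M3 \<subseteq> hit \<delta> {} xs"
    proof clarsimp
      fix a k assume "(a, k) \<in> M3"
      then have k: "k < length xs" "(a, fst (xs ! k)) \<in> edges G" "a \<notin> X" "xs ! k \<notin> Y"
        using M(1) by (auto simp: M3_def realization_def)
      then have "xs ! k \<in> copies G" using xs by (meson nth_mem subsetD)
      then have "(a, xs ! k) \<in> copy_edges G"
        using k(2) by (auto simp: copy_edges_def copies_def split: prod.splits)
      then have "(a, xs ! k) \<in> \<delta>" "xs ! k \<in> set xs" using k by (auto simp: \<delta>_def)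
      then show "a \<in> hit \<delta> {} xs" unfolding hit_def by blast
    qed
    show "finite (hit \<delta> {} xs)" using fin by (intro finite_hit) auto
  qed
  finally show ?thesis using M(3) by simp
qed

section \<open>A saturated cut of the maximum flow\<close>

definition saturated_cut :: "'v set \<Rightarrow> ('v \<Rightarrow> 'v \<Rightarrow> real) \<Rightarrow> ('v \<Rightarrow> 'v \<Rightarrow> real) \<Rightarrow> 'v set \<Rightarrow> bool" where
  "saturated_cut V c f S \<longleftrightarrow> (\<forall>u\<in>S. \<forall>v\<in>V - S. f u v = c u v \<and> f v u = 0)"

text \<open>
  The admissible directions at a flow form a convex cone, so instead of a simple augmenting path
  we may add up the unit steps along any residual walk and scale the sum afterwards.
\<close>

lemma max_flow_saturated_cut:
  assumes fin: "finite V" and st: "s \<in> V" "t \<in> V" "s \<noteq> t" and max: "is_max_flow V c s t f"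
  obtains S where "S \<subseteq> V" "s \<in> S" "t \<notin> S" "saturated_cut V c f S"
proof -
  have flow: "is_flow V c s t f" using max by (simp add: is_max_flow_def)
  then have bounds: "0 \<le> f u v" "f u v \<le> c u v" for u v by (auto simp: is_flow_def)
  define E where "E = {(u, v). u \<in> V \<and> v \<in> V \<and> (f u v < c u v \<or> f v u > 0)}"
  define S where "S = {v. (s, v) \<in> E\<^sup>*}"
  \<comment> \<open>The first-order conditions for \<open>f + e * d\<close> to respect the bounds
    for small \<open>e > 0\<close>. Since \<open>is_flow\<close> bounds all pairs of vertices,
    \<open>d\<close> vanishes outside \<open>V\<close>, which leaves finitely many pairs to
    check.\<close>
  define adm where "adm d \<longleftrightarrow> (\<forall>u v. (f u v = 0 \<longrightarrow> 0 \<le> d u v) \<and> (f u v = c u v \<longrightarrow> d u v \<le> 0) \<and>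
      (u \<notin> V \<or> v \<notin> V \<longrightarrow> d u v = 0))" for d :: "'a \<Rightarrow> 'a \<Rightarrow> real"
  define ex where "ex d w = (\<Sum>u\<in>V. d u w) - (\<Sum>u\<in>V. d w u)" for d :: "'a \<Rightarrow> 'a \<Rightarrow> real" and w
  have SV: "v \<in> V" if "(s, v) \<in> E\<^sup>*" for v
    using that by (induction rule: rtrancl_induct) (auto simp: st E_def)
  have dir: "\<exists>d. adm d \<and> (\<forall>w\<in>V. ex d w = of_bool (w = v) - of_bool (w = s))" if "(s, v) \<in> E\<^sup>*" for v
    using that
  proof (induction rule: rtrancl_induct)
    case base
    then show ?case by (intro exI[of _ "\<lambda>_ _. 0"]) (auto simp: adm_def ex_def bounds)
  next
    case (step u v)
    then obtain d where d: "adm d" "\<forall>w\<in>V. ex d w = of_bool (w = u) - of_bool (w = s)" by auto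
    have uv: "u \<in> V" "v \<in> V" using step.hyps by (auto simp: E_def)
    define unit :: "'a \<Rightarrow> 'a \<Rightarrow> 'a \<Rightarrow> 'a \<Rightarrow> real" where
      "unit p q = (\<lambda>x y. of_bool (x = p) * of_bool (y = q))" for p q
    have ex_unit: "ex (unit p q) w = of_bool (w = q) - of_bool (w = p)"
      if "p \<in> V" "q \<in> V" for p q w
    proof -
      have "(\<Sum>x\<in>V. of_bool (x = p) :: real) = 1" "(\<Sum>x\<in>V. of_bool (x = q) :: real) = 1"
        using that fin by (simp_all add: of_bool_def sum.delta)
      then show ?thesis
        by (simp add: ex_def unit_def flip: sum_distrib_left sum_distrib_right)
    qed
    have ex_add: "ex (\<lambda>x y. d x y + k * e x y) w = ex d w + k * ex e w" for k e w
      by (simp add: ex_def sum.distrib sum_distrib_left algebra_simps)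
    consider "f u v < c u v" | "f v u > 0" using step.hyps by (auto simp: E_def)
    then show ?case
    proof cases
      case 1
      have "adm (\<lambda>x y. d x y + 1 * unit u v x y)"
        using d(1) 1 uv by (auto simp: adm_def unit_def)
      moreover have "\<forall>w\<in>V. ex (\<lambda>x y. d x y + 1 * unit u v x y) w = of_bool (w = v) - of_bool (w = s)"
        unfolding ex_add ex_unit[OF uv] using d(2) by auto
      ultimately show ?thesis by blast
    next
      case 2
      have "adm (\<lambda>x y. d x y + (-1) * unit v u x y)"
        using d(1) 2 uv by (auto simp: adm_def unit_def intro: order_trans[of _ "0::real" 1])
      moreover have "\<forall>w\<in>V. ex (\<lambda>x y. d x y + (-1) * unit v u x y) w = of_bool (w = v) - of_bool (w = s)"
        unfolding ex_add ex_unit[OF uv(2,1)] using d(2) by auto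
      ultimately show ?thesis by blast
    qed
  qed
  have "t \<notin> S"
  proof
    assume "t \<in> S"
    then obtain d where d: "adm d" and exd: "\<And>w. w \<in> V \<Longrightarrow> ex d w = of_bool (w = t) - of_bool (w = s)"
      using dir[of t] by (auto simp: S_def)
    \<comment> \<open>Where a bound is attained, the sign of \<open>d\<close> preserves it for every
      positive \<open>e\<close>; where it is strict, continuity preserves it for small
      \<open>e\<close>.\<close>
    have "eventually (\<lambda>e. 0 \<le> f u v + e * d u v \<and> f u v + e * d u v \<le> c u v) (at_right 0)" for u v
    proof (rule eventually_conj)
      have lim: "((\<lambda>e. f u v + e * d u v) \<longlongrightarrow> f u v + 0 * d u v) (at_right 0)"
        by (intro tendsto_intros)
      have pos: "eventually (\<lambda>e. 0 < e) (at_right (0::real))"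
        by (simp add: eventually_at_right_less)
      show "eventually (\<lambda>e. 0 \<le> f u v + e * d u v) (at_right 0)"
      proof (cases "f u v = 0")
        case True
        then have "0 \<le> d u v" using d by (auto simp: adm_def)
        from pos show ?thesis by eventually_elim (use True \<open>0 \<le> d u v\<close> in simp)
      next
        case False
        then have "0 < f u v + 0 * d u v" using bounds(1)[of u v] by simp
        from order_tendstoD(1)[OF lim this] show ?thesis by eventually_elim simp
      qed
      show "eventually (\<lambda>e. f u v + e * d u v \<le> c u v) (at_right 0)"
      proof (cases "f u v = c u v")
        case True
        then have "d u v \<le> 0" using d by (auto simp: adm_def)
        from pos show ?thesis by eventually_elim (use True \<open>d u v \<le> 0\<close> in \<open>simp add: mult_nonneg_nonpos\<close>)
      next
        case False
        then have "f u v + 0 * d u v < c u v" using bounds(2)[of u v] by simp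
        from order_tendstoD(2)[OF lim this] show ?thesis by eventually_elim simp
      qed
    qed
    then have "eventually (\<lambda>e. \<forall>p\<in>V \<times> V. 0 \<le> f (fst p) (snd p) + e * d (fst p) (snd p) \<and>
        f (fst p) (snd p) + e * d (fst p) (snd p) \<le> c (fst p) (snd p)) (at_right 0)"
      using fin by (intro eventually_ball_finite) auto
    moreover have "eventually (\<lambda>e. 0 < e) (at_right (0::real))"
      by (simp add: eventually_at_right_less)
    ultimately have "eventually (\<lambda>e. 0 < e \<and> (\<forall>p\<in>V \<times> V. 0 \<le> f (fst p) (snd p) + e * d (fst p) (snd p) \<and>
        f (fst p) (snd p) + e * d (fst p) (snd p) \<le> c (fst p) (snd p))) (at_right 0)"
      by eventually_elim blast
    then obtain e where e: "0 < e" and eb: "\<forall>p\<in>V \<times> V. 0 \<le> f (fst p) (snd p) + e * d (fst p) (snd p) \<and>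
        f (fst p) (snd p) + e * d (fst p) (snd p) \<le> c (fst p) (snd p)"
      using eventually_happens'[OF trivial_limit_at_right_real] by blast
    define g where "g u v = f u v + e * d u v" for u v
    have g_bounds: "0 \<le> g u v \<and> g u v \<le> c u v" for u v
      using eb[rule_format, of "(u, v)"] d bounds[of u v]
      by (cases "u \<in> V \<and> v \<in> V") (auto simp: g_def adm_def)
    have ex_g: "ex g w = ex f w + e * ex d w" for w
      by (simp add: ex_def g_def sum.distrib sum_distrib_left algebra_simps)
    have "is_flow V c s t g"
      unfolding is_flow_def
    proof (intro conjI ballI allI)
      fix v assume v: "v \<in> V - {s, t}"
      then have "ex f v = 0" using flow by (auto simp: is_flow_def ex_def)
      moreover have "ex d v = 0" using exd[of v] v by auto
      ultimately have "ex g v = 0" by (simp add: ex_g)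
      then show "(\<Sum>u\<in>V. g u v) = (\<Sum>w\<in>V. g v w)" by (simp add: ex_def)
    qed (use g_bounds in auto)
    then have "flow_value V s g \<le> flow_value V s f" using max by (auto simp: is_max_flow_def)
    moreover have "flow_value V s h = - ex h s" for h by (simp add: flow_value_def ex_def)
    moreover have "ex d s = -1" using exd[OF st(1)] st(3) by simp
    ultimately show False using e by (simp add: ex_g)
  qed
  moreover have "saturated_cut V c f S"
    unfolding saturated_cut_def
  proof (intro ballI conjI)
    fix u v assume uv: "u \<in> S" "v \<in> V - S"
    then have "(u, v) \<notin> E" by (auto simp: S_def intro: rtrancl_into_rtrancl)
    moreover have "u \<in> V" using uv SV by (auto simp: S_def)
    ultimately have "\<not> f u v < c u v" "\<not> f v u > 0" using uv by (auto simp: E_def)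
    then show "f u v = c u v" "f v u = 0" using bounds[of u v] bounds[of v u] by auto
  qed
  ultimately show ?thesis using that[of S] SV by (auto simp: S_def)
qed

section \<open>Flows on the network of ads and impressions, and weak duality\<close>

lemma sum_tsm_nodes:
  fixes h :: "('a, 'j) node \<Rightarrow> real"
  assumes "finite A" "finite J"
  shows "(\<Sum>v\<in>tsm_nodes A J. h v) = h Source + h Sink + (\<Sum>a\<in>A. h (Ad a)) + (\<Sum>j\<in>J. h (Imp j))"
proof -
  have "(\<Sum>v\<in>tsm_nodes A J. h v) = (\<Sum>v\<in>{Source, Sink}. h v) + (\<Sum>v\<in>Ad ` A. h v) + (\<Sum>v\<in>Imp ` J. h v)"
  proof -
    have "sum h (({Source, Sink} \<union> Ad ` A) \<union> Imp ` J) = sum h ({Source, Sink} \<union> Ad ` A) + sum h (Imp ` J)"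
      using assms by (intro sum.union_disjoint) auto
    also have "sum h ({Source, Sink} \<union> Ad ` A) = sum h {Source, Sink} + sum h (Ad ` A)"
      using assms by (intro sum.union_disjoint) auto
    finally show ?thesis by (simp only: tsm_nodes_def)
  qed
  also have "(\<Sum>v\<in>Ad ` A. h v) = (\<Sum>a\<in>A. h (Ad a))" by (subst sum.reindex) (auto simp: inj_on_def)
  also have "(\<Sum>v\<in>Imp ` J. h v) = (\<Sum>j\<in>J. h (Imp j))" by (subst sum.reindex) (auto simp: inj_on_def)
  finally show ?thesis by simp
qed

text \<open>Neither maximality nor integrality is built in, because weak duality must also apply to
  every competing flow when a given flow is certified as maximum.\<close>

locale tsm_flow =
  fixes A :: "'a set" and J :: "'j set" and F :: "('a \<times> 'j) set"
    and f :: "('a, 'j) node \<Rightarrow> ('a, 'j) node \<Rightarrow> real"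
  assumes finA: "finite A" and finJ: "finite J" and F: "F \<subseteq> A \<times> J"
    and flow: "is_flow (tsm_nodes A J) (tsm_cap A J F) Source Sink f"
begin

lemma bounds: "0 \<le> f u v" "f u v \<le> tsm_cap A J F u v"
  using flow by (auto simp: is_flow_def)

lemma f_zero: "tsm_cap A J F u v = 0 \<Longrightarrow> f u v = 0"
  using bounds[of u v] by simp

lemma ad_conservation:
  assumes "a \<in> A" shows "f Source (Ad a) = (\<Sum>j\<in>J. f (Ad a) (Imp j))"
proof -
  have "(\<Sum>u\<in>tsm_nodes A J. f u (Ad a)) = (\<Sum>w\<in>tsm_nodes A J. f (Ad a) w)"
    using flow assms by (auto simp: is_flow_def tsm_nodes_def)
  then show ?thesis by (simp add: sum_tsm_nodes finA finJ f_zero)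
qed

lemma imp_conservation:
  assumes "j \<in> J" shows "f (Imp j) Sink = (\<Sum>a\<in>A. f (Ad a) (Imp j))"
proof -
  have "(\<Sum>u\<in>tsm_nodes A J. f u (Imp j)) = (\<Sum>w\<in>tsm_nodes A J. f (Imp j) w)"
    using flow assms by (auto simp: is_flow_def tsm_nodes_def)
  then show ?thesis by (simp add: sum_tsm_nodes finA finJ f_zero)
qed

lemma flow_value_eq: "flow_value (tsm_nodes A J) Source f = (\<Sum>a\<in>A. f Source (Ad a))"
  by (simp add: flow_value_def sum_tsm_nodes finA finJ f_zero)

text \<open>Weak duality for the cut with the ads outside \<open>X\<close> and the impressions in
  \<open>Y\<close> on the source side. Flow through an ad outside \<open>X\<close> either enters
  \<open>Y\<close>, where the edges to the sink bound it, or uses a crossing edge.\<close>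

lemma flow_value_le_cut:
  assumes X: "X \<subseteq> A" and Y: "Y \<subseteq> J"
  shows "flow_value (tsm_nodes A J) Source f
    \<le> 2 * card X + 2 * card Y + card {(a, j) \<in> F. a \<notin> X \<and> j \<notin> Y}"
proof -
  have fin: "finite X" "finite Y" using X Y finA finJ finite_subset by auto
  have "(\<Sum>a\<in>A. f Source (Ad a)) = (\<Sum>a\<in>X. f Source (Ad a)) + (\<Sum>a\<in>A - X. f Source (Ad a))"
    using sum.subset_diff[OF X finA] by (simp add: add.commute)
  also have "(\<Sum>a\<in>X. f Source (Ad a)) \<le> (\<Sum>a\<in>X. 2)"
    using X bounds(2)[of Source "Ad a" for a] by (intro sum_mono) (metis subsetD tsm_cap.simps(1))
  also have "(\<Sum>a\<in>A - X. f Source (Ad a)) = (\<Sum>a\<in>A - X. \<Sum>j\<in>J. f (Ad a) (Imp j))"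
    by (intro sum.cong) (auto simp: ad_conservation)
  also have "\<dots> = (\<Sum>a\<in>A - X. \<Sum>j\<in>Y. f (Ad a) (Imp j)) + (\<Sum>a\<in>A - X. \<Sum>j\<in>J - Y. f (Ad a) (Imp j))"
    by (simp only: sum.subset_diff[OF Y finJ] sum.distrib add.commute)
  also have "(\<Sum>a\<in>A - X. \<Sum>j\<in>Y. f (Ad a) (Imp j)) \<le> (\<Sum>a\<in>A. \<Sum>j\<in>Y. f (Ad a) (Imp j))"
    using finA by (intro sum_mono2) (auto intro!: sum_nonneg bounds)
  also have "\<dots> = (\<Sum>j\<in>Y. \<Sum>a\<in>A. f (Ad a) (Imp j))" by (rule sum.swap)
  also have "\<dots> = (\<Sum>j\<in>Y. f (Imp j) Sink)"
    using Y by (intro sum.cong) (auto simp: imp_conservation)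
  also have "\<dots> \<le> (\<Sum>j\<in>Y. 2)"
    using Y bounds(2)[of _ Sink] by (intro sum_mono) (metis subsetD tsm_cap.simps(3))
  also have "(\<Sum>a\<in>A - X. \<Sum>j\<in>J - Y. f (Ad a) (Imp j))
      \<le> (\<Sum>a\<in>A - X. \<Sum>j\<in>J - Y. if (a, j) \<in> F then 1 else 0)"
    using bounds(2)[of "Ad _" "Imp _"] by (intro sum_mono) auto
  also have "\<dots> = (\<Sum>p\<in>(A - X) \<times> (J - Y). if p \<in> F then 1 else 0)"
    by (simp add: sum.cartesian_product case_prod_unfold)
  also have "\<dots> = real (card ((A - X) \<times> (J - Y) \<inter> F))"
    using finA finJ by (simp add: sum.If_cases)
  also have "(A - X) \<times> (J - Y) \<inter> F = {(a, j) \<in> F. a \<notin> X \<and> j \<notin> Y}" using F by auto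
  finally show ?thesis by (simp add: flow_value_eq)
qed

end

section \<open>Integral maximum flows as graphs of maximum degree two\<close>

locale tsm_integral_max_flow =
  fixes A :: "'a set" and J :: "'j set" and F :: "('a \<times> 'j) set"
    and f :: "('a, 'j) node \<Rightarrow> ('a, 'j) node \<Rightarrow> real"
  assumes finA: "finite A" and finJ: "finite J" and F: "F \<subseteq> A \<times> J"
    and max: "integral_max_flow A J F f"
begin

sublocale tsm_flow
  by unfold_locales (use max finA finJ F in \<open>auto simp: integral_max_flow_def is_max_flow_def\<close>)

abbreviation "H \<equiv> flow_edges f"

lemma f_01: "f (Ad a) (Imp j) = of_bool ((a, j) \<in> H)"
proof -
  have "f (Ad a) (Imp j) \<in> \<int>" using max by (auto simp: integral_max_flow_def)
  then obtain k where k: "f (Ad a) (Imp j) = of_int k" by (auto elim: Ints_cases)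
  have "0 \<le> f (Ad a) (Imp j)" "f (Ad a) (Imp j) \<le> 1"
    using bounds[of "Ad a" "Imp j"] by (auto split: if_splits)
  then have "k = 0 \<or> k = 1" using k by auto
  then show ?thesis using k by (auto simp: flow_edges_def)
qed

lemma H_subset_F: "H \<subseteq> F"
proof clarify
  fix a j assume "(a, j) \<in> H"
  then have "0 < f (Ad a) (Imp j)" by (simp add: flow_edges_def)
  then show "(a, j) \<in> F" using bounds(2)[of "Ad a" "Imp j"] by (auto split: if_splits)
qed

lemma H_subset: "H \<subseteq> A \<times> J"
  using H_subset_F F by auto

lemma finite_H: "finite H"
  using H_subset finA finJ by (auto intro: finite_subset)

lemma ad_degree:
  assumes "a \<in> A" shows "real (card (H `` {a})) = f Source (Ad a)"
proof -
  have "H `` {a} = J \<inter> {j. (a, j) \<in> H}" using H_subset by auto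
  then show ?thesis
    by (simp add: ad_conservation[OF assms] f_01 of_bool_def sum.If_cases finJ)
qed

lemma imp_degree:
  assumes "j \<in> J" shows "real (card (H\<inverse> `` {j})) = f (Imp j) Sink"
proof -
  have "H\<inverse> `` {j} = A \<inter> {a. (a, j) \<in> H}" using H_subset by auto
  then show ?thesis
    by (simp add: imp_conservation[OF assms] f_01 of_bool_def sum.If_cases finA)
qed

lemma ad_degree_le: "card (H `` {a}) \<le> 2"
proof (cases "a \<in> A")
  case True
  then show ?thesis using ad_degree[OF True] bounds(2)[of Source "Ad a"] by simp
next
  case False
  then have "H `` {a} = {}" using H_subset by auto
  then show ?thesis by simp
qed

lemma imp_degree_le: "card (H\<inverse> `` {j}) \<le> 2"
proof (cases "j \<in> J")
  case True
  then show ?thesis using imp_degree[OF True] bounds(2)[of "Imp j" Sink] by simp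
next
  case False
  then have "H\<inverse> `` {j} = {}" using H_subset by auto
  then show ?thesis by simp
qed

text \<open>
  A vertex with two cut edges is saturated by them, so it may change sides: after doing so the cut
  edges from ads to impressions form a matching.
\<close>

lemma obtain_cut:
  obtains X Y where "X \<subseteq> A" "Y \<subseteq> J"
    "\<And>a. a \<in> X \<Longrightarrow> card (H `` {a}) = 2" "\<And>j. j \<in> Y \<Longrightarrow> card (H\<inverse> `` {j}) = 2"
    "H \<inter> X \<times> Y = {}" "{(a, j) \<in> F. a \<notin> X \<and> j \<notin> Y} \<subseteq> H"
    "matching {(a, j) \<in> F. a \<notin> X \<and> j \<notin> Y}"
proof -
  have fV: "finite (tsm_nodes A J)" using finA finJ by (simp add: tsm_nodes_def)
  have "is_max_flow (tsm_nodes A J) (tsm_cap A J F) Source Sink f"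
    using max by (simp add: integral_max_flow_def)
  moreover have "Source \<in> tsm_nodes A J" "Sink \<in> tsm_nodes A J" "Source \<noteq> (Sink :: ('a, 'j) node)"
    by (auto simp: tsm_nodes_def)
  ultimately obtain S
    where S: "Source \<in> S" "Sink \<notin> S" "saturated_cut (tsm_nodes A J) (tsm_cap A J F) f S"
    using max_flow_saturated_cut[OF fV, of Source Sink] by metis
  \<comment> \<open>The cut is recorded by the vertices whose capacity-2 edge crosses it: ads on the
    sink side and impressions on the source side.\<close>
  define X0 where "X0 = {a \<in> A. Ad a \<notin> S}"
  define Y0 where "Y0 = {j \<in> J. Imp j \<in> S}"
  have X0: "card (H `` {a}) = 2" if "a \<in> X0" for a
  proof -
    have "f Source (Ad a) = 2"
      using S that by (auto simp: saturated_cut_def X0_def tsm_nodes_def)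
    then show ?thesis using ad_degree[of a] that by (simp add: X0_def)
  qed
  have Y0: "card (H\<inverse> `` {j}) = 2" if "j \<in> Y0" for j
  proof -
    have "f (Imp j) Sink = 2"
      using S that by (auto simp: saturated_cut_def Y0_def tsm_nodes_def)
    then show ?thesis using imp_degree[of j] that by (simp add: Y0_def)
  qed
  have XY0: "(a, j) \<notin> H" if "a \<in> X0" "j \<in> Y0" for a j
  proof -
    have "f (Ad a) (Imp j) = 0"
      using S that by (auto simp: saturated_cut_def X0_def Y0_def tsm_nodes_def)
    then show ?thesis using f_01[of a j] by auto
  qed
  have cut0: "(a, j) \<in> H" if "(a, j) \<in> F" "a \<notin> X0" "j \<notin> Y0" for a j
  proof -
    have aj: "a \<in> A" "j \<in> J" using that F by auto
    then have "Ad a \<in> S" "Imp j \<in> tsm_nodes A J - S"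
      using that by (auto simp: X0_def Y0_def tsm_nodes_def)
    then have "f (Ad a) (Imp j) = tsm_cap A J F (Ad a) (Imp j)"
      using S(3) unfolding saturated_cut_def by blast
    then show ?thesis using that f_01[of a j] by (auto split: if_splits)
  qed
  have two: "T = {x, y}" if "card T \<le> 2" "finite T" "x \<in> T" "y \<in> T" "x \<noteq> y" for T :: "'z set" and x y
  proof -
    have "card {x, y} = 2" using that by simp
    then show ?thesis using that by (metis card_seteq empty_subsetI insert_subset)
  qed
  have finH: "finite (H `` {a})" "finite (H\<inverse> `` {j})" for a j
    using finite_H by (auto intro: finite_Image)
  \<comment> \<open>Ads move first. Two crossing edges are all the flow edges of such an ad, and
    both lead outside \<open>Y0\<close>, so the move creates no flow edge from \<open>X\<close> into
    \<open>Y0\<close>.\<close>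
  define X where "X = X0 \<union> {a \<in> A. \<exists>j j'. j \<noteq> j' \<and> j \<notin> Y0 \<and> j' \<notin> Y0 \<and> a \<notin> X0 \<and> (a, j) \<in> F \<and> (a, j') \<in> F}"
  have X1: "card (H `` {a}) = 2 \<and> (\<forall>j\<in>Y0. (a, j) \<notin> H)" if "a \<in> X" for a
  proof (cases "a \<in> X0")
    case False
    then obtain j j' where j: "j \<noteq> j'" "j \<notin> Y0" "j' \<notin> Y0" "(a, j) \<in> F" "(a, j') \<in> F"
      using \<open>a \<in> X\<close> by (auto simp: X_def)
    then have "H `` {a} = {j, j'}"
      using cut0 False by (intro two ad_degree_le finH) auto
    then show ?thesis using j by auto
  qed (use X0 XY0 in auto)
  \<comment> \<open>Impressions are judged against the enlarged \<open>X\<close>: both flow edges of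
    a moved impression come from outside it, so no flow edge joins \<open>X\<close> to
    \<open>Y\<close>.\<close>
  define Y where "Y = Y0 \<union> {j \<in> J. \<exists>a a'. a \<noteq> a' \<and> a \<notin> X \<and> a' \<notin> X \<and> j \<notin> Y0 \<and> (a, j) \<in> F \<and> (a', j) \<in> F}"
  have Y1: "card (H\<inverse> `` {j}) = 2 \<and> (\<forall>a\<in>X. (a, j) \<notin> H)" if "j \<in> Y" for j
  proof (cases "j \<in> Y0")
    case False
    then obtain a a' where a: "a \<noteq> a'" "a \<notin> X" "a' \<notin> X" "(a, j) \<in> F" "(a', j) \<in> F"
      using \<open>j \<in> Y\<close> by (auto simp: Y_def)
    then have "H\<inverse> `` {j} = {a, a'}"
      using cut0 False by (intro two imp_degree_le finH) (auto simp: X_def)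
    then show ?thesis using a by auto
  qed (use Y0 X1 in auto)
  show ?thesis
  proof (rule that[of X Y])
    show "X \<subseteq> A" "Y \<subseteq> J" by (auto simp: X_def Y_def X0_def Y0_def)
    show "card (H `` {a}) = 2" if "a \<in> X" for a using X1 that by auto
    show "card (H\<inverse> `` {j}) = 2" if "j \<in> Y" for j using Y1 that by auto
    show "H \<inter> X \<times> Y = {}" using Y1 by auto
    show "{(a, j) \<in> F. a \<notin> X \<and> j \<notin> Y} \<subseteq> H" using cut0 by (auto simp: X_def Y_def)
    have "j = j'" if "(a, j) \<in> F" "(a, j') \<in> F" "a \<notin> X" "j \<notin> Y" "j' \<notin> Y" for a j j'
    proof (rule ccontr)
      assume "j \<noteq> j'"
      moreover have "a \<in> A" using that F by auto
      moreover have "a \<notin> X0" "j \<notin> Y0" "j' \<notin> Y0" using that by (auto simp: X_def Y_def)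
      ultimately have "a \<in> X" using that unfolding X_def by blast
      then show False using that by simp
    qed
    moreover have "a = a'" if "(a, j) \<in> F" "(a', j) \<in> F" "a \<notin> X" "a' \<notin> X" "j \<notin> Y" for a a' j
    proof (rule ccontr)
      assume "a \<noteq> a'"
      moreover have "j \<in> J" using that F by auto
      moreover have "j \<notin> Y0" using that by (auto simp: Y_def)
      ultimately have "j \<in> Y" using that unfolding Y_def by blast
      then show False using that by simp
    qed
    ultimately show "matching {(a, j) \<in> F. a \<notin> X \<and> j \<notin> Y}"
      by (auto simp: matching_def inj_on_def)
  qed
qed

end

section \<open>Components of graphs of maximum degree two\<close>

lemma adjacent_sym: "adjacent H v w \<longleftrightarrow> adjacent H w v"
  by (cases v; cases w) auto

lemma adjacent_isl: "adjacent H v w \<Longrightarrow> isl w \<longleftrightarrow> \<not> isl v"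
  by (cases v; cases w) auto

lemma edge_between_commute: "edge_between v w = edge_between w v"
  by (cases v; cases w) auto

lemma edge_between_inject:
  assumes "adjacent H v w" "adjacent H v' w'"
  shows "edge_between v w = edge_between v' w' \<longleftrightarrow> v = v' \<and> w = w' \<or> v = w' \<and> w = v'"
  using assms by (cases v; cases w; cases v'; cases w') auto

lemma adjacent_Inl: "{w. adjacent H (Inl a) w} = Inr ` (H `` {a})"
proof -
  have "adjacent H (Inl a) w \<longleftrightarrow> w \<in> Inr ` (H `` {a})" for w
    by (cases w) auto
  then show ?thesis by auto
qed

lemma adjacent_Inr: "{w. adjacent H (Inr j) w} = Inl ` (H\<inverse> `` {j})"
proof -
  have "adjacent H (Inr j) w \<longleftrightarrow> w \<in> Inl ` (H\<inverse> `` {j})" for w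
    by (cases w) auto
  then show ?thesis by auto
qed

lemma incident_edges_eq: "incident_edges H W = {edge_between v w | v w. v \<in> W \<and> adjacent H v w}"
proof (intro equalityI subsetI)
  fix e assume "e \<in> incident_edges H W"
  then obtain a j where e: "e = (a, j)" "(a, j) \<in> H" "Inl a \<in> W \<or> Inr j \<in> W"
    by (auto simp: incident_edges_def)
  then have "e = edge_between (Inl a) (Inr j) \<and> adjacent H (Inl a) (Inr j)"
    "e = edge_between (Inr j) (Inl a) \<and> adjacent H (Inr j) (Inl a)" by auto
  then show "e \<in> {edge_between v w | v w. v \<in> W \<and> adjacent H v w}" using e(3) by blast
next
  fix e assume "e \<in> {edge_between v w | v w. v \<in> W \<and> adjacent H v w}"
  then obtain v w where "e = edge_between v w" "v \<in> W" "adjacent H v w" by auto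
  then show "e \<in> incident_edges H W" by (cases v; cases w) (auto simp: incident_edges_def)
qed

lemma length_path_edges [simp]: "length (path_edges vs) = length vs - 1"
  by (simp add: path_edges_def)

lemma nth_path_edges:
  "Suc k < length vs \<Longrightarrow> path_edges vs ! k = edge_between (vs ! k) (vs ! Suc k)"
  by (simp add: path_edges_def nth_butlast nth_tl)

lemma set_path_edges: "set (path_edges vs) = {edge_between (vs ! k) (vs ! Suc k) | k. Suc k < length vs}"
proof -
  have "set (path_edges vs) = {path_edges vs ! k | k. Suc k < length vs}"
    by (auto simp: set_conv_nth)
  also have "\<dots> = {edge_between (vs ! k) (vs ! Suc k) | k. Suc k < length vs}"
    using nth_path_edges[of _ vs] by (intro Collect_cong) metis
  finally show ?thesis .
qed

lemma path_edges_rev: "path_edges (rev vs) = rev (path_edges vs)"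
proof (rule nth_equalityI)
  fix k assume "k < length (path_edges (rev vs))"
  then have k: "Suc k < length vs" by simp
  define m where "m = length vs - Suc (Suc k)"
  have m: "Suc m < length vs" "length vs - Suc k = Suc m" "length vs - Suc (Suc k) = m"
    "length (path_edges vs) - Suc k = m"
    using k by (auto simp: m_def)
  have "path_edges (rev vs) ! k = edge_between (vs ! Suc m) (vs ! m)"
    using k m by (simp add: nth_path_edges rev_nth)
  also have "\<dots> = path_edges vs ! m" using m by (simp add: nth_path_edges edge_between_commute)
  also have "\<dots> = rev (path_edges vs) ! k" using k m by (simp add: rev_nth)
  finally show "path_edges (rev vs) ! k = rev (path_edges vs) ! k" .
qed simp

lemma length_cycle_edges [simp]: "length (cycle_edges vs) = length vs"
  by (simp add: cycle_edges_def)

lemma nth_cycle_edges: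
  "k < length vs \<Longrightarrow> cycle_edges vs ! k = edge_between (vs ! k) (vs ! (Suc k mod length vs))"
  by (simp add: cycle_edges_def nth_rotate1)

lemma set_cycle_edges:
  "set (cycle_edges vs) = {edge_between (vs ! k) (vs ! (Suc k mod length vs)) | k. k < length vs}"
proof -
  have "set (cycle_edges vs) = {cycle_edges vs ! k | k. k < length vs}"
    by (auto simp: set_conv_nth)
  also have "\<dots> = {edge_between (vs ! k) (vs ! (Suc k mod length vs)) | k. k < length vs}"
    using nth_cycle_edges[of _ vs] by (intro Collect_cong) metis
  finally show ?thesis .
qed

lemma incident_edgesI: "v \<in> W \<Longrightarrow> adjacent H v w \<Longrightarrow> edge_between v w \<in> incident_edges H W"
  by (auto simp: incident_edges_eq)

lemma successively_adjacent_rev: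
  "successively (adjacent H) (rev vs) \<longleftrightarrow> successively (adjacent H) vs"
proof -
  have "(\<lambda>x y. adjacent H y x) = adjacent H" by (intro ext) (rule adjacent_sym)
  then show ?thesis unfolding successively_rev by (rule arg_cong2[where f = successively]) (rule refl)
qed

lemma successively_isl:
  assumes "successively (adjacent H) vs" "p < length vs"
  shows "isl (vs ! p) \<longleftrightarrow> (isl (hd vs) \<longleftrightarrow> even p)"
  using assms(2)
proof (induction p)
  case 0
  then show ?case by (simp add: hd_conv_nth)
next
  case (Suc p)
  then have "adjacent H (vs ! p) (vs ! Suc p)"
    using assms(1) by (auto simp: successively_conv_nth)
  then show ?case using Suc by (auto dest: adjacent_isl)
qed

lemma path_component_rev: "path_component H vs \<Longrightarrow> path_component H (rev vs)"
  unfolding path_component_def successively_adjacent_rev path_edges_rev by simp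

lemma path_component_adjacent:
  assumes P: "path_component H vs" and p: "p < length vs"
  shows "adjacent H (vs ! p) w \<longleftrightarrow> (Suc p < length vs \<and> w = vs ! Suc p) \<or> (0 < p \<and> w = vs ! (p - 1))"
proof
  have suc: "adjacent H (vs ! k) (vs ! Suc k)" if "Suc k < length vs" for k
    using P that by (auto simp: path_component_def successively_conv_nth)
  {
    assume adj: "adjacent H (vs ! p) w"
    then have "edge_between (vs ! p) w \<in> set (path_edges vs)"
      using P p incident_edgesI[of "vs ! p" "set vs"] by (auto simp: path_component_def)
    then obtain k where k: "Suc k < length vs" "edge_between (vs ! p) w = edge_between (vs ! k) (vs ! Suc k)"
      by (auto simp: set_path_edges)
    then have "vs ! p = vs ! k \<and> w = vs ! Suc k \<or> vs ! p = vs ! Suc k \<and> w = vs ! k"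
      using edge_between_inject[OF adj suc[OF k(1)]] by auto
    then show "(Suc p < length vs \<and> w = vs ! Suc p) \<or> (0 < p \<and> w = vs ! (p - 1))"
      using P p k(1) by (auto simp: path_component_def nth_eq_iff_index_eq)
  }
  assume "(Suc p < length vs \<and> w = vs ! Suc p) \<or> (0 < p \<and> w = vs ! (p - 1))"
  then show "adjacent H (vs ! p) w"
    using suc[of p] suc[of "p - 1"] p adjacent_sym[of H] by auto
qed

lemma cycle_component_adjacent_Suc:
  assumes C: "cycle_component H vs" and k: "k < length vs"
  shows "adjacent H (vs ! k) (vs ! (Suc k mod length vs))"
proof (cases "Suc k < length vs")
  case True
  then show ?thesis using C by (auto simp: cycle_component_def successively_conv_nth)
next
  case False
  then have "k = length vs - 1" using k by simp
  moreover have "adjacent H (last vs) (hd vs)" "vs \<noteq> []" using C by (auto simp: cycle_component_def)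
  ultimately show ?thesis by (simp add: last_conv_nth hd_conv_nth)
qed

text \<open>The term \<open>(p + n - 1) mod n\<close> is the cyclic predecessor of \<open>p\<close>;
  adding \<open>n\<close> first keeps the subtraction from truncating at 0.\<close>

lemma Suc_pred_mod:
  assumes "p < (n :: nat)" shows "Suc ((p + n - 1) mod n) mod n = p"
  using assms by (cases p) (auto simp: mod_Suc_eq)

lemma cycle_component_adjacent:
  assumes C: "cycle_component H vs" and p: "p < length vs"
  shows "adjacent H (vs ! p) w \<longleftrightarrow>
    w = vs ! (Suc p mod length vs) \<or> w = vs ! ((p + length vs - 1) mod length vs)"
    (is "_ \<longleftrightarrow> _ \<or> w = vs ! ?q")
proof
  let ?n = "length vs"
  have q: "?q < ?n" "Suc ?q mod ?n = p"
    by (rule mod_less_divisor) (use p Suc_pred_mod[OF p] in auto)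
  {
    assume adj: "adjacent H (vs ! p) w"
    then have "edge_between (vs ! p) w \<in> set (cycle_edges vs)"
      using C p incident_edgesI[of "vs ! p" "set vs"] by (auto simp: cycle_component_def)
    then obtain k where k: "k < ?n" "edge_between (vs ! p) w = edge_between (vs ! k) (vs ! (Suc k mod ?n))"
      by (auto simp: set_cycle_edges)
    then consider "vs ! p = vs ! k" "w = vs ! (Suc k mod ?n)" | "vs ! p = vs ! (Suc k mod ?n)" "w = vs ! k"
      using edge_between_inject[OF adj cycle_component_adjacent_Suc[OF C k(1)]] by auto
    then show "w = vs ! (Suc p mod ?n) \<or> w = vs ! ?q"
    proof cases
      case 1
      then show ?thesis using C p k(1) by (auto simp: cycle_component_def nth_eq_iff_index_eq)
    next
      case 2
      have "Suc k mod ?n < ?n" by (rule mod_less_divisor) (use p in auto)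
      then have "p = Suc k mod ?n"
        using 2 C p by (auto simp: cycle_component_def nth_eq_iff_index_eq)
      then have "?q = k" using k(1) by (cases "Suc k < ?n") (auto simp: mod_Suc)
      then show ?thesis using 2 by simp
    qed
  }
  assume "w = vs ! (Suc p mod ?n) \<or> w = vs ! ?q"
  then show "adjacent H (vs ! p) w"
    using cycle_component_adjacent_Suc[OF C p] cycle_component_adjacent_Suc[OF C q(1)]
      adjacent_sym[of H] unfolding q(2) by auto
qed

locale degree_two =
  fixes H :: "('a \<times> 'j) set"
  assumes fin: "finite H"
    and degree: "\<And>v. card {w. adjacent H v w} \<le> 2"
begin

lemma finite_neighbours: "finite {w. adjacent H v w}"
proof -
  have "w \<in> Inl ` fst ` H \<union> Inr ` snd ` H" if "adjacent H v w" for w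
    using that by (cases v; cases w) force+
  then have "{w. adjacent H v w} \<subseteq> Inl ` fst ` H \<union> Inr ` snd ` H" by blast
  then show ?thesis using fin by (auto intro: finite_subset)
qed

lemma two_neighbours:
  assumes "adjacent H v x" "adjacent H v y" "x \<noteq> y" "adjacent H v w"
  shows "w = x \<or> w = y"
proof (rule ccontr)
  assume "\<not> (w = x \<or> w = y)"
  then have "card {x, y, w} = 3" using assms by auto
  moreover have "card {x, y, w} \<le> card {w. adjacent H v w}"
    using assms finite_neighbours by (intro card_mono) auto
  ultimately show False using degree[of v] by simp
qed

text \<open>An inner vertex before the predecessor already has its two neighbours on the path, and
  the first vertex is excluded by the absence of a closing edge, so only the predecessor
  remains.\<close>

lemma maximal_path_last:
  assumes vs: "distinct vs" "successively (adjacent H) vs" "2 \<le> length vs"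
    and max: "\<And>w. adjacent H (last vs) w \<Longrightarrow> w \<in> set vs"
    and nocycle: "\<not> (3 \<le> length vs \<and> adjacent H (last vs) (hd vs))"
    and w: "adjacent H (last vs) w"
  shows "w = vs ! (length vs - 2)"
proof -
  let ?n = "length vs"
  have suc: "adjacent H (vs ! k) (vs ! Suc k)" if "Suc k < ?n" for k
    using vs that by (auto simp: successively_conv_nth)
  have ne: "vs \<noteq> []" using vs by auto
  have last: "last vs = vs ! (?n - 1)" using ne by (simp add: last_conv_nth)
  obtain p where p: "p < ?n" "w = vs ! p" using max[OF w] by (auto simp: in_set_conv_nth)
  have "p \<noteq> ?n - 1"
    using w p last adjacent_isl[of H "last vs" w] by auto
  moreover have "\<not> (0 < p \<and> p < ?n - 2)"
  proof
    assume p': "0 < p \<and> p < ?n - 2"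
    have "adjacent H (vs ! p) (vs ! Suc p)" using suc p' by auto
    moreover have "adjacent H (vs ! p) (vs ! (p - 1))"
      using suc[of "p - 1"] p' adjacent_sym[of H] by auto
    moreover have "vs ! Suc p \<noteq> vs ! (p - 1)" using vs(1) p' nth_eq_iff_index_eq[of vs "Suc p" "p - 1"] by fastforce
    moreover have "adjacent H (vs ! p) (vs ! (?n - 1))" using w p last adjacent_sym[of H] by auto
    ultimately have "vs ! (?n - 1) = vs ! Suc p \<or> vs ! (?n - 1) = vs ! (p - 1)"
      by (rule two_neighbours)
    then show False using vs(1) p' by (auto simp: nth_eq_iff_index_eq)
  qed
  \<comment> \<open>On a path with two vertices the first one is the predecessor itself, and
    adjacency to it closes no cycle.\<close>
  moreover have "p = 0 \<Longrightarrow> ?n = 2"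
    using nocycle w p ne vs(3) by (auto simp: hd_conv_nth)
  ultimately have "p = ?n - 2" using p(1) by linarith
  then show ?thesis using p by simp
qed

text \<open>A longest path through \<open>v\<close> extends at neither end. If at least three
  vertices lie on it and its ends are adjacent, every vertex has used up its degree and the path
  closes to a cycle component; otherwise \<open>maximal_path_last\<close>, applied at both ends,
  makes it a path component.\<close>

lemma component_exists:
  assumes "adjacent H v w"
  shows "(\<exists>vs. path_component H vs \<and> v \<in> set vs) \<or> (\<exists>vs. cycle_component H vs \<and> v \<in> set vs)"
proof -
  define P where "P vs \<longleftrightarrow> distinct vs \<and> successively (adjacent H) vs \<and> v \<in> set vs \<and> 2 \<le> length vs" for vs
  let ?V = "Inl ` fst ` H \<union> Inr ` snd ` H"
  have finV: "finite ?V" using fin by auto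
  have adjV: "x \<in> ?V \<and> y \<in> ?V" if "adjacent H x y" for x y
    using that by (cases x; cases y) force+
  have "length vs < Suc (card ?V)" if "P vs" for vs
  proof -
    have "set vs \<subseteq> ?V"
    proof
      fix x assume "x \<in> set vs"
      then obtain k where k: "k < length vs" "x = vs ! k" by (auto simp: in_set_conv_nth)
      have suc: "adjacent H (vs ! i) (vs ! Suc i)" if "Suc i < length vs" for i
        using \<open>P vs\<close> that by (auto simp: P_def successively_conv_nth)
      have "2 \<le> length vs" using \<open>P vs\<close> by (simp add: P_def)
      then have "Suc k < length vs \<or> Suc (k - 1) < length vs \<and> Suc (k - 1) = k" using k(1) by linarith
      then show "x \<in> ?V" using adjV suc[of k] suc[of "k - 1"] k by metis
    qed
    then have "card (set vs) \<le> card ?V" using finV by (intro card_mono)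
    then show ?thesis using that by (auto simp: P_def distinct_card)
  qed
  moreover have "v \<noteq> w" using adjacent_isl[OF assms] by auto
  then have "P [v, w]" using assms by (auto simp: P_def)
  ultimately obtain vs where vs: "P vs" and vmax: "\<And>us. P us \<Longrightarrow> length us \<le> length vs"
    using ex_has_greatest_nat[of P "[v, w]" length "Suc (card ?V)"] by auto
  have path: "distinct vs" "successively (adjacent H) vs" "v \<in> set vs" "2 \<le> length vs"
    using vs by (auto simp: P_def)
  have ne: "vs \<noteq> []" using path by auto
  let ?n = "length vs"
  have suc: "adjacent H (vs ! k) (vs ! Suc k)" if "Suc k < ?n" for k
    using path that by (auto simp: successively_conv_nth)
  have max: "x \<in> set vs" if "adjacent H (last vs) x" for x
  proof (rule ccontr)
    assume "x \<notin> set vs"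
    then have "P (vs @ [x])" using path that ne by (auto simp: P_def successively_append_iff)
    then show False using vmax by fastforce
  qed
  have max': "x \<in> set vs" if "adjacent H (hd vs) x" for x
  proof (rule ccontr)
    assume "x \<notin> set vs"
    then have "P (x # vs)"
      using path that ne adjacent_sym[of H] by (auto simp: P_def successively_Cons)
    then show False using vmax by fastforce
  qed
  show ?thesis
  proof (cases "3 \<le> ?n \<and> adjacent H (last vs) (hd vs)")
    case True
    have csuc: "adjacent H (vs ! k) (vs ! (Suc k mod ?n))" if "k < ?n" for k
    proof (cases "Suc k < ?n")
      case False
      then have "k = ?n - 1" using that by simp
      then show ?thesis using True ne by (simp add: last_conv_nth hd_conv_nth)
    qed (use suc in auto)
    have inc: "incident_edges H (set vs) \<subseteq> set (cycle_edges vs)"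
    proof
      fix e assume "e \<in> incident_edges H (set vs)"
      then obtain x y where e: "e = edge_between x y" "x \<in> set vs" "adjacent H x y"
        by (auto simp: incident_edges_eq)
      then obtain p where p: "p < ?n" "x = vs ! p" by (auto simp: in_set_conv_nth)
      define q where "q = (p + ?n - 1) mod ?n"
      have q: "q < ?n" "Suc q mod ?n = p"
        unfolding q_def by (rule mod_less_divisor) (use p Suc_pred_mod[OF p(1)] in auto)
      \<comment> \<open>Three vertices are needed for the two cyclic neighbours to differ; then they
        exhaust the degree.\<close>
      have "q \<noteq> Suc p mod ?n"
        using True p q by (auto simp: mod_Suc split: if_splits)
      moreover have "Suc p mod ?n < ?n" by (rule mod_less_divisor) (use p in auto)
      ultimately have ne': "vs ! (Suc p mod ?n) \<noteq> vs ! q"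
        using path(1) q(1) nth_eq_iff_index_eq[of vs "Suc p mod ?n" q] by auto
      have "adjacent H x (vs ! (Suc p mod ?n))" using csuc p by simp
      moreover have "adjacent H x (vs ! q)" using csuc[OF q(1)] p q adjacent_sym[of H] by auto
      ultimately have "y = vs ! (Suc p mod ?n) \<or> y = vs ! q"
        using ne' e(3) by (rule two_neighbours)
      then show "e \<in> set (cycle_edges vs)"
      proof
        assume "y = vs ! q"
        then have "e = edge_between (vs ! q) (vs ! (Suc q mod ?n))"
          using e(1) p q by (simp add: edge_between_commute)
        then show ?thesis using q by (auto simp: set_cycle_edges)
      qed (use e p in \<open>auto simp: set_cycle_edges\<close>)
    qed
    moreover have "set (cycle_edges vs) \<subseteq> incident_edges H (set vs)"
      using csuc by (force simp: set_cycle_edges incident_edges_eq)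
    ultimately have "cycle_component H vs" using True path by (auto simp: cycle_component_def)
    then show ?thesis using path by auto
  next
    case False
    have "incident_edges H (set vs) \<subseteq> set (path_edges vs)"
    proof
      fix e assume "e \<in> incident_edges H (set vs)"
      then obtain x y where e: "e = edge_between x y" "x \<in> set vs" "adjacent H x y"
        by (auto simp: incident_edges_eq)
      then obtain p where p: "p < ?n" "x = vs ! p" by (auto simp: in_set_conv_nth)
      have "(Suc p < ?n \<and> y = vs ! Suc p) \<or> (0 < p \<and> y = vs ! (p - 1))"
      proof -
        consider "p = ?n - 1" | "p = 0" | "0 < p" "Suc p < ?n" using p by linarith
        then show ?thesis
        proof cases
          case 1
          then have "y = vs ! (?n - 2)"
            using maximal_path_last[OF path(1,2,4) max False, of y] e p ne by (simp add: last_conv_nth)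
          moreover have "0 < p" "p - 1 = ?n - 2" using 1 path(4) by auto
          ultimately show ?thesis by simp
        next
          case 2
          have nc: "\<not> (3 \<le> length (rev vs) \<and> adjacent H (last (rev vs)) (hd (rev vs)))"
            using False ne adjacent_sym[of H] by (auto simp: hd_rev last_rev)
          have sr: "successively (adjacent H) (rev vs)" using path(2) by (simp only: successively_adjacent_rev)
          have "x = hd vs" using p 2 ne by (simp add: hd_conv_nth)
          then have "y = rev vs ! (length (rev vs) - 2)"
            using e(3) path max' ne
            by (intro maximal_path_last[OF _ sr _ _ nc]) (auto simp: last_rev)
          then show ?thesis using path(4) 2 by (simp add: rev_nth Suc_diff_Suc numeral_2_eq_2)
        next
          case 3
          have "adjacent H x (vs ! Suc p)" "adjacent H x (vs ! (p - 1))"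
            using suc[of p] suc[of "p - 1"] 3 p adjacent_sym[of H] by auto
          moreover have "vs ! Suc p \<noteq> vs ! (p - 1)" using path(1) 3 nth_eq_iff_index_eq[of vs "Suc p" "p - 1"] by auto
          ultimately have "y = vs ! Suc p \<or> y = vs ! (p - 1)" using e(3) by (rule two_neighbours)
          then show ?thesis using 3 by auto
        qed
      qed
      then show "e \<in> set (path_edges vs)"
      proof
        assume "0 < p \<and> y = vs ! (p - 1)"
        then have "e = edge_between (vs ! (p - 1)) (vs ! Suc (p - 1)) \<and> Suc (p - 1) < ?n"
          using e(1) p by (simp add: edge_between_commute)
        then show ?thesis unfolding set_path_edges by blast
      qed (use e p in \<open>auto simp: set_path_edges\<close>)
    qed
    moreover have "set (path_edges vs) \<subseteq> incident_edges H (set vs)"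
      using suc by (force simp: set_path_edges incident_edges_eq)
    ultimately have "path_component H vs" using path by (auto simp: path_component_def)
    then show ?thesis using path by auto
  qed
qed

end

section \<open>The colours at a vertex\<close>

lemma alternating_nth: "alternating B es \<Longrightarrow> Suc k < length es \<Longrightarrow> es ! k \<in> B \<longleftrightarrow> es ! Suc k \<notin> B"
  by (auto simp: alternating_def successively_conv_nth)

text \<open>This turns the condition that an odd path has more blue than red edges into the colour
  of its first edge.\<close>

lemma alternating_balance:
  assumes "alternating B es"
  shows "int (length (filter (\<lambda>e. e \<in> B) es)) - int (length (filter (\<lambda>e. e \<notin> B) es)) =
    (if even (length es) then 0 else if hd es \<in> B then 1 else -1)"
  using assms
proof (induction es)
  case (Cons e es)
  have "alternating B es" using Cons.prems by (cases es) (simp_all add: alternating_def)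
  note IH = Cons.IH[OF this]
  show ?case
  proof (cases es)
    case Nil
    then show ?thesis by auto
  next
    case (Cons e' es')
    have "e \<in> B \<longleftrightarrow> hd es \<notin> B" using Cons.prems Cons by (simp add: alternating_def)
    then show ?thesis using IH by auto
  qed
qed simp

text \<open>The colouring condition compares cardinalities of edge sets, whereas alternation counts
  list entries; distinctness identifies the two counts.\<close>

lemma distinct_path_edges:
  assumes "path_component H vs" shows "distinct (path_edges vs)"
proof -
  have suc: "adjacent H (vs ! k) (vs ! Suc k)" if "Suc k < length vs" for k
    using assms that by (auto simp: path_component_def successively_conv_nth)
  have "path_edges vs ! i \<noteq> path_edges vs ! k" if "i < k" "Suc k < length vs" for i k
  proof -
    have "distinct vs" using assms by (simp add: path_component_def)
    then have "vs ! i \<noteq> vs ! k" "vs ! i \<noteq> vs ! Suc k"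
      using that by (auto simp: nth_eq_iff_index_eq)
    then show ?thesis
      using that edge_between_inject[OF suc suc, of i k] by (auto simp: nth_path_edges)
  qed
  then show ?thesis by (auto simp: distinct_conv_nth less_diff_conv) (metis linorder_neqE_nat)
qed

locale tsm_coloured = degree_two H for H :: "('a \<times> 'j) set" +
  fixes B R :: "('a \<times> 'j) set"
  assumes colouring: "tsm_colouring H B R"
begin

lemma H_eq: "H = B \<union> R" and disjoint: "B \<inter> R = {}"
  using colouring by (auto simp: tsm_colouring_def)

lemma last_isl:
  assumes "path_component H vs" "even (length (path_edges vs))"
  shows "isl (last vs) \<longleftrightarrow> isl (hd vs)"
proof -
  have "vs \<noteq> []" "successively (adjacent H) vs" using assms by (auto simp: path_component_def)
  then show ?thesis
    using assms(2) successively_isl[of H vs "length vs - 1"] by (auto simp: last_conv_nth)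
qed

lemma path_pattern:
  assumes P: "path_component H vs"
  shows "alternating B (path_edges vs) \<or> (even (length (path_edges vs)) \<and> \<not> isl (hd vs) \<and> \<not> isl (last vs) \<and>
    (impression_pattern B (path_edges vs) \<or> impression_pattern B (path_edges (rev vs))))"
  using colouring P last_isl[OF P] unfolding tsm_colouring_def path_edges_rev by blast

text \<open>Reversing a path is harmless, so the impression pattern may be assumed to start at the
  head.\<close>

lemma component_exists':
  assumes "adjacent H v w"
  obtains vs where "path_component H vs" "v \<in> set vs"
      "alternating B (path_edges vs) \<or> \<not> isl (hd vs) \<and> impression_pattern B (path_edges vs)"
  | vs where "cycle_component H vs" "v \<in> set vs" "alternating_cyclically B (cycle_edges vs)"
  using component_exists[OF assms]
proof
  assume "\<exists>vs. path_component H vs \<and> v \<in> set vs"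
  then obtain vs where vs: "path_component H vs" "v \<in> set vs" by auto
  then have "vs \<noteq> []" by auto
  with path_pattern[OF vs(1)] consider
    "alternating B (path_edges vs) \<or> \<not> isl (hd vs) \<and> impression_pattern B (path_edges vs)" |
    "\<not> isl (hd (rev vs)) \<and> impression_pattern B (path_edges (rev vs))"
    by (auto simp: hd_rev)
  then show thesis
    using that(1)[OF vs] that(1)[OF path_component_rev[OF vs(1)]] vs(2) by cases auto
next
  assume "\<exists>vs. cycle_component H vs \<and> v \<in> set vs"
  then show thesis using that(2) colouring unfolding tsm_colouring_def by blast
qed

lemma cycle_pred:
  assumes "cycle_component H vs" "p < length vs"
  defines "q \<equiv> (p + length vs - 1) mod length vs"
  shows "q < length vs" "Suc q mod length vs = p" "vs ! (Suc p mod length vs) \<noteq> vs ! q"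
proof -
  let ?n = "length vs"
  show q: "q < ?n" "Suc q mod ?n = p"
    unfolding q_def by (rule mod_less_divisor) (use assms(2) Suc_pred_mod[OF assms(2)] in auto)
  have "3 \<le> ?n" "distinct vs" using assms(1) by (auto simp: cycle_component_def)
  moreover from this have "q \<noteq> Suc p mod ?n" using q assms(2) by (auto simp: mod_Suc split: if_splits)
  moreover have "Suc p mod ?n < ?n" by (rule mod_less_divisor) (use assms(2) in auto)
  ultimately show "vs ! (Suc p mod ?n) \<noteq> vs ! q"
    using q(1) nth_eq_iff_index_eq[of vs] by metis
qed

text \<open>The only consecutive edges of equal colour are the two leading blue ones of an
  impression pattern. They meet at position 1 of a path that starts at an impression, hence at an
  ad.\<close>

lemma two_colours:
  assumes w: "adjacent H v w" "adjacent H v w'" "w \<noteq> w'"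
  shows "(edge_between v w \<in> B \<longleftrightarrow> edge_between v w' \<notin> B) \<or>
    isl v \<and> edge_between v w \<in> B \<and> edge_between v w' \<in> B" (is "?D w w'")
  using w(1)
proof (cases rule: component_exists')
  case (1 vs)
  let ?es = "path_edges vs"
  obtain p where p: "p < length vs" "v = vs ! p" using 1(2) by (auto simp: in_set_conv_nth)
  have p': "0 < p" "Suc p < length vs"
    and ww: "w = vs ! Suc p \<and> w' = vs ! (p - 1) \<or> w = vs ! (p - 1) \<and> w' = vs ! Suc p"
    using path_component_adjacent[OF 1(1) p(1)] w p(2) by auto
  have e1: "edge_between v (vs ! (p - 1)) = ?es ! (p - 1)"
    using p p' by (simp add: nth_path_edges edge_between_commute)
  have e2: "edge_between v (vs ! Suc p) = ?es ! p"
    using p p' by (simp add: nth_path_edges)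
  have "(?es ! (p - 1) \<in> B \<longleftrightarrow> ?es ! p \<notin> B) \<or> isl v \<and> ?es ! (p - 1) \<in> B \<and> ?es ! p \<in> B"
    using 1(3)
  proof
    assume "alternating B ?es"
    from alternating_nth[OF this, of "p - 1"] show ?thesis using p' by auto
  next
    assume pat: "\<not> isl (hd vs) \<and> impression_pattern B ?es"
    have "isl v \<longleftrightarrow> odd p"
      using successively_isl[of H vs p] 1(1) p pat by (auto simp: path_component_def)
    moreover have "?es ! (p - 1) \<in> B \<longleftrightarrow> p - 1 = 0 \<or> odd (p - 1)"
      and "?es ! p \<in> B \<longleftrightarrow> p = 0 \<or> odd p"
      using pat p' unfolding impression_pattern_def by auto
    ultimately show ?thesis using p' by auto
  qed
  then show ?thesis using ww e1 e2 by auto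
next
  case (2 vs)
  let ?es = "cycle_edges vs" and ?n = "length vs"
  obtain p where p: "p < ?n" "v = vs ! p" using 2(2) by (auto simp: in_set_conv_nth)
  define q where "q = (p + ?n - 1) mod ?n"
  have q: "q < ?n" "Suc q mod ?n = p" using cycle_pred[OF 2(1) p(1)] by (auto simp: q_def)
  have ww: "w = vs ! (Suc p mod ?n) \<and> w' = vs ! q \<or> w = vs ! q \<and> w' = vs ! (Suc p mod ?n)"
    using cycle_component_adjacent[OF 2(1) p(1)] w p(2) by (auto simp: q_def)
  have e1: "edge_between v (vs ! q) = ?es ! q"
    using p q by (simp add: nth_cycle_edges edge_between_commute)
  have e2: "edge_between v (vs ! (Suc p mod ?n)) = ?es ! p"
    using p q by (simp add: nth_cycle_edges)
  have "?es ! q \<in> B \<longleftrightarrow> ?es ! p \<notin> B"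
  proof (cases "Suc q < ?n")
    case True
    then have "p = Suc q" using q by simp
    then show ?thesis using alternating_nth[of B ?es q] 2(3) True by (auto simp: alternating_cyclically_def)
  next
    case False
    then have "Suc q = ?n" using q(1) by linarith
    then have "q = ?n - 1" "p = 0" "?es \<noteq> []"
      using q(2) length_cycle_edges[of vs] by (auto simp del: length_cycle_edges)
    then show ?thesis
      using 2(3) by (auto simp: alternating_cyclically_def last_conv_nth hd_conv_nth)
  qed
  then show ?thesis using ww e1 e2 by auto
qed

text \<open>Inner vertices of a path and all vertices of a cycle have two distinct neighbours, so a
  leaf is an end of a path, and reversal puts it at the head.\<close>

lemma leaf_path:
  assumes "adjacent H v w" and leaf: "\<And>w'. adjacent H v w' \<Longrightarrow> w' = w"
  obtains vs where "path_component H vs" "hd vs = v" "path_edges vs ! 0 = edge_between v w"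
proof -
  have hd: "path_edges vs ! 0 = edge_between v w" if "path_component H vs" "hd vs = v" for vs
  proof -
    have len: "2 \<le> length vs" using that by (simp add: path_component_def)
    then have v: "v = vs ! 0" using that(2) by (metis hd_conv_nth list.size(3) not_numeral_le_zero)
    have "0 < length vs" "Suc 0 < length vs" using len by linarith+
    then have "adjacent H v (vs ! 1)" using path_component_adjacent[OF that(1), of 0] v by simp
    then have "vs ! 1 = w" by (rule leaf)
    then show ?thesis using len v by (simp add: nth_path_edges)
  qed
  show thesis
    using assms(1)
  proof (cases rule: component_exists')
    case (1 vs)
    obtain p where p: "p < length vs" "v = vs ! p" using 1(2) by (auto simp: in_set_conv_nth)
    have vs: "vs \<noteq> []" "distinct vs" using 1(1) by (auto simp: path_component_def)
    have "\<not> (0 < p \<and> Suc p < length vs)"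
    proof
      assume p': "0 < p \<and> Suc p < length vs"
      then have "vs ! Suc p = w" "vs ! (p - 1) = w"
        using path_component_adjacent[OF 1(1) p(1)] p(2) leaf by auto
      then have "vs ! Suc p = vs ! (p - 1)" by simp
      then show False using vs(2) p' nth_eq_iff_index_eq[of vs "Suc p" "p - 1"] by fastforce
    qed
    then consider "p = 0" | "p = length vs - 1" using p(1) by linarith
    then show ?thesis
    proof cases
      case 1
      then show ?thesis using that[OF _ _ hd] \<open>path_component H vs\<close> vs p by (simp add: hd_conv_nth)
    next
      case 2
      then have "hd (rev vs) = v" using vs p by (simp add: hd_rev last_conv_nth)
      then show ?thesis using that[OF _ _ hd] path_component_rev[OF 1(1)] by simp
    qed
  next
    case (2 vs)
    obtain p where p: "p < length vs" "v = vs ! p" using 2(2) by (auto simp: in_set_conv_nth)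
    then show ?thesis
      using cycle_component_adjacent[OF 2(1) p(1)] cycle_pred(3)[OF 2(1) p(1)] leaf by metis
  qed
qed

text \<open>An alternating list of odd length has one more entry of the colour of its first edge,
  and the colouring gives the majority to blue.\<close>

lemma odd_path_blue:
  assumes P: "path_component H vs" and odd: "odd (length (path_edges vs))"
  shows "path_edges vs ! 0 \<in> B"
proof -
  let ?es = "path_edges vs"
  have alt: "alternating B ?es" and more: "card (set ?es \<inter> R) < card (set ?es \<inter> B)"
    using colouring P odd by (auto simp: tsm_colouring_def)
  have sub: "set ?es \<subseteq> H" using P by (auto simp: path_component_def incident_edges_def)
  have "length (filter P ?es) = card {e \<in> set ?es. P e}" for P
    using distinct_card[of "filter P ?es"] distinct_path_edges[OF P] by simp
  moreover have "{e \<in> set ?es. e \<in> B} = set ?es \<inter> B" "{e \<in> set ?es. e \<notin> B} = set ?es \<inter> R"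
    using sub H_eq disjoint by auto
  moreover have "?es \<noteq> []" using odd by (metis even_zero list.size(3))
  ultimately show ?thesis
    using alternating_balance[OF alt] more odd by (auto simp: hd_conv_nth split: if_splits)
qed

text \<open>A leaf starts a path. If the length is odd, the first edge is blue. If it is even, both
  ends are impressions and the impression pattern is blue at index 0 and at the last, odd index, so
  the orientation does not matter.\<close>

lemma leaf_impression_blue:
  assumes "(a, j) \<in> H" and leaf: "\<And>a'. (a', j) \<in> H \<Longrightarrow> a' = a"
  shows "(a, j) \<in> B"
proof -
  have adj: "adjacent H (Inr j) (Inl a)" using assms(1) by simp
  have only: "w = Inl a" if "adjacent H (Inr j) w" for w using that by (cases w) (auto dest: leaf)
  obtain vs where vs: "path_component H vs" "hd vs = Inr j"
    "path_edges vs ! 0 = edge_between (Inr j) (Inl a)"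
    by (rule leaf_path[OF adj only])
  show ?thesis
  proof (cases "even (length (path_edges vs))")
    case True
    have len: "path_edges vs \<noteq> []"
    proof -
      have "0 < length (path_edges vs)" using vs(1) by (simp add: path_component_def)
      then show ?thesis by blast
    qed
    have pat: "impression_pattern B (path_edges vs) \<or> impression_pattern B (rev (path_edges vs))"
      using colouring vs True last_isl[OF vs(1)] by (auto simp: tsm_colouring_def)
    moreover have "rev (path_edges vs) ! (length (path_edges vs) - 1) = path_edges vs ! 0"
      using len by (simp add: rev_nth del: length_path_edges)
    moreover have "odd (length (path_edges vs) - 1)" using True len by (simp del: length_path_edges)
    moreover have "0 < length (path_edges vs)" "length (path_edges vs) - 1 < length (rev (path_edges vs))"
      using len by (auto simp del: length_path_edges)
    ultimately have "path_edges vs ! 0 \<in> B" unfolding impression_pattern_def by metis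
    then show ?thesis using vs(3) by simp
  next
    case False
    then show ?thesis using odd_path_blue[OF vs(1)] vs(3) by simp
  qed
qed

lemma impression_colours:
  assumes "(a, j) \<in> H" "(a', j) \<in> H" "a \<noteq> a'"
  shows "(a, j) \<in> B \<longleftrightarrow> (a', j) \<in> R"
  using two_colours[of "Inr j" "Inl a" "Inl a'"] assms H_eq disjoint by auto

lemma inj_on_snd_B: "inj_on snd B"
proof (rule inj_onI, clarsimp)
  fix a a' j assume "(a, j) \<in> B" "(a', j) \<in> B"
  then show "a = a'" using impression_colours[of a j a'] disjoint H_eq by auto
qed

lemma inj_on_snd_R: "inj_on snd R"
proof (rule inj_onI, clarsimp)
  fix a a' j assume "(a, j) \<in> R" "(a', j) \<in> R"
  then show "a = a'" using impression_colours[of a j a'] disjoint H_eq by auto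
qed

text \<open>The exceptional pair of equal colours at an ad is blue. Hence red is a matching, whereas
  blue is injective on impressions only, and an ad may have two blue edges.\<close>

lemma inj_on_fst_R: "inj_on fst R"
proof (rule inj_onI)
  fix e e' assume e: "e \<in> R" "e' \<in> R" "fst e = fst e'"
  obtain a j j' where ee: "e = (a, j)" "e' = (a, j')" using e(3) by (cases e; cases e') auto
  show "e = e'"
    using two_colours[of "Inl a" "Inr j" "Inr j'"] e ee H_eq disjoint by auto
qed

text \<open>A path that starts at an ad with a red edge cannot have odd length. So it ends at
  another ad, where alternation makes the last edge blue. Mapping a red leaf to the other end of its
  path is injective.\<close>

lemma card_red_leaves_le:
  assumes "finite A" "fst ` H \<subseteq> A"
  shows "card {a. \<exists>j. H `` {a} = {j} \<and> (a, j) \<in> R} \<le> card {a. \<exists>j. H `` {a} = {j} \<and> (a, j) \<in> B}"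
    (is "card ?LR \<le> card ?LB")
proof -
  have leaf: "w = Inr j" if "H `` {a} = {j}" "adjacent H (Inl a) w" for a j w
    using that by (cases w) auto
  define Q where "Q a vs a' \<longleftrightarrow> path_component H vs \<and> hd vs = Inl a \<and> last vs = Inl a' \<and> a' \<in> ?LB"
    for a vs a'
  have "\<exists>vs a'. Q a vs a'" if a: "a \<in> ?LR" for a
  proof -
    obtain j where j: "H `` {a} = {j}" "(a, j) \<in> R" using a by auto
    have adj: "adjacent H (Inl a) (Inr j)" using j H_eq by auto
    obtain vs where vs: "path_component H vs" "hd vs = Inl a"
      "path_edges vs ! 0 = edge_between (Inl a) (Inr j)"
      by (rule leaf_path[OF adj leaf[OF j(1)]])
    let ?es = "path_edges vs"
    have ev: "even (length ?es)"
      using odd_path_blue[OF vs(1)] vs(3) j(2) disjoint by auto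
    have len: "2 \<le> length vs" and ne: "vs \<noteq> []" using vs(1) by (auto simp: path_component_def)
    have "isl (last vs)" using last_isl[OF vs(1) ev] vs(2) by simp
    then obtain a' where a': "last vs = Inl a'" by (cases "last vs") auto
    have alt: "alternating B ?es"
      using colouring vs ev a' by (auto simp: tsm_colouring_def)
    have colour: "?es ! k \<in> B \<longleftrightarrow> odd k" if "k < length ?es" for k
      using that
    proof (induction k)
      case 0
      then show ?case using vs(3) j(2) disjoint by auto
    next
      case (Suc k)
      then show ?case using alternating_nth[OF alt, of k] by auto
    qed
    define m where "m = length vs - 1"
    have m: "m < length vs" "last vs = vs ! m" "0 < m" "Suc (m - 1) = m"
      using len ne by (auto simp: m_def last_conv_nth)
    have only: "adjacent H (Inl a') w \<longleftrightarrow> w = vs ! (m - 1)" for w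
      using path_component_adjacent[OF vs(1) m(1), of w] m a' by (auto simp: m_def)
    have "adjacent H (Inl a') (vs ! (m - 1))" unfolding only by (rule refl)
    then obtain j' where j': "vs ! (m - 1) = Inr j'"
      by (cases "vs ! (m - 1)") auto
    have "x \<in> H `` {a'} \<longleftrightarrow> x = j'" for x
      using only[of "Inr x"] unfolding j' by simp
    then have "H `` {a'} = {j'}" by blast
    moreover have "(a', j') \<in> B"
    proof -
      have "?es ! (m - 1) = (a', j')"
      proof -
        have "vs ! m = Inl a'" using m(2) a' by simp
        then show ?thesis using m(1,4) j' nth_path_edges[of "m - 1" vs] by simp
      qed
      moreover have "odd (m - 1)" using ev m(3) by (auto simp: m_def)
      ultimately show ?thesis using colour[of "m - 1"] m by (simp add: m_def)
    qed
    ultimately have "Q a vs a'" using vs(1,2) a' unfolding Q_def by blast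
    then show ?thesis by blast
  qed
  then have "\<forall>a\<in>?LR. \<exists>vs a'. Q a vs a'" by (rule ballI)
  then obtain pth end_ad where "\<forall>a\<in>?LR. Q a (pth a) (end_ad a)" unfolding bchoice_iff by blast
  then have pth: "path_component H (pth a) \<and> hd (pth a) = Inl a \<and> last (pth a) = Inl (end_ad a) \<and> end_ad a \<in> ?LB"
    if "a \<in> ?LR" for a
    using that unfolding Q_def by (rule bspec)
  have "inj_on end_ad ?LR"
  proof (rule inj_onI)
    fix a1 a2 assume a: "a1 \<in> ?LR" "a2 \<in> ?LR" and eq: "end_ad a1 = end_ad a2"
    let ?p = "pth a1" and ?q = "pth a2"
    have P: "path_component H ?p" "hd ?p = Inl a1" "last ?p = Inl (end_ad a1)"
      and Q: "path_component H ?q" "hd ?q = Inl a2" "last ?q = Inl (end_ad a1)"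
      and e: "end_ad a1 \<in> ?LB"
      using pth[OF a(1)] pth[OF a(2)] eq by auto
    have nep: "?p \<noteq> []" and neq: "?q \<noteq> []" and dq: "distinct ?q"
      using P(1) Q(1) by (auto simp: path_component_def)
    \<comment> \<open>Walking \<open>?p\<close> back from the common end therefore never leaves
      \<open>?q\<close>, so \<open>a1\<close> lies on \<open>?q\<close>. As a leaf it is an end of
      \<open>?q\<close>; it is not the last vertex, whose edge is blue, and so it is the head
      \<open>a2\<close>.\<close>
    have closed: "y \<in> set ?q" if "x \<in> set ?q" "adjacent H x y" for x y
    proof -
      obtain k where "k < length ?q" "x = ?q ! k" using \<open>x \<in> set ?q\<close> by (auto simp: in_set_conv_nth)
      then show ?thesis using path_component_adjacent[OF Q(1), of k y] that(2) by auto
    qed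
    have "?p ! (length ?p - 1 - k) \<in> set ?q" if "k < length ?p" for k
      using that
    proof (induction k)
      case 0
      have "?p ! (length ?p - 1) = last ?q" using P(3) Q(3) nep by (simp add: last_conv_nth)
      then show ?case using neq by simp
    next
      case (Suc k)
      let ?i = "length ?p - 1 - k"
      have i: "0 < ?i" "?i < length ?p" "length ?p - 1 - Suc k = ?i - 1" using Suc.prems by auto
      have "adjacent H (?p ! ?i) (?p ! (?i - 1))" using path_component_adjacent[OF P(1) i(2)] i by blast
      then show ?case using closed Suc i by simp
    qed
    from this[of "length ?p - 1"] have "Inl a1 \<in> set ?q"
      using nep P(2) by (simp add: hd_conv_nth)
    then obtain k where k: "k < length ?q" "Inl a1 = ?q ! k" by (auto simp: in_set_conv_nth)
    obtain j where j: "H `` {a1} = {j}" "(a1, j) \<in> R" using a(1) by auto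
    have "\<not> (0 < k \<and> Suc k < length ?q)"
    proof
      assume k': "0 < k \<and> Suc k < length ?q"
      then have "?q ! Suc k = Inr j" "?q ! (k - 1) = Inr j"
        using path_component_adjacent[OF Q(1) k(1)] k(2) leaf[OF j(1)] by auto
      then have "?q ! Suc k = ?q ! (k - 1)" by simp
      then show False using dq k' nth_eq_iff_index_eq[of ?q "Suc k" "k - 1"] by fastforce
    qed
    then consider "k = 0" | "k = length ?q - 1" using k(1) by linarith
    then show "a1 = a2"
    proof cases
      case 1
      then show ?thesis using k Q(2) neq by (simp add: hd_conv_nth)
    next
      case 2
      then have "a1 = end_ad a1" using k Q(3) neq by (simp add: last_conv_nth)
      then have "a1 \<in> ?LB" using e by simp
      then show ?thesis using j disjoint by auto
    qed
  qed
  moreover have "end_ad ` ?LR \<subseteq> ?LB" using pth by blast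
  moreover have "finite ?LB"
    by (rule finite_subset[OF _ assms(1)]) (use assms(2) H_eq in force)
  ultimately show ?thesis by (intro card_inj_on_le)
qed

end

section \<open>Counting ads against the cut\<close>

lemma exp_minus_one_bounds: "exp (-1) > (367879 / 1000000 :: real)" "exp (-1) < (36788 / 100000 :: real)"
proof -
  have "exp 1 - 5837465777 / 2147483648 \<le> (inverse (2 ^ 32) :: real)"
    "- (exp 1 - 5837465777 / 2147483648) \<le> (inverse (2 ^ 32) :: real)"
    using e_approx_32 by (simp_all only: abs_le_iff)
  moreover have "inverse (2 ^ 32) = (1 / 4294967296 :: real)" by simp
  ultimately have e: "exp 1 > (271828182 / 100000000 :: real)" "exp 1 < (271828183 / 100000000 :: real)"
    by linarith+
  have "exp (-1) * exp 1 = (1 :: real)" by (simp flip: exp_add)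
  then have eq: "exp (-1) = 1 / (exp 1 :: real)" by (simp add: field_simps)
  show "exp (-1) > (367879 / 1000000 :: real)" "exp (-1) < (36788 / 100000 :: real)"
    unfolding eq using e by (simp_all add: field_simps)
qed

lemma tsm_ratio_eq: "tsm_ratio * (4 / 3 - 2 / 3 * exp (-1)) = 1 - 2 * (exp (-1))\<^sup>2"
proof -
  have "tsm_ratio = (1 - 2 * (exp (-1))\<^sup>2) / (4 / 3 - 2 / 3 * exp (-1))"
    by (simp add: tsm_ratio_def exp_minus inverse_eq_divide power_divide)
  moreover have "4 / 3 - 2 / 3 * exp (-1) \<noteq> (0 :: real)" using exp_minus_one_bounds by simp
  ultimately show ?thesis by (metis nonzero_eq_divide_eq)
qed

text \<open>The two bounds are exactly 0.67029 - 0.000005 and 0.67029 + 0.000005.\<close>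

lemma tsm_ratio_interval: "134057 / 200000 \<le> tsm_ratio" "tsm_ratio \<le> 134059 / 200000"
proof -
  define x where "x = exp (-1 :: real)"
  have x: "367879 / 1000000 < x" "x < 36788 / 100000" using exp_minus_one_bounds by (auto simp: x_def)
  have eq: "tsm_ratio * (4 / 3 - 2 / 3 * x) = 1 - 2 * x\<^sup>2" using tsm_ratio_eq by (simp add: x_def)
  have pos: "4 / 3 - 2 / 3 * x > 0" using x by simp
  have "x * x \<le> 36788 / 100000 * (36788 / 100000)" "367879 / 1000000 * (367879 / 1000000) \<le> x * x"
    using x by (intro mult_mono; simp)+
  then have "x * x \<le> 1353357 / 10000000" "1353349 / 10000000 \<le> x * x" by auto
  then have "134057 / 200000 * (4 / 3 - 2 / 3 * x) \<le> tsm_ratio * (4 / 3 - 2 / 3 * x)"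
    "tsm_ratio * (4 / 3 - 2 / 3 * x) \<le> 134059 / 200000 * (4 / 3 - 2 / 3 * x)"
    unfolding eq power2_eq_square using x by (simp_all add: field_simps)
  then show "134057 / 200000 \<le> tsm_ratio" "tsm_ratio \<le> 134059 / 200000"
    using pos by (blast intro: mult_right_le_imp_le)+
qed

lemma tsm_ratio_approx: "\<bar>tsm_ratio - 0.67029\<bar> \<le> 0.000005"
  unfolding abs_le_iff using tsm_ratio_interval by auto

lemma tsm_ratio_gt: "tsm_ratio > 1 - 1 / exp 1"
proof -
  have "1 / exp 1 = (exp (-1) :: real)" by (simp add: exp_minus inverse_eq_divide)
  then show ?thesis using tsm_ratio_interval exp_minus_one_bounds by linarith
qed

text \<open>Linear programming duality: \<open>nbr\<close> stands for the number of ads with b blue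
  and r red edges, \<open>z\<close> for \<open>card X + card Y\<close> and \<open>d\<close> for
  \<open>card \<delta>\<close>. The equation eliminates \<open>z\<close>, the multiplier
  \<open>t\<close> prices the bound on \<open>d\<close>, and the coefficients of the classes are
  then compared.\<close>

lemma class_inequality:
  fixes n11 n20 n10 n01 d z :: real
  defines "x \<equiv> exp (-1)"
  assumes nonneg: "0 \<le> n20" "0 \<le> n01" "n01 \<le> n10"
    and d: "3 * d \<le> 2 * n11 + 4 * n20 + 3 * n10 + n01"
    and z: "2 * z + d = 2 * n11 + 2 * n20 + n10 + n01"
  shows "tsm_ratio * (z + (1 - x) * d)
    \<le> n11 * (1 - 2 * x\<^sup>2) + n20 * (1 - x\<^sup>2) + n10 * (1 - x) + n01 * (1 - 2 * x)"
proof -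
  let ?\<alpha> = tsm_ratio
  have x: "(367879 / 1000000) < x" "x < (36788 / 100000)" using exp_minus_one_bounds by (auto simp: x_def)
  note \<alpha> = tsm_ratio_interval
  have xx: "x * x \<le> (36788 / 100000) * (36788 / 100000)" using x by (intro mult_mono) auto
  \<comment> \<open>After elimination of \<open>z\<close>, the coefficient of \<open>d\<close> is
    \<open>?\<alpha> * (1 - x - 1 / 2)\<close>; the division by 3 is due to the constraint being one
    on \<open>3 * d\<close>.\<close>
  define t where "t = ?\<alpha> * (1 / 2 - x) / 3"
  have t: "0 \<le> t" using \<alpha> x by (simp add: t_def)
  have t_le: "t \<le> (134059 / 200000) * (1 / 2 - (367879 / 1000000)) / 3"
    unfolding t_def using \<alpha> x by (intro divide_right_mono mult_mono) auto
  have "?\<alpha> * (z + (1 - x) * d) = ?\<alpha> * (n11 + n20 + (n10 + n01) / 2) + t * (3 * d)"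
  proof -
    have "z = n11 + n20 + (n10 + n01) / 2 - d / 2" using z by argo
    then show ?thesis by (simp only:) (simp add: t_def field_simps)
  qed
  also have "\<dots> \<le> ?\<alpha> * (n11 + n20 + (n10 + n01) / 2) + t * (2 * n11 + 4 * n20 + 3 * n10 + n01)"
    using t d by (intro add_left_mono mult_left_mono) auto
  also have "\<dots> = n11 * (?\<alpha> + 2 * t) + n20 * (?\<alpha> + 4 * t) + n10 * (?\<alpha> / 2 + 3 * t) + n01 * (?\<alpha> / 2 + t)"
    by (simp add: field_simps)
  finally have main: "?\<alpha> * (z + (1 - x) * d)
    \<le> n11 * (?\<alpha> + 2 * t) + n20 * (?\<alpha> + 4 * t) + n10 * (?\<alpha> / 2 + 3 * t) + n01 * (?\<alpha> / 2 + t)" .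
  \<comment> \<open>Equality here is the defining equation of the ratio, since
    \<open>?\<alpha> + 2 * t = ?\<alpha> * (4 / 3 - 2 / 3 * x)\<close>. The other classes leave
    slack, the last two only jointly.\<close>
  have c11: "?\<alpha> + 2 * t = 1 - 2 * x\<^sup>2"
    using tsm_ratio_eq by (simp add: t_def x_def field_simps)
  have c20: "n20 * (?\<alpha> + 4 * t) \<le> n20 * (1 - x\<^sup>2)"
    using nonneg xx \<alpha> t_le by (intro mult_left_mono) (auto simp: power2_eq_square)
  \<comment> \<open>A red leaf falls short by about 0.10 and a blue leaf has about 0.21 to spare;
    \<open>n01 \<le> n10\<close> lets the latter pay for the former.\<close>
  have c10: "n10 * (?\<alpha> / 2 + 3 * t) + n01 * (?\<alpha> / 2 + t) \<le> n10 * (1 - x) + n01 * (1 - 2 * x)"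
  proof -
    have "n01 * (?\<alpha> / 2 + t - (1 - 2 * x)) \<le> n10 * (1 - x - (?\<alpha> / 2 + 3 * t))"
    proof -
      have "n01 * (?\<alpha> / 2 + t - (1 - 2 * x)) \<le> n01 * (1 - x - (?\<alpha> / 2 + 3 * t))"
        using nonneg \<alpha> t_le x by (intro mult_left_mono) auto
      also have "\<dots> \<le> n10 * (1 - x - (?\<alpha> / 2 + 3 * t))"
        using nonneg \<alpha> t_le x by (intro mult_right_mono) auto
      finally show ?thesis .
    qed
    then show ?thesis by (simp add: algebra_simps)
  qed
  show ?thesis using main c20 c10 unfolding c11 by linarith
qed

section \<open>Counting coloured edges by the degrees of their ends\<close>

lemma card_edges_fst:
  assumes "finite H" "finite X"
  shows "card {e \<in> H. fst e \<in> X} = (\<Sum>a\<in>X. card (H `` {a}))"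
proof -
  have "{e \<in> H. fst e \<in> X} = (SIGMA a:X. H `` {a})" by auto
  then show ?thesis using assms by (simp add: card_SigmaI finite_Image)
qed

lemma card_edges_snd:
  assumes "finite H" "finite Y"
  shows "card {e \<in> H. snd e \<in> Y} = (\<Sum>j\<in>Y. card (H\<inverse> `` {j}))"
proof -
  have "{e \<in> H\<inverse>. fst e \<in> Y} = prod.swap ` {e \<in> H. snd e \<in> Y}" by force
  then have "card {e \<in> H\<inverse>. fst e \<in> Y} = card {e \<in> H. snd e \<in> Y}"
    by (simp add: card_image inj_on_subset[OF inj_swap])
  then show ?thesis using card_edges_fst[of "H\<inverse>" Y] assms by simp
qed

lemma card_Image_le_1: "inj_on fst M \<Longrightarrow> finite M \<Longrightarrow> card (M `` {a}) \<le> 1"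
  by (auto simp: card_le_Suc0_iff_eq finite_Image dest: inj_on_fstD)

lemma card_converse_Image_le_1: "inj_on snd M \<Longrightarrow> finite M \<Longrightarrow> card (M\<inverse> `` {j}) \<le> 1"
  by (auto simp: card_le_Suc0_iff_eq finite_Image dest: inj_on_sndD)

locale tsm_cut = tsm_coloured H B R for H B R :: "('a \<times> 'j) set" +
  fixes A :: "'a set" and J :: "'j set" and X :: "'a set" and Y :: "'j set"
  assumes finA: "finite A" and finJ: "finite J" and H_sub: "H \<subseteq> A \<times> J"
    and X: "X \<subseteq> A" and Y: "Y \<subseteq> J"
    and X_deg: "\<And>a. a \<in> X \<Longrightarrow> card (H `` {a}) = 2"
    and Y_deg: "\<And>j. j \<in> Y \<Longrightarrow> card (H\<inverse> `` {j}) = 2"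
    and XY: "H \<inter> X \<times> Y = {}"
    and matching_\<delta>: "matching {(a, j) \<in> H. a \<notin> X \<and> j \<notin> Y}"
begin

definition "\<delta> = {(a, j) \<in> H. a \<notin> X \<and> j \<notin> Y}"

lemma \<delta>_sub: "\<delta> \<subseteq> H" by (auto simp: \<delta>_def)

lemma finite_\<delta>: "finite \<delta>" using \<delta>_sub fin by (rule finite_subset)

lemma inj_\<delta>: "inj_on fst \<delta>" "inj_on snd \<delta>"
  using matching_\<delta> by (auto simp: matching_def \<delta>_def)

lemma finite_B: "finite B" and finite_R: "finite R"
  using fin H_eq by auto

lemma Image_H: "card (H `` {a}) = card (B `` {a}) + card (R `` {a})"
proof -
  have "H `` {a} = B `` {a} \<union> R `` {a}" "B `` {a} \<inter> R `` {a} = {}"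
    using H_eq disjoint by auto
  then show ?thesis using finite_B finite_R by (simp add: card_Un_disjoint finite_Image)
qed

lemma converse_Image_H: "card (H\<inverse> `` {j}) = card (B\<inverse> `` {j}) + card (R\<inverse> `` {j})"
proof -
  have "H\<inverse> `` {j} = B\<inverse> `` {j} \<union> R\<inverse> `` {j}" "B\<inverse> `` {j} \<inter> R\<inverse> `` {j} = {}"
    using H_eq disjoint by auto
  then show ?thesis using finite_B finite_R by (simp add: card_Un_disjoint finite_Image)
qed

lemma Image_H_le: "card (H `` {a}) \<le> 2"
  using degree[of "Inl a"] by (simp add: adjacent_Inl card_image)

lemma converse_Image_H_le: "card (H\<inverse> `` {j}) \<le> 2"
  using degree[of "Inr j"] by (simp add: adjacent_Inr card_image)

lemma card_R_le: "card (R `` {a}) \<le> 1"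
  by (rule card_Image_le_1[OF inj_on_fst_R finite_R])

lemma card_H: "card H = 2 * card X + 2 * card Y + card \<delta>"
proof -
  have finXY: "finite X" "finite Y" using X Y finA finJ finite_subset by auto
  have "H = \<delta> \<union> ({e \<in> H. fst e \<in> X} \<union> {e \<in> H. snd e \<in> Y})" by (auto simp: \<delta>_def)
  then have "card H = card (\<delta> \<union> ({e \<in> H. fst e \<in> X} \<union> {e \<in> H. snd e \<in> Y}))" by (rule arg_cong)
  also have "\<dots> = card \<delta> + card ({e \<in> H. fst e \<in> X} \<union> {e \<in> H. snd e \<in> Y})"
    using fin finite_\<delta> by (intro card_Un_disjoint) (auto simp: \<delta>_def)
  also have "card ({e \<in> H. fst e \<in> X} \<union> {e \<in> H. snd e \<in> Y})
      = card {e \<in> H. fst e \<in> X} + card {e \<in> H. snd e \<in> Y}"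
    using fin XY by (intro card_Un_disjoint) auto
  finally show ?thesis
    using X_deg Y_deg finXY fin by (simp add: card_edges_fst card_edges_snd)
qed

text \<open>
  No edge of \<open>H\<close> outside \<open>\<delta>\<close> meets two edges of \<open>\<delta>\<close>.  Hence the edges adjacent to those of \<open>\<delta>\<close> at
  their two ends are all distinct, and an end without such an edge is a leaf.
\<close>

lemma card_\<delta>_le:
  "3 * card \<delta> \<le> card H + card {a \<in> A. card (H `` {a}) = 1} + card {j \<in> J. card (H\<inverse> `` {j}) = 1}"
proof -
  let ?DA = "{a \<in> A. card (H `` {a}) = 1}" and ?DJ = "{j \<in> J. card (H\<inverse> `` {j}) = 1}"
  define PA where "PA = {e \<in> H - \<delta>. fst e \<in> fst ` \<delta>}"
  define PJ where "PJ = {e \<in> H - \<delta>. snd e \<in> snd ` \<delta>}"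
  have finP: "finite PA" "finite PJ" using fin by (auto simp: PA_def PJ_def)
  have "fst ` \<delta> \<subseteq> ?DA \<union> fst ` PA"
  proof clarsimp
    fix a j assume aj: "(a, j) \<in> \<delta>" and no: "a \<notin> fst ` PA"
    have "H `` {a} \<subseteq> {j}"
    proof clarsimp
      fix j' assume "(a, j') \<in> H"
      then have "(a, j') \<in> \<delta>" using aj no by (force simp: PA_def)
      then show "j' = j" using aj inj_on_fstD[OF inj_\<delta>(1)] by metis
    qed
    then have "H `` {a} = {j}" using aj \<delta>_sub by auto
    then show "a \<in> A \<and> card (H `` {a}) = Suc 0" using aj \<delta>_sub H_sub by auto
  qed
  then have "card (fst ` \<delta>) \<le> card (?DA \<union> fst ` PA)"
    using finP finA by (intro card_mono) auto
  also have "\<dots> \<le> card ?DA + card PA"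
    by (rule order_trans[OF card_Un_le]) (simp add: card_image_le finP)
  finally have A: "card \<delta> \<le> card ?DA + card PA" by (simp add: card_image inj_\<delta>)
  have "snd ` \<delta> \<subseteq> ?DJ \<union> snd ` PJ"
  proof clarsimp
    fix a j assume aj: "(a, j) \<in> \<delta>" and no: "j \<notin> snd ` PJ"
    have "H\<inverse> `` {j} \<subseteq> {a}"
    proof clarsimp
      fix a' assume "(a', j) \<in> H"
      then have "(a', j) \<in> \<delta>" using aj no by (force simp: PJ_def)
      then show "a' = a" using aj inj_on_sndD[OF inj_\<delta>(2)] by metis
    qed
    then have "H\<inverse> `` {j} = {a}" using aj \<delta>_sub by auto
    then show "j \<in> J \<and> card (H\<inverse> `` {j}) = Suc 0" using aj \<delta>_sub H_sub by auto
  qed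
  then have "card (snd ` \<delta>) \<le> card (?DJ \<union> snd ` PJ)"
    using finP finJ by (intro card_mono) auto
  also have "\<dots> \<le> card ?DJ + card PJ"
    by (rule order_trans[OF card_Un_le]) (simp add: card_image_le finP)
  finally have J: "card \<delta> \<le> card ?DJ + card PJ" by (simp add: card_image inj_\<delta>)
  \<comment> \<open>An edge in both sets has its ad outside \<open>X\<close> and its impression
    outside \<open>Y\<close>, so it would itself belong to \<open>\<delta>\<close>.\<close>
  have "PA \<inter> PJ = {}" by (auto simp: PA_def PJ_def \<delta>_def)
  moreover have "\<delta> \<inter> (PA \<union> PJ) = {}" by (auto simp: PA_def PJ_def)
  ultimately have "card (\<delta> \<union> (PA \<union> PJ)) = card \<delta> + (card PA + card PJ)"
    using finP finite_\<delta> by (simp add: card_Un_disjoint)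
  moreover have "card (\<delta> \<union> (PA \<union> PJ)) \<le> card H"
    using fin \<delta>_sub by (intro card_mono) (auto simp: PA_def PJ_def)
  ultimately show ?thesis using A J by linarith
qed

text \<open>Each colour occurs at most once at an impression, so two edges are one of each colour,
  and a lone edge is blue. This expresses the number of impression leaves, which
  \<open>card_\<delta>_le\<close> mentions, through the colours and hence through the classes of
  ads.\<close>

lemma card_B_eq: "card B = card R + card {j \<in> J. card (H\<inverse> `` {j}) = 1}"
proof -
  have "card (B\<inverse> `` {j}) = card (R\<inverse> `` {j}) + of_bool (card (H\<inverse> `` {j}) = 1)" for j
  proof -
    have "card (B\<inverse> `` {j}) = 1" if "card (H\<inverse> `` {j}) = 1"
    proof -
      obtain a where a: "H\<inverse> `` {j} = {a}" using \<open>card (H\<inverse> `` {j}) = 1\<close> by (rule card_1_singletonE)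
      have "(a, j) \<in> B" by (rule leaf_impression_blue) (use a in auto)
      then have "B\<inverse> `` {j} = {a}" using a H_eq by auto
      then show ?thesis by simp
    qed
    then show ?thesis
      using converse_Image_H[of j] converse_Image_H_le[of j]
        card_converse_Image_le_1[OF inj_on_snd_B finite_B, of j]
        card_converse_Image_le_1[OF inj_on_snd_R finite_R, of j]
      by (auto simp: of_bool_def)
  qed
  then have "(\<Sum>j\<in>J. card (B\<inverse> `` {j})) = (\<Sum>j\<in>J. card (R\<inverse> `` {j})) + (\<Sum>j\<in>J. of_bool (card (H\<inverse> `` {j}) = 1))"
    by (simp add: sum.distrib)
  moreover have "{e \<in> B. snd e \<in> J} = B" "{e \<in> R. snd e \<in> J} = R" using H_eq H_sub by auto
  ultimately show ?thesis
    using card_edges_snd[OF finite_B finJ] card_edges_snd[OF finite_R finJ] finJ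
    by (simp add: of_bool_def sum.If_cases Int_def)
qed

definition "cls b r = card {a \<in> A. card (B `` {a}) = b \<and> card (R `` {a}) = r}"

text \<open>Red degree at most one and total degree at most two leave five classes; the assumption
  on \<open>g\<close> removes the ads without edges.\<close>

lemma sum_classes:
  fixes g :: "nat \<Rightarrow> nat \<Rightarrow> real"
  assumes "g 0 0 = 0"
  shows "(\<Sum>a\<in>A. g (card (B `` {a})) (card (R `` {a})))
    = cls 1 1 * g 1 1 + cls 2 0 * g 2 0 + cls 1 0 * g 1 0 + cls 0 1 * g 0 1"
proof -
  let ?c = "\<lambda>b r a. of_bool (card (B `` {a}) = b \<and> card (R `` {a}) = r) :: real"
  have "g (card (B `` {a})) (card (R `` {a}))
      = ?c 1 1 a * g 1 1 + ?c 2 0 a * g 2 0 + ?c 1 0 a * g 1 0 + ?c 0 1 a * g 0 1" for a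
  proof -
    have "card (R `` {a}) \<le> 1" "card (B `` {a}) + card (R `` {a}) \<le> 2"
      using card_R_le Image_H[of a] Image_H_le[of a] by auto
    then consider "card (R `` {a}) = 0" "card (B `` {a}) = 0" | "card (R `` {a}) = 0" "card (B `` {a}) = 1"
      | "card (R `` {a}) = 0" "card (B `` {a}) = 2" | "card (R `` {a}) = 1" "card (B `` {a}) = 0"
      | "card (R `` {a}) = 1" "card (B `` {a}) = 1" by linarith
    then show ?thesis using assms by cases simp_all
  qed
  moreover have "(\<Sum>a\<in>A. ?c b r a) = cls b r" for b r
    using finA by (simp add: of_bool_def sum.If_cases cls_def Int_def)
  ultimately show ?thesis by (simp add: sum.distrib flip: sum_distrib_right)
qed

lemma cls_01_le: "cls 0 1 \<le> cls 1 0"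
proof -
  have "{a \<in> A. card (B `` {a}) = 0 \<and> card (R `` {a}) = 1} = {a. \<exists>j. H `` {a} = {j} \<and> (a, j) \<in> R}"
    (is "?L = ?L'")
  proof (intro equalityI subsetI)
    fix a assume "a \<in> ?L"
    then have e: "B `` {a} = {}" and c: "card (R `` {a}) = 1" using finite_B by (auto simp: finite_Image)
    from c obtain j where "R `` {a} = {j}" by (rule card_1_singletonE)
    then have "H `` {a} = {j} \<and> (a, j) \<in> R" using e H_eq by (auto simp: Un_Image)
    then show "a \<in> ?L'" by (intro CollectI exI)
  next
    fix a assume "a \<in> ?L'"
    then obtain j where j: "H `` {a} = {j}" "(a, j) \<in> R" by auto
    have only: "x = j" if "(a, x) \<in> B \<union> R" for x using that j(1) unfolding H_eq by blast
    have "B `` {a} = {}" using only j(2) disjoint by auto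
    moreover have "R `` {a} = {j}" using only j(2) by auto
    moreover have "a \<in> A" using j(2) H_eq H_sub by blast
    ultimately show "a \<in> ?L" by simp
  qed
  moreover have "{a \<in> A. card (B `` {a}) = 1 \<and> card (R `` {a}) = 0} = {a. \<exists>j. H `` {a} = {j} \<and> (a, j) \<in> B}"
    (is "?L = ?L'")
  proof (intro equalityI subsetI)
    fix a assume "a \<in> ?L"
    then have e: "R `` {a} = {}" and c: "card (B `` {a}) = 1" using finite_R by (auto simp: finite_Image)
    from c obtain j where "B `` {a} = {j}" by (rule card_1_singletonE)
    then have "H `` {a} = {j} \<and> (a, j) \<in> B" using e H_eq by (auto simp: Un_Image)
    then show "a \<in> ?L'" by (intro CollectI exI)
  next
    fix a assume "a \<in> ?L'"
    then obtain j where j: "H `` {a} = {j}" "(a, j) \<in> B" by auto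
    have only: "x = j" if "(a, x) \<in> B \<union> R" for x using that j(1) unfolding H_eq by blast
    have "R `` {a} = {}" using only j(2) disjoint by auto
    moreover have "B `` {a} = {j}" using only j(2) by auto
    moreover have "a \<in> A" using j(2) H_eq H_sub by blast
    ultimately show "a \<in> ?L" by simp
  qed
  moreover have "fst ` H \<subseteq> A" using H_sub by auto
  ultimately show ?thesis using card_red_leaves_le[OF finA] by (simp add: cls_def)
qed

lemma limit_inequality:
  "tsm_ratio * (real (card X) + real (card Y) + (1 - exp (-1)) * real (card \<delta>))
    \<le> (\<Sum>a\<in>A. 1 - (1 + card (R `` {a})) * exp (- real (card (B `` {a}) + card (R `` {a}))))"
proof -
  have "{e \<in> B. fst e \<in> A} = B" "{e \<in> R. fst e \<in> A} = R" using H_eq H_sub by auto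
  then have "card B = (\<Sum>a\<in>A. card (B `` {a}))" "card R = (\<Sum>a\<in>A. card (R `` {a}))"
    using card_edges_fst[OF finite_B finA] card_edges_fst[OF finite_R finA] by auto
  then have "real (card B) = (\<Sum>a\<in>A. real (card (B `` {a})))" "real (card R) = (\<Sum>a\<in>A. real (card (R `` {a})))"
    by simp_all
  then have cB: "real (card B) = real (cls 1 1) + 2 * real (cls 2 0) + real (cls 1 0)"
    and cR: "real (card R) = real (cls 1 1) + real (cls 0 1)"
    using sum_classes[of "\<lambda>b r. real b"] sum_classes[of "\<lambda>b r. real r"] by auto
  have cH: "card H = card B + card R"
    using H_eq disjoint finite_B finite_R by (simp add: card_Un_disjoint)
  have "real (card {a \<in> A. card (H `` {a}) = 1}) = (\<Sum>a\<in>A. of_bool (card (B `` {a}) + card (R `` {a}) = 1))"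
    using finA by (simp add: Image_H of_bool_def sum.If_cases Int_def)
  also have "\<dots> = real (cls 1 0) + real (cls 0 1)"
    using sum_classes[of "\<lambda>b r. of_bool (b + r = 1)"] by simp
  finally have cA: "real (card {a \<in> A. card (H `` {a}) = 1}) = real (cls 1 0) + real (cls 0 1)" .
  have 1: "0 \<le> real (cls 2 0)" "0 \<le> real (cls 0 1)" "real (cls 0 1) \<le> real (cls 1 0)"
    using cls_01_le by auto
  have 2: "3 * real (card \<delta>) \<le> 2 * real (cls 1 1) + 4 * real (cls 2 0) + 3 * real (cls 1 0) + real (cls 0 1)"
  proof -
    have "3 * real (card \<delta>) \<le> real (card H) + real (card {a \<in> A. card (H `` {a}) = 1})
        + real (card {j \<in> J. card (H\<inverse> `` {j}) = 1})"
      using card_\<delta>_le by linarith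
    \<comment> \<open>Together with \<open>card_B_eq\<close> below, the right-hand side becomes
      twice \<open>card B\<close> plus the number of ad leaves. Expanding both in classes gives the
      coefficients 2, 4, 3 and 1.\<close>
    moreover have "real (card B) = real (card R) + real (card {j \<in> J. card (H\<inverse> `` {j}) = 1})"
      using card_B_eq by linarith
    ultimately show ?thesis using cA cB cR cH by simp
  qed
  have 3: "2 * (real (card X) + real (card Y)) + real (card \<delta>)
      = 2 * real (cls 1 1) + 2 * real (cls 2 0) + real (cls 1 0) + real (cls 0 1)"
    using card_H cH cB cR by simp
  have "(\<Sum>a\<in>A. 1 - (1 + card (R `` {a})) * exp (- real (card (B `` {a}) + card (R `` {a}))))
      = cls 1 1 * (1 - 2 * exp (- 2)) + cls 2 0 * (1 - exp (- 2)) + cls 1 0 * (1 - exp (- 1)) + cls 0 1 * (1 - 2 * exp (- 1))"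
    by (subst sum_classes) simp_all
  also have "exp (- 2) = (exp (- 1) :: real)\<^sup>2" by (simp add: power2_eq_square flip: exp_add)
  finally show ?thesis using class_inequality[OF 1 2 3] by simp
qed

end

section \<open>The approximation ratio\<close>

lemma (in uniform_draws) E_card_hit_matching:
  assumes A: "finite A" and \<delta>: "\<delta> \<subseteq> A \<times> C" "inj_on fst \<delta>" and n: "n = card C"
  shows "E n (\<lambda>xs. real (card (hit \<delta> {} xs))) = card \<delta> * (1 - miss n 1 0)"
proof -
  have fin: "finite \<delta>" using \<delta>(1) A finite_C by (auto intro: finite_subset)
  have "E n (\<lambda>xs. real (card (hit \<delta> {} xs))) = (\<Sum>a\<in>A. 1 - miss n (card (\<delta> `` {a})) 0)"
    using E_card_hit[OF A _ _ _ n, of \<delta> "{}"] \<delta>(1) by simp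
  also have "\<dots> = (\<Sum>a\<in>A. card (\<delta> `` {a}) * (1 - miss n 1 0))"
  proof (intro sum.cong refl)
    fix a
    have "card (\<delta> `` {a}) = 0 \<or> card (\<delta> `` {a}) = 1"
      using card_Image_le_1[OF \<delta>(2) fin, of a] by linarith
    then show "1 - miss n (card (\<delta> `` {a})) 0 = card (\<delta> `` {a}) * (1 - miss n 1 0)"
      by (auto simp: miss_def)
  qed
  also have "\<dots> = real (\<Sum>a\<in>A. card (\<delta> `` {a})) * (1 - miss n 1 0)"
    by (simp add: sum_distrib_right)
  also have "(\<Sum>a\<in>A. card (\<delta> `` {a})) = card {e \<in> \<delta>. fst e \<in> A}"
    by (rule card_edges_fst[OF fin A, symmetric])
  also have "{e \<in> \<delta>. fst e \<in> A} = \<delta>" using \<delta>(1) by auto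
  finally show ?thesis .
qed

text \<open>A vertex of the coloured graph has only finitely many possible degree pairs, so a single
  threshold for \<open>n\<close> serves all instances and all ads.\<close>

lemma eventually_miss_close:
  assumes "\<eta> > 0"
  shows "\<forall>\<^sub>F n in sequentially. \<forall>d\<in>{1, 2}. \<forall>r\<in>{0, 1}. \<bar>miss n d r - (1 + r) * exp (- real d)\<bar> < \<eta>"
proof -
  have "\<forall>\<^sub>F n in sequentially. \<bar>miss n d r - (1 + r) * exp (- real d)\<bar> < \<eta>" for d r
    using tendstoD[OF tendsto_miss assms, of d r] by (simp add: dist_real_def)
  then show ?thesis by (intro eventually_ball_finite ballI) auto
qed

lemma prob_ge_compl:
  assumes "measure_pmf.prob M bad \<le> q" "\<And>x. x \<in> set_pmf M \<Longrightarrow> x \<notin> bad \<Longrightarrow> x \<in> good"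
  shows "measure_pmf.prob M good \<ge> 1 - q"
proof -
  have "measure_pmf.prob M (- good) \<le> measure_pmf.prob M bad"
    by (rule measure_pmf.finite_measure_mono_AE) (use assms(2) in \<open>auto simp: AE_measure_pmf_iff\<close>)
  then show ?thesis
    using assms(1) measure_pmf.prob_compl[of good M] by (simp add: Compl_eq_Diff_UNIV)
qed

lemma copy_edges_subset: "osm_instance G \<Longrightarrow> copy_edges G \<subseteq> ads G \<times> copies G"
  by (auto simp: osm_instance_def copy_edges_def copies_def)

text \<open>Every crossing edge of the copy graph carries flow, so the two descriptions of
  \<open>\<delta>\<close> agree: the one in the copy graph bounds the optimum, the one among
  coloured edges enters the counting.\<close>

lemma tsm_offline_cut:
  assumes G: "osm_instance G" and off: "tsm_offline G B R"
  obtains X Y \<delta> where "tsm_cut (B \<union> R) B R (ads G) (copies G) X Y"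
    "\<delta> = {(a, j) \<in> B \<union> R. a \<notin> X \<and> j \<notin> Y}" "\<delta> = {(a, j) \<in> copy_edges G. a \<notin> X \<and> j \<notin> Y}"
proof -
  obtain f where f: "integral_max_flow (ads G) (copies G) (copy_edges G) f"
    and col: "tsm_colouring (flow_edges f) B R"
    using off by (auto simp: tsm_offline_def)
  interpret tsm_integral_max_flow "ads G" "copies G" "copy_edges G" f
    by unfold_locales
      (use G finite_copies[OF G] copy_edges_subset[OF G] f in \<open>auto simp: osm_instance_def\<close>)
  have H: "H = B \<union> R" using col by (auto simp: tsm_colouring_def)
  interpret tsm_coloured H B R
  proof
    show "card {w. adjacent H v w} \<le> 2" for v
      using ad_degree_le imp_degree_le by (cases v) (simp_all add: adjacent_Inl adjacent_Inr card_image)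
  qed (use finite_H col in auto)
  obtain X Y where XY: "X \<subseteq> ads G" "Y \<subseteq> copies G"
    "\<And>a. a \<in> X \<Longrightarrow> card (H `` {a}) = 2" "\<And>j. j \<in> Y \<Longrightarrow> card (H\<inverse> `` {j}) = 2"
    "H \<inter> X \<times> Y = {}" "{(a, j) \<in> copy_edges G. a \<notin> X \<and> j \<notin> Y} \<subseteq> H"
    "matching {(a, j) \<in> copy_edges G. a \<notin> X \<and> j \<notin> Y}"
    by (rule obtain_cut) (rule that)
  have eq: "{(a, j) \<in> copy_edges G. a \<notin> X \<and> j \<notin> Y} = {(a, j) \<in> H. a \<notin> X \<and> j \<notin> Y}"
    using XY(6) H_subset_F by auto
  have "tsm_cut H B R (ads G) (copies G) X Y"
    by unfold_locales (use XY finA finJ H_subset in \<open>auto simp: eq\<close>)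
  then show ?thesis using that[of X Y] eq unfolding H by auto
qed

lemma tsm_concentration:
  fixes \<epsilon> c :: real
  assumes \<epsilon>: "\<epsilon> > 0" and c: "c > 0"
  shows "\<exists>\<kappa>>0. \<exists>N. \<forall>(G :: ('a, 'i) osm) B R.
    osm_instance G \<and> num G \<ge> N \<and> tsm_offline G B R \<longrightarrow>
    measure_pmf.prob (arrivals G)
      {xs. real (OPT G xs) \<ge> c * real (num G) \<longrightarrow>
        real (ALG B R xs) / real (OPT G xs) \<ge> tsm_ratio - \<epsilon>}
    \<ge> 1 - exp (- \<kappa> * real (num G))"
proof -
  let ?\<alpha> = tsm_ratio
  have \<alpha>: "0 \<le> ?\<alpha>" "?\<alpha> \<le> 1" using tsm_ratio_interval by auto
  \<comment> \<open>The error budget: \<open>t * n\<close> from the expected upper bound on the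
    optimum, \<open>2 * t * n\<close> from the expectation of the algorithm and \<open>t * n\<close>
    for the deviation. The total is \<open>\<epsilon> * c * n\<close>, which is at most
    \<open>\<epsilon>\<close> times the optimum.\<close>
  define t where "t = \<epsilon> * c / 4"
  have t: "t > 0" using \<epsilon> c by (simp add: t_def)
  \<comment> \<open>One draw changes the number of arrivals in \<open>Y\<close> by at most 1 and
    each of the two hit counts by at most 2. The sum is left in the shape that the rules for
    \<open>bounded_diff\<close> produce.\<close>
  define L where "L = \<bar>?\<alpha>\<bar> * (1 + 2) + \<bar>-1\<bar> * 2"
  have L: "L > 0" by (simp add: L_def add_nonneg_pos)
  obtain N where N: "\<And>n d r. n \<ge> N \<Longrightarrow> d \<in> {1, 2} \<Longrightarrow> r \<in> {0, 1} \<Longrightarrow>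
      \<bar>miss n d r - (1 + r) * exp (- real d)\<bar> < t"
    using eventually_miss_close[OF t] unfolding eventually_sequentially by blast
  define \<kappa> where "\<kappa> = t\<^sup>2 / (2 * L\<^sup>2)"
  have "1 - exp (- \<kappa> * real (num G)) \<le> measure_pmf.prob (arrivals G)
      {xs. real (OPT G xs) \<ge> c * real (num G) \<longrightarrow>
        real (ALG B R xs) / real (OPT G xs) \<ge> ?\<alpha> - \<epsilon>}"
    if G: "osm_instance G" and n: "num G \<ge> N" and off: "tsm_offline G B R"
    for G :: "('a, 'i) osm" and B R
  proof -
    define n where "n = num G"
    obtain X Y \<delta> where cut: "tsm_cut (B \<union> R) B R (ads G) (copies G) X Y"
      and \<delta>: "\<delta> = {(a, j) \<in> B \<union> R. a \<notin> X \<and> j \<notin> Y}" "\<delta> = {(a, j) \<in> copy_edges G. a \<notin> X \<and> j \<notin> Y}"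
      by (rule tsm_offline_cut[OF G off])
    interpret tsm_cut "B \<union> R" B R "ads G" "copies G" X Y by (rule cut)
    interpret uniform_draws "copies G"
      by unfold_locales (use G finite_copies copies_nonempty in auto)
    have \<delta>': "\<delta> = tsm_cut.\<delta> (B \<union> R) X Y" unfolding \<delta>_def by (rule \<delta>(1))
    have inj_d: "inj_on fst \<delta>" "inj_on snd \<delta>" "finite \<delta>" "\<delta> \<subseteq> B \<union> R"
      unfolding \<delta>' using inj_\<delta> finite_\<delta> \<delta>_sub by auto
    have cardC: "n = card (copies G)" using card_copies[OF G] by (simp add: n_def)
    have arr: "arrivals G = draws n" using arrivals_eq[OF G] by (simp add: n_def)
    have n0: "n > 0" using G by (simp add: n_def osm_instance_def)
    have finX: "finite X" using X finA by (rule finite_subset)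
    define ub where "ub xs = real (card X) + (real (length (filter (\<lambda>j. j \<in> Y) xs)) + real (card (hit \<delta> {} xs)))" for xs
    \<comment> \<open>Algorithm and bound are combined in one function, so a single tail estimate
      suffices, and \<open>limit_inequality\<close> bounds its expectation by a term of error
      order.\<close>
    define f where "f xs = ?\<alpha> * ub xs + (-1) * real (card (hit B R xs))" for xs
    have bd: "bounded_diff L f"
    proof -
      have "bounded_diff (0 + (1 + 2)) ub"
        unfolding ub_def
        by (intro bounded_diff_add bounded_diff_const bounded_diff_count bounded_diff_hit) (use inj_d in auto)
      then have "bounded_diff (1 + 2) ub" by (simp only: add_0)
      then show ?thesis
        unfolding f_def L_def
        by (intro bounded_diff_add bounded_diff_mult bounded_diff_hit inj_on_snd_B inj_on_snd_R finite_B finite_R)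
    qed
    have card_d: "real (card \<delta>) \<le> n"
    proof -
      have "card \<delta> = card (snd ` \<delta>)" by (rule card_image[symmetric, OF inj_d(2)])
      also have "\<dots> \<le> n" unfolding cardC using inj_d(4) H_sub finite_C by (intro card_mono) auto
      finally show ?thesis by simp
    qed
    have E_ub: "E n ub \<le> card X + card Y + (1 - exp (-1)) * card \<delta> + t * n"
    proof -
      have "E n ub = card X + (E n (\<lambda>xs. real (length (filter (\<lambda>j. j \<in> Y) xs))) + E n (\<lambda>xs. real (card (hit \<delta> {} xs))))"
        unfolding ub_def by (simp add: Bochner_Integration.integral_add[OF int int])
      also have "E n (\<lambda>xs. real (length (filter (\<lambda>j. j \<in> Y) xs))) = card Y"
        using E_count[OF Y, of n] n0 cardC by simp
      also have "E n (\<lambda>xs. real (card (hit \<delta> {} xs))) = card \<delta> * (1 - miss n 1 0)"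
        by (rule E_card_hit_matching[OF finA _ inj_d(1) cardC]) (use inj_d(4) H_sub in auto)
      also have "card \<delta> * (1 - miss n 1 0) \<le> card \<delta> * (1 - exp (-1) + t)"
        using N[of n 1 0] n by (intro mult_left_mono) (auto simp: n_def abs_less_iff)
      also have "\<dots> \<le> (1 - exp (-1)) * card \<delta> + t * n"
        using card_d t by (simp add: algebra_simps)
      finally show ?thesis by simp
    qed
    have E_hit: "(\<Sum>a\<in>ads G. 1 - (1 + card (R `` {a})) * exp (- real (card (B `` {a}) + card (R `` {a})))) - 2 * t * n
        \<le> E n (\<lambda>xs. real (card (hit B R xs)))"
    proof -
      let ?d = "\<lambda>a. card (B `` {a}) + card (R `` {a})"
      \<comment> \<open>The error is charged as \<open>t\<close> per edge. An ad without edges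
        contributes none, and the degrees add up to at most \<open>2 * n\<close>, whatever the
        number of ads.\<close>
      have "1 - (1 + card (R `` {a})) * exp (- real (?d a)) - t * ?d a
          \<le> 1 - miss n (?d a) (card (R `` {a}))" for a
      proof (cases "?d a = 0")
        case False
        have r: "card (R `` {a}) \<in> {0, 1}" using card_R_le[of a] by auto
        have d: "?d a \<in> {1, 2}" using False Image_H_le[of a] unfolding Image_H by auto
        have "t * 1 \<le> t * ?d a" using t False by (intro mult_left_mono) auto
        moreover have "\<bar>miss n (?d a) (card (R `` {a})) - (1 + card (R `` {a})) * exp (- real (?d a))\<bar> < t"
          using N[OF _ d r, of n] n by (simp add: n_def)
        ultimately show ?thesis unfolding abs_less_iff by linarith
      qed (simp add: miss_def)
      then have "(\<Sum>a\<in>ads G. 1 - (1 + card (R `` {a})) * exp (- real (?d a)) - t * ?d a)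
          \<le> (\<Sum>a\<in>ads G. 1 - miss n (?d a) (card (R `` {a})))" by (intro sum_mono)
      also have "\<dots> = E n (\<lambda>xs. real (card (hit B R xs)))"
        by (rule E_card_hit[OF finA H_sub disjoint card_R_le cardC, symmetric])
      also have "(\<Sum>a\<in>ads G. 1 - (1 + card (R `` {a})) * exp (- real (?d a)) - t * ?d a)
          = (\<Sum>a\<in>ads G. 1 - (1 + card (R `` {a})) * exp (- real (?d a))) - t * (\<Sum>a\<in>ads G. real (?d a))"
        by (simp only: sum_subtractf sum_distrib_left)
      also have "(\<Sum>a\<in>ads G. real (?d a)) = card (B \<union> R)"
      proof -
        have "{e \<in> B \<union> R. fst e \<in> ads G} = B \<union> R" using H_sub by auto
        then have "card (B \<union> R) = (\<Sum>a\<in>ads G. ?d a)"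
          using card_edges_fst[OF fin finA] by (simp only: Image_H)
        then show ?thesis by simp
      qed
      finally have "(\<Sum>a\<in>ads G. 1 - (1 + card (R `` {a})) * exp (- real (?d a))) - t * card (B \<union> R)
          \<le> E n (\<lambda>xs. real (card (hit B R xs)))" .
      moreover have "card (B \<union> R) \<le> 2 * n"
      proof -
        have "{e \<in> B \<union> R. snd e \<in> copies G} = B \<union> R" using H_sub by auto
        then have "card (B \<union> R) = (\<Sum>j\<in>copies G. card ((B \<union> R)\<inverse> `` {j}))"
          using card_edges_snd[OF fin finJ] by simp
        also have "\<dots> \<le> (\<Sum>j\<in>copies G. 2)" by (intro sum_mono converse_Image_H_le)
        finally show ?thesis by (simp add: cardC)
      qed
      then have "t * card (B \<union> R) \<le> t * (2 * n)" using t by (intro mult_left_mono) linarith+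
      ultimately show ?thesis by (simp add: algebra_simps)
    qed
    have E_f: "E n f \<le> 3 * t * n"
    proof -
      have "E n f = ?\<alpha> * E n ub + (-1) * E n (\<lambda>xs. real (card (hit B R xs)))"
        unfolding f_def by (simp add: Bochner_Integration.integral_diff[OF int int])
      moreover have "?\<alpha> * E n ub \<le> ?\<alpha> * (card X + card Y + (1 - exp (-1)) * card \<delta> + t * n)"
        using E_ub \<alpha> by (intro mult_left_mono)
      moreover have "?\<alpha> * (t * n) \<le> 1 * (t * n)" using \<alpha> t by (intro mult_right_mono) auto
      ultimately show ?thesis
        using E_hit limit_inequality[folded \<delta>'] by (simp add: algebra_simps)
    qed
    have tail: "measure_pmf.prob (arrivals G) {xs. f xs \<ge> E n f + t * n} \<le> exp (- \<kappa> * real (num G))"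
      using bounded_diff_tail[OF fin_pmf bd L t, of n] by (simp add: arr \<kappa>_def n_def)
    show ?thesis
    proof (rule prob_ge_compl[OF tail])
      fix xs assume xs: "xs \<in> set_pmf (arrivals G)" "xs \<notin> {xs. f xs \<ge> E n f + t * n}"
      have "real (ALG B R xs) / real (OPT G xs) \<ge> ?\<alpha> - \<epsilon>" if O: "real (OPT G xs) \<ge> c * real (num G)"
      proof -
        have sub: "set xs \<subseteq> copies G" using xs(1) by (simp add: set_arrivals[OF G])
        have "OPT G xs \<le> card X + length (filter (\<lambda>j. j \<in> Y) xs) + card (hit \<delta> {} xs)"
          using OPT_le_cut[OF G sub finX, of Y] inj_d(3) unfolding \<delta>(2) by simp
        then have "real (OPT G xs) \<le> ub xs" by (simp add: ub_def)
        then have "?\<alpha> * real (OPT G xs) \<le> ?\<alpha> * ub xs" using \<alpha> by (intro mult_left_mono)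
        moreover have "f xs < 4 * t * n" using xs(2) E_f by simp
        moreover have "ALG B R xs = card (hit B R xs)"
          by (rule ALG_eq_card_hit[OF inj_on_snd_B finite_B inj_on_snd_R finite_R])
        moreover have "4 * t * n \<le> \<epsilon> * real (OPT G xs)"
          using mult_left_mono[OF O, of \<epsilon>] \<epsilon> by (simp add: t_def n_def algebra_simps)
        ultimately have "(?\<alpha> - \<epsilon>) * real (OPT G xs) \<le> real (ALG B R xs)"
          unfolding f_def by (simp add: algebra_simps)
        moreover have "c * real (num G) > 0" using c n0 by (simp add: n_def)
        then have "real (OPT G xs) > 0" using O by linarith
        ultimately show ?thesis by (simp add: pos_le_divide_eq)
      qed
      then show "xs \<in> {xs. real (OPT G xs) \<ge> c * real (num G) \<longrightarrow>
          real (ALG B R xs) / real (OPT G xs) \<ge> ?\<alpha> - \<epsilon>}" by simp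
    qed
  qed
  moreover have "\<kappa> > 0" using t L by (simp add: \<kappa>_def)
  ultimately show ?thesis by blast
qed

section \<open>Tight instances\<close>

lemma bounded_diff_mono: "bounded_diff c f \<Longrightarrow> c \<le> d \<Longrightarrow> bounded_diff d f"
  unfolding bounded_diff_def by (meson add_left_mono order_trans)

lemma bounded_diff_lower_tail:
  fixes f :: "'x list \<Rightarrow> real"
  assumes fin: "finite (set_pmf p)" and bd: "bounded_diff c f" and c: "c > 0" and t: "t > 0"
  shows "measure_pmf.prob (replicate_pmf n p)
      {xs. f xs \<le> measure_pmf.expectation (replicate_pmf n p) f - t * real n}
    \<le> exp (- (t\<^sup>2 / (2 * c\<^sup>2)) * real n)"
proof -
  have "bounded_diff c (\<lambda>xs. - f xs)" using bounded_diff_mult[OF bd, of "-1"] by simp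
  from bounded_diff_tail[OF fin this c t, of n] show ?thesis
    by (simp add: algebra_simps)
qed

text \<open>Every vertex of the union has exactly one edge of each colour. So no vertex is a leaf,
  which excludes path components, and the cycles alternate.\<close>

lemma tsm_colouring_matchings:
  assumes B: "matching B" and R: "matching R" and disj: "B \<inter> R = {}"
    and ads: "fst ` B = fst ` R" and imps: "snd ` B = snd ` R"
  shows "tsm_colouring (B \<union> R) B R"
proof -
  let ?H = "B \<union> R"
  have other: "\<exists>w'. adjacent ?H v w' \<and> (edge_between v w' \<in> B \<longleftrightarrow> edge_between v w \<notin> B)"
    if "adjacent ?H v w" for v w
  proof (cases v)
    case (Inl a)
    with that obtain j where w: "w = Inr j" "(a, j) \<in> ?H" by (cases w) auto
    obtain j1 j2 where o: "(a, j1) \<in> B" "(a, j2) \<in> R"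
    proof -
      have "a \<in> fst ` B" "a \<in> fst ` R" using w ads by force+
      then show ?thesis using that by force
    qed
    show ?thesis
    proof (cases "(a, j) \<in> B")
      case True
      then show ?thesis using Inl w disj o by (intro exI[of _ "Inr j2"]) auto
    next
      case False
      then show ?thesis using Inl w disj o by (intro exI[of _ "Inr j1"]) auto
    qed
  next
    case (Inr j)
    with that obtain a where w: "w = Inl a" "(a, j) \<in> ?H" by (cases w) auto
    obtain a1 a2 where o: "(a1, j) \<in> B" "(a2, j) \<in> R"
    proof -
      have "j \<in> snd ` B" "j \<in> snd ` R" using w imps by force+
      then show ?thesis using that by force
    qed
    show ?thesis
    proof (cases "(a, j) \<in> B")
      case True
      then show ?thesis using Inr w disj o by (intro exI[of _ "Inl a2"]) auto
    next
      case False
      then show ?thesis using Inr w disj o by (intro exI[of _ "Inl a1"]) auto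
    qed
  qed
  have differ: "edge_between v w \<in> B \<longleftrightarrow> edge_between v w' \<notin> B"
    if "adjacent ?H v w" "adjacent ?H v w'" "w \<noteq> w'" for v w w'
  proof (cases v)
    case (Inl a)
    with that obtain j j' where "w = Inr j" "w' = Inr j'" "(a, j) \<in> ?H" "(a, j') \<in> ?H" "j \<noteq> j'"
      by (cases w; cases w') auto
    then show ?thesis
      using Inl B R disj inj_on_fstD[of B a j j'] inj_on_fstD[of R a j j'] by (auto simp: matching_def)
  next
    case (Inr j)
    with that obtain a a' where "w = Inl a" "w' = Inl a'" "(a, j) \<in> ?H" "(a', j) \<in> ?H" "a \<noteq> a'"
      by (cases w; cases w') auto
    then show ?thesis
      using Inr B R disj inj_on_sndD[of B a j a'] inj_on_sndD[of R a j a'] by (auto simp: matching_def)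
  qed
  have no_path: False if P: "path_component ?H vs" for vs
  proof -
    have len: "0 < length vs" "Suc 0 < length vs" using P unfolding path_component_def by linarith+
    have nb: "adjacent ?H (vs ! 0) w \<longleftrightarrow> w = vs ! Suc 0" for w
      using path_component_adjacent[OF P len(1), of w] len by simp
    then show False using other[of "vs ! 0" "vs ! Suc 0"] by auto
  qed
  have "alternating_cyclically B (cycle_edges vs)" if C: "cycle_component ?H vs" for vs
  proof -
    let ?n = "length vs" and ?es = "cycle_edges vs"
    have n: "3 \<le> ?n" "distinct vs" using C by (auto simp: cycle_component_def)
    have step: "?es ! k \<in> B \<longleftrightarrow> ?es ! (Suc k mod ?n) \<notin> B" if k: "k < ?n" for k
    proof -
      define p where "p = Suc k mod ?n"
      define q where "q = Suc p mod ?n"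
      have p: "p < ?n" unfolding p_def by (rule mod_less_divisor) (use k in auto)
      have q: "q < ?n" unfolding q_def by (rule mod_less_divisor) (use k in auto)
      have "k \<noteq> q" using n k by (auto simp: p_def q_def mod_Suc split: if_splits)
      then have "vs ! k \<noteq> vs ! q" using n k q nth_eq_iff_index_eq[of vs k q] by auto
      moreover have "adjacent ?H (vs ! p) (vs ! k)"
        using cycle_component_adjacent_Suc[OF C k] adjacent_sym[of ?H] by (auto simp: p_def)
      moreover have "adjacent ?H (vs ! p) (vs ! q)"
        using cycle_component_adjacent_Suc[OF C p] by (simp add: q_def)
      ultimately have "edge_between (vs ! p) (vs ! k) \<in> B \<longleftrightarrow> edge_between (vs ! p) (vs ! q) \<notin> B"
        using differ by blast
      moreover have "?es ! k = edge_between (vs ! p) (vs ! k)"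
        using k by (simp add: nth_cycle_edges p_def edge_between_commute)
      moreover have "?es ! p = edge_between (vs ! p) (vs ! q)"
        using p by (simp add: nth_cycle_edges q_def)
      ultimately show ?thesis by (simp add: p_def)
    qed
    have "?es ! k \<in> B \<longleftrightarrow> ?es ! Suc k \<notin> B" if "Suc k < ?n" for k
      using step[of k] that by simp
    then have alt: "alternating B ?es" by (auto simp: alternating_def successively_conv_nth)
    have "?es \<noteq> []" using n length_cycle_edges[of vs] by (auto simp del: length_cycle_edges)
    moreover have "?n - 1 < ?n" "Suc (?n - 1) = ?n" using n by linarith+
    then have "?es ! (?n - 1) \<in> B \<longleftrightarrow> ?es ! 0 \<notin> B" using step[of "?n - 1"] by simp
    ultimately have "last ?es \<in> B \<longleftrightarrow> hd ?es \<notin> B" by (simp add: last_conv_nth hd_conv_nth)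
    with alt show ?thesis by (simp add: alternating_cyclically_def)
  qed
  then show ?thesis using no_path disj unfolding tsm_colouring_def by blast
qed

fun flow_of :: "('a \<times> 'j) set \<Rightarrow> ('a, 'j) node \<Rightarrow> ('a, 'j) node \<Rightarrow> real" where
  "flow_of H Source (Ad a) = card (H `` {a})"
| "flow_of H (Ad a) (Imp j) = of_bool ((a, j) \<in> H)"
| "flow_of H (Imp j) Sink = card (H\<inverse> `` {j})"
| "flow_of H _ _ = 0"

text \<open>The flow along \<open>H\<close> has value \<open>card H\<close>, which equals the
  capacity of the cut given by \<open>X\<close> and \<open>Y\<close>; by weak duality no flow
  exceeds it.\<close>

lemma integral_max_flow_of:
  assumes fin: "finite A" "finite J" and H: "H \<subseteq> F" and F: "F \<subseteq> A \<times> J"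
    and deg: "\<And>a. card (H `` {a}) \<le> 2" "\<And>j. card (H\<inverse> `` {j}) \<le> 2"
    and X: "X \<subseteq> A" and Y: "Y \<subseteq> J"
    and card: "card H = 2 * card X + 2 * card Y + card {(a, j) \<in> F. a \<notin> X \<and> j \<notin> Y}"
  shows "integral_max_flow A J F (flow_of H)"
proof -
  let ?V = "tsm_nodes A J" and ?c = "tsm_cap A J F" and ?f = "flow_of H"
  have finH: "finite H" using H F fin by (meson finite_SigmaI finite_subset)
  have flow: "is_flow ?V ?c Source Sink ?f"
    unfolding is_flow_def
  proof (intro conjI allI ballI)
    fix u v
    have "H `` {a} = {}" if "a \<notin> A" for a using that H F by auto
    moreover have "H\<inverse> `` {j} = {}" if "j \<notin> J" for j using that H F by auto
    ultimately show "?f u v \<le> ?c u v" "0 \<le> ?f u v"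
      using deg H by (cases u; cases v; auto)+
  next
    fix v assume v: "v \<in> ?V - {Source, Sink}"
    show "(\<Sum>u\<in>?V. ?f u v) = (\<Sum>w\<in>?V. ?f v w)"
    proof (cases v)
      case (Ad a)
      have "H `` {a} = J \<inter> {j. (a, j) \<in> H}" using H F by auto
      then show ?thesis using Ad fin by (simp add: sum_tsm_nodes of_bool_def sum.If_cases)
    next
      case (Imp j)
      have "H\<inverse> `` {j} = A \<inter> {a. (a, j) \<in> H}" using H F by auto
      then show ?thesis using Imp fin by (simp add: sum_tsm_nodes of_bool_def sum.If_cases)
    qed (use v in auto)
  qed
  interpret f: tsm_flow A J F ?f by unfold_locales (use fin F flow in auto)
  have "{e \<in> H. fst e \<in> A} = H" using H F by auto
  then have "flow_value ?V Source ?f = card H"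
    using card_edges_fst[OF finH fin(1)] by (simp add: f.flow_value_eq)
  moreover have "flow_value ?V Source g \<le> card H" if "is_flow ?V ?c Source Sink g" for g
  proof -
    interpret g: tsm_flow A J F g by unfold_locales (use fin F that in auto)
    show ?thesis using g.flow_value_le_cut[OF X Y] card by simp
  qed
  moreover have "?f u v \<in> \<int>" for u v by (cases u; cases v) auto
  ultimately show ?thesis using flow by (auto simp: integral_max_flow_def is_max_flow_def)
qed

lemma flow_edges_flow_of: "flow_edges (flow_of H) = H"
  by (auto simp: flow_edges_def)

lemma matching_Un:
  assumes "matching M" "matching M'" "fst ` M \<inter> fst ` M' = {}" "snd ` M \<inter> snd ` M' = {}"
  shows "matching (M \<union> M')"
  using assms unfolding matching_def by (auto simp: inj_on_Un)

lemma complete_matching: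
  assumes "finite D" "finite P"
  obtains M where "M \<subseteq> D \<times> P" "matching M" "card M = min (card D) (card P)" "finite M"
proof -
  obtain P' where P': "P' \<subseteq> P" "card P' = min (card D) (card P)"
    by (metis min.cobounded2 obtain_subset_with_card_n)
  then have fP: "finite P'" using assms finite_subset by auto
  obtain g where g: "g ` P' \<subseteq> D" "inj_on g P'"
    using card_le_inj[OF fP assms(1)] P' by auto
  let ?M = "(\<lambda>k. (g k, k)) ` P'"
  have "matching ?M" using g by (auto simp: matching_def inj_on_def)
  moreover have "card ?M = card P'" by (rule card_image) (auto simp: inj_on_def)
  ultimately show ?thesis using that[of ?M] g P' fP by auto
qed

section \<open>The tight instances and their offline phase\<close>

definition core :: "nat \<Rightarrow> nat set" where
  "core m = {i. i < 4 * m \<and> i mod 4 \<noteq> 3}"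

text \<open>Rotates the positions 0, 1, 2 of a block. As type \<open>i\<close> gets the blue ad
  \<open>i\<close> and the red ad \<open>cyc i\<close>, the three types of a block trace a
  hexagon.\<close>

definition cyc :: "nat \<Rightarrow> nat" where
  "cyc i = (if i mod 4 = 2 then i - 2 else i + 1)"

definition tight_blue :: "nat \<Rightarrow> (nat \<times> (nat \<times> nat)) set" where
  "tight_blue m = (\<lambda>i. (i, (i, 0))) ` core m"

definition tight_red :: "nat \<Rightarrow> (nat \<times> (nat \<times> nat)) set" where
  "tight_red m = (\<lambda>i. (cyc i, (i, 0))) ` core m"

text \<open>
  Block \<open>c < m\<close> holds the ads and the types \<open>4 * c, \<dots>, 4 * c + 3\<close>, of which the first three form a
  cycle of length six.  The additional edges do not change the maximum flow, but let the optimum use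
  almost all ads \<open>4 * c + 1\<close> and almost all arrivals of types \<open>4 * c + 2\<close>.
\<close>

definition tight_edges :: "nat \<Rightarrow> (nat \<times> nat) set" where
  "tight_edges m = {(a, i). a < 4 * m \<and> i < 4 * m \<and>
     (i mod 4 \<noteq> 3 \<and> (a = i \<or> a = cyc i) \<or> a mod 4 = 1 \<and> i mod 4 = 3 \<or> a mod 4 = 3 \<and> i mod 4 = 2)}"

definition tight_osm :: "nat \<Rightarrow> (nat, nat) osm" where
  "tight_osm m = \<lparr>ads = {..<4 * m}, imps = {..<4 * m}, edges = tight_edges m, freq = (\<lambda>_. 1)\<rparr>"

text \<open>The edges crossing the cut given by the ads of residue 1 and the types of residue 2: in
  each hexagon the blue edge at type \<open>4 * c\<close> and the red edge at type
  \<open>4 * c + 1\<close>. They are every third edge of the hexagon, the extremal case of the bound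
  on \<open>\<delta>\<close>.\<close>

definition tight_\<delta> :: "nat \<Rightarrow> (nat \<times> (nat \<times> nat)) set" where
  "tight_\<delta> m = (\<lambda>i. (if i mod 4 = 0 then i else i + 1, (i, 0))) ` {i. i < 4 * m \<and> (i mod 4 = 0 \<or> i mod 4 = 1)}"

definition residue :: "nat \<Rightarrow> nat \<Rightarrow> nat set" where
  "residue m r = {i. i < 4 * m \<and> i mod 4 = r}"

lemma card_residue: "r < 4 \<Longrightarrow> card (residue m r) = m" and finite_residue: "finite (residue m r)"
proof -
  assume r: "r < 4"
  have "residue m r = (\<lambda>c. 4 * c + r) ` {..<m}"
  proof (intro equalityI subsetI)
    fix i assume "i \<in> residue m r"
    then have "i = 4 * (i div 4) + r" "i div 4 < m" by (auto simp: residue_def)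
    then show "i \<in> (\<lambda>c. 4 * c + r) ` {..<m}" by blast
  qed (use r in \<open>auto simp: residue_def\<close>)
  moreover have "inj_on (\<lambda>c. 4 * c + r) {..<m}" by (auto simp: inj_on_def)
  ultimately show "card (residue m r) = m" by (simp add: card_image)
qed (simp add: residue_def)

lemma card_two_residues:
  assumes "r < 4" "s < 4" "r \<noteq> s" shows "card (residue m r \<union> residue m s) = 2 * m"
  using assms finite_residue by (subst card_Un_disjoint) (auto simp: card_residue, auto simp: residue_def)

lemma finite_core: "finite (core m)"
  by (simp add: core_def)

lemma card_core: "card (core m) = 3 * m"
proof -
  have "i mod 4 = 0 \<or> i mod 4 = 1 \<or> i mod 4 = 2 \<or> i mod 4 = 3" for i :: nat by presburger
  then have "core m = (residue m 0 \<union> residue m 1) \<union> residue m 2"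
    by (fastforce simp: core_def residue_def)
  moreover have "(residue m 0 \<union> residue m 1) \<inter> residue m 2 = {}" by (auto simp: residue_def)
  ultimately show ?thesis
    using card_two_residues[of 0 1 m] finite_residue by (simp add: card_Un_disjoint card_residue)
qed

lemma mod_4_cases:
  fixes i :: nat
  obtains c where "i = 4 * c" | c where "i = 4 * c + 1" | c where "i = 4 * c + 2" | c where "i = 4 * c + 3"
proof -
  have "i = 4 * (i div 4) + i mod 4" "i mod 4 < 4" by auto
  then have "i = 4 * (i div 4) \<or> i = 4 * (i div 4) + 1 \<or> i = 4 * (i div 4) + 2 \<or> i = 4 * (i div 4) + 3"
    by linarith
  then show ?thesis using that by blast
qed

lemma cyc_core: "i \<in> core m \<Longrightarrow> cyc i \<in> core m"
  by (cases i rule: mod_4_cases) (auto simp: core_def cyc_def mod_Suc, presburger+)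

lemma cyc_neq: "cyc i \<noteq> i"
  unfolding cyc_def by (auto split: if_splits)

lemma inj_on_cyc: "inj_on cyc (core m)"
proof (rule inj_on_inverseI[of _ "\<lambda>a. if a mod 4 = 0 then a + 2 else a - 1"])
  fix i assume "i \<in> core m"
  then show "(if cyc i mod 4 = 0 then cyc i + 2 else cyc i - 1) = i"
    by (cases i rule: mod_4_cases) (auto simp: core_def cyc_def mod_Suc)
qed

lemma cyc_image: "cyc ` core m = core m"
  by (rule endo_inj_surj[OF finite_core _ inj_on_cyc]) (use cyc_core in auto)

lemma matching_blue: "matching (tight_blue m)" and matching_red: "matching (tight_red m)"
  using inj_onD[OF inj_on_cyc[of m]] by (auto simp: matching_def tight_blue_def tight_red_def inj_on_def)

lemma tight_disjoint: "tight_blue m \<inter> tight_red m = {}"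
  using cyc_neq by (auto simp: tight_blue_def tight_red_def)

lemma tight_fst: "fst ` tight_blue m = core m" "fst ` tight_red m = core m"
  using cyc_image by (auto simp: tight_blue_def tight_red_def image_image)

lemma tight_snd: "snd ` tight_blue m = (\<lambda>i. (i, 0)) ` core m" "snd ` tight_red m = (\<lambda>i. (i, 0)) ` core m"
  by (auto simp: tight_blue_def tight_red_def image_image)

lemma finite_tight: "finite (tight_blue m)" "finite (tight_red m)" "finite (tight_\<delta> m)"
  by (auto simp: tight_blue_def tight_red_def tight_\<delta>_def finite_core)

lemma tight_num: "num (tight_osm m) = 4 * m"
  by (simp add: num_def tight_osm_def)

lemma tight_instance: "m > 0 \<Longrightarrow> osm_instance (tight_osm m)"
  by (auto simp: osm_instance_def tight_num) (auto simp: tight_osm_def tight_edges_def)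

lemma tight_copies: "copies (tight_osm m) = (\<lambda>i. (i, 0)) ` {..<4 * m}"
  by (auto simp: copies_def tight_osm_def)

lemma tight_copy_edges: "copy_edges (tight_osm m) = (\<lambda>(a, i). (a, (i, 0))) ` tight_edges m"
  by (force simp: copy_edges_def tight_osm_def)

lemma tight_sub: "tight_blue m \<union> tight_red m \<subseteq> copy_edges (tight_osm m)"
proof -
  have "(i, i) \<in> tight_edges m" "(cyc i, i) \<in> tight_edges m" if "i \<in> core m" for i
    using that cyc_core[OF that] by (auto simp: tight_edges_def core_def)
  then show ?thesis by (force simp: tight_copy_edges tight_blue_def tight_red_def)
qed

lemma tight_card_le: "card (tight_blue m `` {a}) \<le> 1" "card (tight_red m `` {a}) \<le> 1"
  "card ((tight_blue m)\<inverse> `` {j}) \<le> 1" "card ((tight_red m)\<inverse> `` {j}) \<le> 1"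
  using matching_blue[of m] matching_red[of m] finite_tight
  by (auto intro!: card_Image_le_1 card_converse_Image_le_1 simp: matching_def simp del: One_nat_def)

lemma mem_tight_\<delta>: "(a, (i, l)) \<in> tight_\<delta> m \<longleftrightarrow>
    l = 0 \<and> i < 4 * m \<and> (i mod 4 = 0 \<or> i mod 4 = 1) \<and> a = (if i mod 4 = 0 then i else i + 1)"
  unfolding tight_\<delta>_def image_iff by (simp only: prod.inject mem_Collect_eq bex_simps Bex_def) auto

text \<open>Each additional edge has its ad in residue 1 or its type in residue 2, so only hexagon
  edges cross. The cut has capacity \<open>2 * m + 2 * m + 2 * m\<close>, the number of hexagon
  edges, which certifies the flow.\<close>

lemma tight_cut:
  "{(a, j) \<in> copy_edges (tight_osm m). a \<notin> residue m 1 \<and> j \<notin> (\<lambda>i. (i, 0)) ` residue m 2} = tight_\<delta> m"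
proof -
  have "(a, i) \<in> tight_edges m \<and> a \<notin> residue m 1 \<and> i \<notin> residue m 2
      \<longleftrightarrow> i < 4 * m \<and> (i mod 4 = 0 \<or> i mod 4 = 1) \<and> a = (if i mod 4 = 0 then i else i + 1)" for a i
    by (cases i rule: mod_4_cases) (auto simp: tight_edges_def residue_def cyc_def mod_Suc, presburger+)
  note key = this
  have "(a, (i, l)) \<in> copy_edges (tight_osm m) \<and> a \<notin> residue m 1 \<and> (i, l) \<notin> (\<lambda>i. (i, 0)) ` residue m 2
      \<longleftrightarrow> (a, (i, l)) \<in> tight_\<delta> m" for a i l
  proof -
    have 1: "(a, (i, l)) \<in> copy_edges (tight_osm m) \<longleftrightarrow> l = 0 \<and> (a, i) \<in> tight_edges m"
      by (auto simp: copy_edges_def tight_osm_def)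
    have 2: "(i, l) \<in> (\<lambda>i. (i, 0)) ` residue m 2 \<longleftrightarrow> l = 0 \<and> i \<in> residue m 2" by auto
    show ?thesis unfolding 1 2 mem_tight_\<delta> key[of a i, symmetric] by auto
  qed
  then show ?thesis by auto
qed

lemma inj_tight_\<delta>: "inj_on fst (tight_\<delta> m)" "inj_on snd (tight_\<delta> m)"
proof -
  show "inj_on fst (tight_\<delta> m)"
  proof (rule inj_on_inverseI[of _ "\<lambda>a. (a, (if a mod 4 = 0 then a else a - 1, 0))"])
    fix e assume "e \<in> tight_\<delta> m"
    then obtain i where i: "i mod 4 = 0 \<or> i mod 4 = 1" "e = (if i mod 4 = 0 then i else i + 1, (i, 0))"
      by (cases e) (auto simp: mem_tight_\<delta>)
    then show "(fst e, (if fst e mod 4 = 0 then fst e else fst e - 1, 0)) = e"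
      by (cases i rule: mod_4_cases) (auto simp: mod_Suc)
  qed
  show "inj_on snd (tight_\<delta> m)" by (auto simp: tight_\<delta>_def inj_on_def)
qed

lemma card_tight_\<delta>: "card (tight_\<delta> m) = 2 * m"
proof -
  have "{i. i < 4 * m \<and> (i mod 4 = 0 \<or> i mod 4 = 1)} = residue m 0 \<union> residue m 1"
    by (auto simp: residue_def)
  then show ?thesis
    using card_two_residues[of 0 1 m] by (simp add: tight_\<delta>_def card_image inj_on_def)
qed

lemma tight_offline:
  assumes m: "m > 0"
  shows "tsm_offline (tight_osm m) (tight_blue m) (tight_red m)"
proof -
  let ?H = "tight_blue m \<union> tight_red m"
  have col: "tsm_colouring ?H (tight_blue m) (tight_red m)"
    by (rule tsm_colouring_matchings[OF matching_blue matching_red tight_disjoint])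
      (simp_all add: tight_fst tight_snd)
  have "integral_max_flow (ads (tight_osm m)) (copies (tight_osm m)) (copy_edges (tight_osm m)) (flow_of ?H)"
  proof (rule integral_max_flow_of)
    show "?H \<subseteq> copy_edges (tight_osm m)" by (rule tight_sub)
    show "copy_edges (tight_osm m) \<subseteq> ads (tight_osm m) \<times> copies (tight_osm m)"
      by (rule copy_edges_subset[OF tight_instance[OF m]])
    show "card (?H `` {a}) \<le> 2" for a
      using card_Un_le[of "tight_blue m `` {a}" "tight_red m `` {a}"] tight_card_le(1,2)[of m a]
      by (simp add: Un_Image)
    show "card (?H\<inverse> `` {j}) \<le> 2" for j
      using card_Un_le[of "(tight_blue m)\<inverse> `` {j}" "(tight_red m)\<inverse> `` {j}"] tight_card_le(3,4)[of m j]
      by (simp add: Un_Image converse_Un)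
    show "residue m 1 \<subseteq> ads (tight_osm m)" by (auto simp: residue_def tight_osm_def)
    show "(\<lambda>i. (i, 0)) ` residue m 2 \<subseteq> copies (tight_osm m)" by (auto simp: residue_def tight_copies)
    have "card (tight_blue m) = 3 * m" "card (tight_red m) = 3 * m"
      by (simp_all add: tight_blue_def tight_red_def card_image inj_on_def card_core)
    then have "card ?H = 6 * m"
      using finite_tight tight_disjoint by (simp add: card_Un_disjoint)
    moreover have "card ((\<lambda>i. (i, 0 :: nat)) ` residue m 2) = m"
      by (simp add: card_image inj_on_def card_residue)
    ultimately show "card ?H = 2 * card (residue m 1) + 2 * card ((\<lambda>i. (i, 0 :: nat)) ` residue m 2)
        + card {(a, j) \<in> copy_edges (tight_osm m). a \<notin> residue m 1 \<and> j \<notin> (\<lambda>i. (i, 0)) ` residue m 2}"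
      unfolding tight_cut by (simp add: card_residue card_tight_\<delta>)
    show "finite (ads (tight_osm m))" by (simp add: tight_osm_def)
    show "finite (copies (tight_osm m))" by (simp add: tight_copies)
  qed
  then show ?thesis
    using col unfolding tsm_offline_def by (intro exI[of _ "flow_of ?H"]) (simp add: flow_edges_flow_of)
qed

text \<open>Three matchings without common vertices: ads of residue 1 with arrivals of residue 3,
  ads of residue 3 with arrivals of residue 2, and cut edges, which use ads of residues 0 and 2 and
  arrivals of residues 0 and 1. The first two live in bipartite graphs that are complete across
  blocks, so only the total numbers of arrivals matter and repeated types do no harm.\<close>

lemma tight_OPT_ge:
  assumes m: "m > 0" and xs: "set xs \<subseteq> copies (tight_osm m)"
  shows "min m (length (filter (\<lambda>j. j \<in> (\<lambda>i. (i, 0)) ` residue m 3) xs))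
    + min m (length (filter (\<lambda>j. j \<in> (\<lambda>i. (i, 0)) ` residue m 2) xs))
    + card (hit (tight_\<delta> m) {} xs) \<le> OPT (tight_osm m) xs"
proof -
  let ?res = "\<lambda>r. (\<lambda>i. (i, 0 :: nat)) ` residue m r"
  let ?P = "\<lambda>r. {k. k < length xs \<and> xs ! k \<in> ?res r}"
  have card_P: "card (?P r) = length (filter (\<lambda>j. j \<in> ?res r) xs)" for r
    by (simp add: length_filter_conv_card)
  obtain M1 where M1: "M1 \<subseteq> residue m 1 \<times> ?P 3" "matching M1" "card M1 = min m (card (?P 3))" "finite M1"
    using complete_matching[of "residue m 1" "?P 3"] finite_residue by (auto simp: card_residue)
  obtain M2 where M2: "M2 \<subseteq> residue m 3 \<times> ?P 2" "matching M2" "card M2 = min m (card (?P 2))" "finite M2"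
    using complete_matching[of "residue m 3" "?P 2"] finite_residue by (auto simp: card_residue)
  let ?h = "hit (tight_\<delta> m) {} xs"
  have "\<exists>k. k < length xs \<and> (a, xs ! k) \<in> tight_\<delta> m" if "a \<in> ?h" for a
    using that by (auto simp: hit_def in_set_conv_nth)
  then obtain pos where pos: "\<And>a. a \<in> ?h \<Longrightarrow> pos a < length xs \<and> (a, xs ! pos a) \<in> tight_\<delta> m" by metis
  define M3 where "M3 = (\<lambda>a. (a, pos a)) ` ?h"
  have M3: "matching M3" "card M3 = card ?h" "finite M3"
  proof -
    have "a = b" if "a \<in> ?h" "b \<in> ?h" "pos a = pos b" for a b
      using pos[OF that(1)] pos[OF that(2)] that(3) inj_on_sndD[OF inj_tight_\<delta>(2)] by metis
    then show "matching M3" by (auto simp: M3_def matching_def inj_on_def)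
    show "card M3 = card ?h" unfolding M3_def by (rule card_image) (auto simp: inj_on_def)
    show "finite M3" unfolding M3_def by (intro finite_imageI finite_hit) (simp_all add: finite_tight)
  qed
  have M3_sub: "a mod 4 \<noteq> 1 \<and> a mod 4 \<noteq> 3 \<and> k < length xs \<and>
      (\<exists>i. xs ! k = (i, 0) \<and> (i mod 4 = 0 \<or> i mod 4 = 1) \<and> (a, i) \<in> tight_edges m)"
    if ak: "(a, k) \<in> M3" for a k
  proof -
    have "k < length xs" "(a, xs ! k) \<in> tight_\<delta> m" using ak pos by (auto simp: M3_def)
    moreover from this obtain i where i: "xs ! k = (i, 0)" "i mod 4 = 0 \<or> i mod 4 = 1"
        "a = (if i mod 4 = 0 then i else i + 1)"
      by (cases "xs ! k") (auto simp: mem_tight_\<delta>)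
    moreover have "(a, xs ! k) \<in> copy_edges (tight_osm m)"
      using \<open>(a, xs ! k) \<in> tight_\<delta> m\<close> unfolding tight_cut[symmetric] by auto
    then have "(a, i) \<in> tight_edges m" using i by (auto simp: tight_copy_edges)
    moreover have "a mod 4 \<noteq> 1 \<and> a mod 4 \<noteq> 3"
      using i(2,3) by (cases i rule: mod_4_cases) (auto simp: mod_Suc)
    ultimately show ?thesis by auto
  qed
  let ?M = "M1 \<union> M2 \<union> M3"
  have "fst ` M1 \<inter> fst ` M2 = {}" "snd ` M1 \<inter> snd ` M2 = {}"
    using M1(1) M2(1) by (fastforce simp: residue_def)+
  then have M12: "matching (M1 \<union> M2)" by (intro matching_Un M1 M2)
  have "fst ` (M1 \<union> M2) \<inter> fst ` M3 = {}"
    using M1(1) M2(1) M3_sub by (fastforce simp: residue_def)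
  moreover have "snd ` (M1 \<union> M2) \<inter> snd ` M3 = {}"
  proof -
    have False if "(a, k) \<in> M1 \<union> M2" "(b, k) \<in> M3" for a b k
      using that M1(1) M2(1) M3_sub[OF that(2)] by (auto simp: residue_def)
    then show ?thesis by force
  qed
  ultimately have M: "matching ?M" by (intro matching_Un M12 M3)
  have "?M \<subseteq> realization (tight_osm m) xs"
  proof clarify
    fix a k assume "(a, k) \<in> ?M"
    then consider "(a, k) \<in> M1" | "(a, k) \<in> M2" | "(a, k) \<in> M3" by auto
    then show "(a, k) \<in> realization (tight_osm m) xs"
    proof cases
      case 1
      then show ?thesis
        using M1(1) by (auto simp: realization_def tight_osm_def tight_edges_def residue_def)
    next
      case 2
      then show ?thesis
        using M2(1) by (auto simp: realization_def tight_osm_def tight_edges_def residue_def)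
    next
      case 3
      then show ?thesis using M3_sub[OF 3] by (auto simp: realization_def tight_osm_def)
    qed
  qed
  then have "card ?M \<le> OPT (tight_osm m) xs" by (rule card_le_OPT[OF tight_instance[OF m] _ M])
  moreover have "card ?M = card M1 + card M2 + card M3"
  proof -
    have "M1 \<inter> M2 = {}" "(M1 \<union> M2) \<inter> M3 = {}"
      using \<open>fst ` M1 \<inter> fst ` M2 = {}\<close> \<open>fst ` (M1 \<union> M2) \<inter> fst ` M3 = {}\<close> by auto
    then show ?thesis using M1(4) M2(4) M3(3) by (simp add: card_Un_disjoint)
  qed
  ultimately show ?thesis using M1(3) M2(3) M3(2) by (simp add: card_P)
qed


section \<open>Concentration and expected ratio on the tight instances\<close>

abbreviation tight_count :: "nat \<Rightarrow> nat \<Rightarrow> (nat \<times> nat) list \<Rightarrow> nat" where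
  "tight_count m r xs \<equiv> length (filter (\<lambda>j. j \<in> (\<lambda>i. (i, 0)) ` residue m r) xs)"

definition tight_good :: "nat \<Rightarrow> real \<Rightarrow> (nat \<times> nat) list set" where
  "tight_good m t = {xs.
     real (tight_count m 3 xs) > m - t * real (4 * m) \<and>
     real (tight_count m 2 xs) > m - t * real (4 * m) \<and>
     real (card (hit (tight_\<delta> m) {} xs)) > 2 * m * (1 - miss (4 * m) 1 0) - t * real (4 * m) \<and>
     real (card (hit (tight_blue m) (tight_red m) xs)) < 3 * m * (1 - miss (4 * m) 2 1) + t * real (4 * m)}"

text \<open>A union bound over the four conditions. The counts of arrivals have difference 1,
  weakened to 2, so that all four tails share the exponent \<open>t^2 / (2 * 2^2)\<close>.\<close>

lemma tight_bad_le:
  assumes m: "m > 0" and t: "t > 0"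
  shows "measure_pmf.prob (arrivals (tight_osm m)) (- tight_good m t)
    \<le> 4 * exp (- (t\<^sup>2 / 8) * real (4 * m))"
proof -
  let ?C = "copies (tight_osm m)" and ?n = "4 * m"
  have G: "osm_instance (tight_osm m)" by (rule tight_instance[OF m])
  interpret uniform_draws ?C
    by unfold_locales (use G finite_copies copies_nonempty in auto)
  have cardC: "?n = card ?C" using card_copies[OF G] by (simp add: tight_num)
  have arr: "arrivals (tight_osm m) = draws ?n" using arrivals_eq[OF G] by (simp add: tight_num)
  have E_count: "E ?n (\<lambda>xs. real (tight_count m r xs)) = m" if "r < 4" for r
  proof -
    have "(\<lambda>i. (i, 0)) ` residue m r \<subseteq> ?C" by (auto simp: tight_copies residue_def)
    moreover have "card ((\<lambda>i. (i, 0 :: nat)) ` residue m r) = m"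
      using that by (simp add: card_image inj_on_def card_residue)
    ultimately show ?thesis using E_count[of "(\<lambda>i. (i, 0)) ` residue m r" ?n] m by (simp flip: cardC)
  qed
  have sub: "tight_\<delta> m \<subseteq> {..<?n} \<times> ?C" "tight_blue m \<union> tight_red m \<subseteq> {..<?n} \<times> ?C"
  proof -
    have "copy_edges (tight_osm m) \<subseteq> {..<?n} \<times> ?C"
      using copy_edges_subset[OF G] by (simp add: tight_osm_def)
    moreover have "tight_\<delta> m \<subseteq> copy_edges (tight_osm m)" unfolding tight_cut[symmetric] by auto
    ultimately show "tight_\<delta> m \<subseteq> {..<?n} \<times> ?C" "tight_blue m \<union> tight_red m \<subseteq> {..<?n} \<times> ?C"
      using tight_sub by blast+
  qed
  have E_drawn: "E ?n (\<lambda>xs. real (card (hit (tight_\<delta> m) {} xs))) = 2 * m * (1 - miss ?n 1 0)"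
    using E_card_hit_matching[OF _ sub(1) inj_tight_\<delta>(1) cardC] by (simp add: card_tight_\<delta>)
  have E_hit: "E ?n (\<lambda>xs. real (card (hit (tight_blue m) (tight_red m) xs))) = 3 * m * (1 - miss ?n 2 1)"
  proof -
    have one: "card (M `` {a}) = of_bool (a \<in> core m)"
      if "fst ` M = core m" "inj_on fst M" "finite M" for M :: "(nat \<times> nat \<times> nat) set" and a
    proof -
      have "M `` {a} = {} \<longleftrightarrow> a \<notin> core m" using that(1) by force
      then show ?thesis
        using card_Image_le_1[OF that(2,3), of a] that(3)
        by (cases "a \<in> core m") (auto simp: le_Suc_eq finite_Image)
    qed
    have B: "card (tight_blue m `` {a}) = of_bool (a \<in> core m)" for a
      by (rule one) (use tight_fst matching_blue finite_tight in \<open>auto simp: matching_def\<close>)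
    have R: "card (tight_red m `` {a}) = of_bool (a \<in> core m)" for a
      by (rule one) (use tight_fst matching_red finite_tight in \<open>auto simp: matching_def\<close>)
    have "E ?n (\<lambda>xs. real (card (hit (tight_blue m) (tight_red m) xs)))
        = (\<Sum>a<?n. 1 - miss ?n (card (tight_blue m `` {a}) + card (tight_red m `` {a})) (card (tight_red m `` {a})))"
      by (rule E_card_hit[OF _ sub(2) tight_disjoint tight_card_le(2) cardC]) simp
    also have "\<dots> = (\<Sum>a<?n. if a \<in> core m then 1 - miss ?n 2 1 else 0)"
      by (intro sum.cong refl) (simp add: B R miss_def)
    also have "\<dots> = card ({..<?n} \<inter> core m) * (1 - miss ?n 2 1)"
      by (simp add: sum.If_cases)
    also have "{..<?n} \<inter> core m = core m" by (auto simp: core_def)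
    finally show ?thesis by (simp add: card_core)
  qed
  let ?q = "exp (- (t\<^sup>2 / 8) * real ?n)"
  have b: "bounded_diff 2 (\<lambda>xs. real (length (filter P xs)))" for P :: "nat \<times> nat \<Rightarrow> bool"
    by (rule bounded_diff_mono[OF bounded_diff_count]) simp
  have bB: "bounded_diff 2 (\<lambda>xs. real (card (hit (tight_blue m) (tight_red m) xs)))"
    using matching_blue[of m] matching_red[of m] finite_tight
    by (intro bounded_diff_hit) (auto simp: matching_def)
  have bD: "bounded_diff 2 (\<lambda>xs. real (card (hit (tight_\<delta> m) {} xs)))"
    using inj_tight_\<delta> finite_tight by (intro bounded_diff_hit) auto
  define B1 where "B1 r = {xs. real (tight_count m r xs) \<le> m - t * real ?n}" for r
  define B3 where "B3 = {xs. real (card (hit (tight_\<delta> m) {} xs)) \<le> 2 * m * (1 - miss ?n 1 0) - t * real ?n}"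
  define B4 where "B4 = {xs. real (card (hit (tight_blue m) (tight_red m) xs)) \<ge> 3 * m * (1 - miss ?n 2 1) + t * real ?n}"
  have 1: "measure_pmf.prob (draws ?n) (B1 r) \<le> ?q" if "r < 4" for r
    using bounded_diff_lower_tail[OF fin_pmf b _ t, of ?n "\<lambda>j. j \<in> (\<lambda>i. (i, 0)) ` residue m r"]
    unfolding E_count[OF that] B1_def by simp
  have 3: "measure_pmf.prob (draws ?n) B3 \<le> ?q"
    using bounded_diff_lower_tail[OF fin_pmf bD _ t, of ?n] unfolding E_drawn B3_def by simp
  have 4: "measure_pmf.prob (draws ?n) B4 \<le> ?q"
    using bounded_diff_tail[OF fin_pmf bB _ t, of ?n] unfolding E_hit B4_def by simp
  have "- tight_good m t = B1 3 \<union> (B1 2 \<union> (B3 \<union> B4))"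
    by (auto simp: tight_good_def B1_def B3_def B4_def not_less)
  then have "measure_pmf.prob (arrivals (tight_osm m)) (- tight_good m t)
      = measure_pmf.prob (draws ?n) (B1 3 \<union> (B1 2 \<union> (B3 \<union> B4)))" by (simp only: arr)
  also have "\<dots> \<le> measure_pmf.prob (draws ?n) (B1 3) + (measure_pmf.prob (draws ?n) (B1 2) +
      (measure_pmf.prob (draws ?n) B3 + measure_pmf.prob (draws ?n) B4))"
    by (intro order_trans[OF measure_Un_le] add_left_mono) auto
  also have "\<dots> \<le> ?q + (?q + (?q + ?q))" by (intro add_mono 1 3 4) auto
  finally show ?thesis by simp
qed

text \<open>With \<open>T = t * m\<close>, the optimum loses at most \<open>14 * T\<close> against
  its limit: \<open>4 * T\<close> for each of three counts and \<open>2 * T\<close> for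
  \<open>miss\<close>. The algorithm gains at most \<open>7 * T\<close>. The sum
  \<open>21 * T\<close> fits under 24, and \<open>t \<le> 1 / 8\<close> keeps the optimum above
  \<open>m\<close>.\<close>

lemma tight_good_bounds:
  assumes m: "m > 0" and t: "t > 0" "t \<le> 1 / 8"
    and miss1: "\<bar>miss (4 * m) 1 0 - exp (-1)\<bar> < t"
    and miss2: "\<bar>miss (4 * m) 2 1 - 2 * exp (-2)\<bar> < t"
    and xs: "xs \<in> tight_good m t" "set xs \<subseteq> copies (tight_osm m)"
  shows "real m \<le> real (OPT (tight_osm m) xs)"
    and "real (ALG (tight_blue m) (tight_red m) xs) \<le> (tsm_ratio + 24 * t) * real (OPT (tight_osm m) xs)"
proof -
  define x where "x = exp (-1 :: real)"
  have x: "x < 36788 / 100000" using exp_minus_one_bounds by (simp add: x_def)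
  have x2: "exp (-2) = x\<^sup>2" by (simp add: x_def power2_eq_square flip: exp_add)
  define M where "M = real m"
  define T where "T = t * M"
  have M: "M > 0" "0 \<le> T" "T \<le> M / 8" using m t by (auto simp: M_def T_def)
  let ?opt = "real (OPT (tight_osm m) xs)" and ?alg = "real (ALG (tight_blue m) (tight_red m) xs)"
  have g: "real (tight_count m 3 xs) > M - 4 * T" "real (tight_count m 2 xs) > M - 4 * T"
    "real (card (hit (tight_\<delta> m) {} xs)) > 2 * M * (1 - miss (4 * m) 1 0) - 4 * T"
    "real (card (hit (tight_blue m) (tight_red m) xs)) < 3 * M * (1 - miss (4 * m) 2 1) + 4 * T"
    using xs(1) by (auto simp: tight_good_def M_def T_def algebra_simps)
  have "real (min m (tight_count m 3 xs)) + real (min m (tight_count m 2 xs))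
      + real (card (hit (tight_\<delta> m) {} xs)) \<le> ?opt"
    using tight_OPT_ge[OF m xs(2)] by (simp only: of_nat_add[symmetric] of_nat_le_iff)
  moreover have "real (min m (tight_count m 3 xs)) \<ge> M - 4 * T" "real (min m (tight_count m 2 xs)) \<ge> M - 4 * T"
    using g(1,2) M by (auto simp: min_def M_def)
  moreover have "M * (miss (4 * m) 1 0) \<le> M * (x + t)"
    using miss1 M by (intro mult_left_mono) (auto simp: x_def abs_less_iff)
  then have "2 * M * (1 - miss (4 * m) 1 0) \<ge> 2 * M - 2 * (M * x) - 2 * T"
    by (simp add: T_def algebra_simps)
  ultimately have opt: "?opt \<ge> 4 * M - 2 * (M * x) - 14 * T" using g(3) by linarith
  have "M * x \<le> M * (36788 / 100000)" using x M by (intro mult_left_mono) auto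
  then have "M \<le> ?opt" using opt M by linarith
  then show opt_ge: "real m \<le> ?opt" by (simp add: M_def)
  have "?alg = real (card (hit (tight_blue m) (tight_red m) xs))"
    using ALG_eq_card_hit[of "tight_blue m" "tight_red m" xs] matching_blue[of m] matching_red[of m]
    by (simp add: matching_def finite_tight)
  moreover have "M * (2 * x\<^sup>2 - t) \<le> M * (miss (4 * m) 2 1)"
    using miss2 M by (intro mult_left_mono) (auto simp: x2 abs_less_iff)
  then have "3 * M * (1 - miss (4 * m) 2 1) \<le> 3 * M * (1 - 2 * x\<^sup>2) + 3 * T"
    by (simp add: T_def algebra_simps)
  ultimately have "?alg \<le> 3 * M * (1 - 2 * x\<^sup>2) + 7 * T" using g(4) by linarith
  \<comment> \<open>Exact tightness: this is \<open>tsm_ratio_eq\<close> multiplied by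
    \<open>3 * M\<close>.\<close>
  also have "3 * M * (1 - 2 * x\<^sup>2) = tsm_ratio * (4 * M - 2 * (M * x))"
    unfolding x_def by (simp flip: tsm_ratio_eq) (simp add: algebra_simps)
  also have "\<dots> \<le> tsm_ratio * (?opt + 14 * T)"
    using opt tsm_ratio_interval by (intro mult_left_mono) auto
  also have "\<dots> \<le> tsm_ratio * ?opt + 14 * T"
    using mult_right_mono[of tsm_ratio 1 "14 * T"] tsm_ratio_interval M by (simp add: distrib_left)
  finally have "?alg \<le> tsm_ratio * ?opt + 21 * T" by simp
  moreover have "T \<le> t * ?opt" unfolding T_def using opt_ge t by (intro mult_left_mono) (auto simp: M_def)
  moreover have "0 \<le> t * ?opt" using t by simp
  moreover have "(tsm_ratio + 24 * t) * ?opt = tsm_ratio * ?opt + 24 * (t * ?opt)"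
    by (simp add: algebra_simps)
  ultimately show "?alg \<le> (tsm_ratio + 24 * t) * ?opt" by linarith
qed

lemma eventually_tight_miss:
  assumes "t > 0"
  shows "\<forall>\<^sub>F k in sequentially. \<bar>miss (4 * Suc k) 1 0 - exp (-1)\<bar> < t \<and> \<bar>miss (4 * Suc k) 2 1 - 2 * exp (-2)\<bar> < t"
proof -
  have "filterlim (\<lambda>k. 4 * Suc k) at_top sequentially"
    by (rule filterlim_at_top_mono[OF filterlim_ident]) auto
  from filterlim_iff[THEN iffD1, OF this, rule_format, OF eventually_miss_close[OF assms]]
  show ?thesis by eventually_elim auto
qed

lemma tight_OPT_prob:
  "\<exists>c>0. \<exists>\<kappa>>0. \<forall>\<^sub>F k in sequentially.
     measure_pmf.prob (arrivals (tight_osm (Suc k)))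
       {xs. real (OPT (tight_osm (Suc k)) xs) \<ge> c * real (num (tight_osm (Suc k)))}
     \<ge> 1 - exp (- \<kappa> * real (num (tight_osm (Suc k))))"
proof -
  define t :: real where "t = 1 / 8"
  define \<kappa> where "\<kappa> = t\<^sup>2 / 8"
  have t: "t > 0" "t \<le> 1 / 8" and \<kappa>: "\<kappa> > 0" by (auto simp: t_def \<kappa>_def)
  \<comment> \<open>Halving the exponent absorbs the factor 4 of the union bound.\<close>
  have ev: "\<forall>\<^sub>F k in sequentially. 4 * exp (- \<kappa> * real (4 * Suc k)) \<le> exp (- (\<kappa> / 2) * real (4 * Suc k))"
    using \<kappa> by real_asymp
  have "\<forall>\<^sub>F k in sequentially.
     measure_pmf.prob (arrivals (tight_osm (Suc k)))
       {xs. real (OPT (tight_osm (Suc k)) xs) \<ge> 1 / 4 * real (num (tight_osm (Suc k)))}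
     \<ge> 1 - exp (- (\<kappa> / 2) * real (num (tight_osm (Suc k))))"
    using ev eventually_tight_miss[OF t(1)]
  proof eventually_elim
    case (elim k)
    have "measure_pmf.prob (arrivals (tight_osm (Suc k))) (- tight_good (Suc k) t)
        \<le> exp (- (\<kappa> / 2) * real (num (tight_osm (Suc k))))"
      using tight_bad_le[of "Suc k" t] t elim(1) unfolding tight_num \<kappa>_def by linarith
    then show ?case
    proof (rule prob_ge_compl)
      fix xs assume "xs \<in> set_pmf (arrivals (tight_osm (Suc k)))" "xs \<notin> - tight_good (Suc k) t"
      then have "xs \<in> tight_good (Suc k) t" "set xs \<subseteq> copies (tight_osm (Suc k))"
        by (auto simp: set_arrivals tight_instance)
      from tight_good_bounds(1)[OF _ t _ _ this] elim(2)
      show "xs \<in> {xs. real (OPT (tight_osm (Suc k)) xs) \<ge> 1 / 4 * real (num (tight_osm (Suc k)))}"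
        by (simp add: tight_num)
    qed
  qed
  then show ?thesis using \<kappa> by (intro exI[of _ "1 / 4"] conjI exI[of _ "\<kappa> / 2"]) auto
qed

text \<open>Off the good event the ratio is at most the number \<open>4 * m\<close> of arrivals, and
  the exponentially small probability outweighs this factor.\<close>

lemma tight_expectation:
  assumes \<epsilon>: "\<epsilon> > 0"
  shows "\<forall>\<^sub>F k in sequentially.
    measure_pmf.expectation (arrivals (tight_osm (Suc k)))
      (\<lambda>xs. real (ALG (tight_blue (Suc k)) (tight_red (Suc k)) xs) / real (OPT (tight_osm (Suc k)) xs))
    \<le> tsm_ratio + \<epsilon>"
proof -
  \<comment> \<open>Chosen so that the error \<open>24 * t\<close> of
    \<open>tight_good_bounds\<close> is at most half of \<open>\<epsilon>\<close>; the other half is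
    left for the bad event.\<close>
  define t where "t = min (1 / 8) (\<epsilon> / 48)"
  define \<kappa> where "\<kappa> = t\<^sup>2 / 8"
  have t: "t > 0" "t \<le> 1 / 8" "24 * t \<le> \<epsilon> / 2" and \<kappa>: "\<kappa> > 0"
    using \<epsilon> by (auto simp: t_def \<kappa>_def min_def)
  have "(\<lambda>k. real (4 * Suc k) * (4 * exp (- \<kappa> * real (4 * Suc k)))) \<longlonglongrightarrow> 0"
    using \<kappa> by real_asymp
  then have ev: "\<forall>\<^sub>F k in sequentially. real (4 * Suc k) * (4 * exp (- \<kappa> * real (4 * Suc k))) < \<epsilon> / 2"
    using \<epsilon> by (intro order_tendstoD(2)[of _ 0]) auto
  show ?thesis
    using ev eventually_tight_miss[OF t(1)]
  proof eventually_elim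
    case (elim k)
    define m where "m = Suc k"
    let ?M = "arrivals (tight_osm m)"
    let ?ratio = "\<lambda>xs. real (ALG (tight_blue m) (tight_red m) xs) / real (OPT (tight_osm m) xs)"
    have G: "osm_instance (tight_osm m)" by (rule tight_instance) (simp add: m_def)
    have fin: "finite (set_pmf ?M)"
      by (simp add: arrivals_eq[OF G] finite_set_replicate_pmf finite_copies[OF G] copies_nonempty[OF G])
    have "measure_pmf.expectation ?M ?ratio
        \<le> measure_pmf.expectation ?M (\<lambda>xs. (tsm_ratio + \<epsilon> / 2) + real (4 * m) * indicator (- tight_good m t) xs)"
    proof (intro integral_mono_AE integrable_measure_pmf_finite fin AE_pmfI)
      fix xs assume "xs \<in> set_pmf ?M"
      then have xs: "set xs \<subseteq> copies (tight_osm m)" "length xs = 4 * m"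
        by (auto simp: set_arrivals[OF G] tight_num)
      show "?ratio xs \<le> (tsm_ratio + \<epsilon> / 2) + real (4 * m) * indicator (- tight_good m t) xs"
      proof (cases "xs \<in> tight_good m t")
        case True
        have "real m \<le> real (OPT (tight_osm m) xs)"
          "real (ALG (tight_blue m) (tight_red m) xs) \<le> (tsm_ratio + 24 * t) * real (OPT (tight_osm m) xs)"
          using tight_good_bounds[OF _ t(1,2) _ _ True xs(1)] elim(2) by (simp_all add: m_def)
        then have "?ratio xs \<le> tsm_ratio + 24 * t"
          by (simp add: m_def divide_le_eq)
        then show ?thesis using t(3) True by simp
      next
        case False
        have len: "length (tsm_online B R past T ys) = length ys" for B R past T and ys :: "(nat \<times> nat) list"
          by (induction ys arbitrary: past T) (simp_all add: Let_def)
        have "ALG (tight_blue m) (tight_red m) xs \<le> 4 * m"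
          unfolding ALG_def using len xs(2) length_filter_le by metis
        \<comment> \<open>If the optimum is 0, the quotient is 0 by the convention for division;
          otherwise the denominator is at least 1.\<close>
        moreover have "?ratio xs \<le> real (ALG (tight_blue m) (tight_red m) xs)"
          by (cases "OPT (tight_osm m) xs = 0") (auto simp: divide_le_eq mult_le_cancel_left1)
        ultimately show ?thesis using False tsm_ratio_interval \<epsilon> by simp
      qed
    qed
    also have "\<dots> = (tsm_ratio + \<epsilon> / 2) + real (4 * m) * measure_pmf.prob ?M (- tight_good m t)"
      by (subst Bochner_Integration.integral_add) (auto intro: integrable_measure_pmf_finite fin)
    also have "\<dots> \<le> (tsm_ratio + \<epsilon> / 2) + real (4 * m) * (4 * exp (- \<kappa> * real (4 * m)))"
      unfolding \<kappa>_def by (intro add_left_mono mult_left_mono tight_bad_le t) (auto simp: m_def)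
    also have "\<dots> \<le> tsm_ratio + \<epsilon>" using elim(1) by (simp add: m_def)
    finally show ?case by (simp add: m_def)
  qed
qed

theorem theorem3:
  shows
    "(\<forall>\<epsilon>>0. \<forall>c>0. \<exists>\<kappa>>0. \<exists>N. \<forall>(G :: ('a, 'i) osm) B R.
        osm_instance G \<and> num G \<ge> N \<and> tsm_offline G B R \<longrightarrow>
        measure_pmf.prob (arrivals G)
          {xs. real (OPT G xs) \<ge> c * real (num G) \<longrightarrow>
               real (ALG B R xs) / real (OPT G xs) \<ge> tsm_ratio - \<epsilon>}
        \<ge> 1 - exp (- \<kappa> * real (num G)))
     \<and> \<bar>tsm_ratio - 0.67029\<bar> \<le> 0.000005
     \<and> tsm_ratio > 1 - 1 / exp 1
     \<and> (\<exists>(G :: nat \<Rightarrow> (nat, nat) osm) B R.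
          (\<forall>k. osm_instance (G k) \<and> tsm_offline (G k) (B k) (R k)) \<and>
          filterlim (\<lambda>k. num (G k)) at_top sequentially \<and>
          (\<exists>c>0. \<exists>\<kappa>>0. \<forall>\<^sub>F k in sequentially.
             measure_pmf.prob (arrivals (G k)) {xs. real (OPT (G k) xs) \<ge> c * real (num (G k))}
             \<ge> 1 - exp (- \<kappa> * real (num (G k)))) \<and>
          (\<forall>\<epsilon>>0. \<forall>\<^sub>F k in sequentially.
             measure_pmf.expectation (arrivals (G k))
               (\<lambda>xs. real (ALG (B k) (R k) xs) / real (OPT (G k) xs))
             \<le> tsm_ratio + \<epsilon>))"
proof (intro conjI)
  show "\<forall>\<epsilon>>0. \<forall>c>0. \<exists>\<kappa>>0. \<exists>N. \<forall>(G :: ('a, 'i) osm) B R.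
      osm_instance G \<and> num G \<ge> N \<and> tsm_offline G B R \<longrightarrow>
      measure_pmf.prob (arrivals G)
        {xs. real (OPT G xs) \<ge> c * real (num G) \<longrightarrow>
             real (ALG B R xs) / real (OPT G xs) \<ge> tsm_ratio - \<epsilon>}
      \<ge> 1 - exp (- \<kappa> * real (num G))"
    by (intro allI impI tsm_concentration)
  \<comment> \<open>The index is shifted by \<open>Suc\<close> because \<open>tight_osm 0\<close>
    has no impressions and is not an instance.\<close>
  have "filterlim (\<lambda>k. num (tight_osm (Suc k))) at_top sequentially"
    unfolding tight_num by (rule filterlim_at_top_mono[OF filterlim_ident]) auto
  then show "\<exists>(G :: nat \<Rightarrow> (nat, nat) osm) B R.
      (\<forall>k. osm_instance (G k) \<and> tsm_offline (G k) (B k) (R k)) \<and>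
      filterlim (\<lambda>k. num (G k)) at_top sequentially \<and>
      (\<exists>c>0. \<exists>\<kappa>>0. \<forall>\<^sub>F k in sequentially.
         measure_pmf.prob (arrivals (G k)) {xs. real (OPT (G k) xs) \<ge> c * real (num (G k))}
         \<ge> 1 - exp (- \<kappa> * real (num (G k)))) \<and>
      (\<forall>\<epsilon>>0. \<forall>\<^sub>F k in sequentially.
         measure_pmf.expectation (arrivals (G k))
           (\<lambda>xs. real (ALG (B k) (R k) xs) / real (OPT (G k) xs))
         \<le> tsm_ratio + \<epsilon>)"
    using tight_instance tight_offline tight_OPT_prob tight_expectation
    by (intro exI[of _ "\<lambda>k. tight_osm (Suc k)"] exI[of _ "\<lambda>k. tight_blue (Suc k)"]
        exI[of _ "\<lambda>k. tight_red (Suc k)"] conjI) simp_all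
qed (rule tsm_ratio_approx tsm_ratio_gt)+

end
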